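(* Suppose $n$ is an odd integer with $t_2+t_3\leq n<t_1$, and put $K=k_1+k_2+k_3$, $N=\tfrac{n+1}{2}$. Then: (i) the $\mathfrak{BI}$-module $\mathscr M_n(x_2)\cap\mathscr M_n(x_3)$ is isomorphic to $W_1\oplus W_1$, where $W_1=E_{n-t_2-t_3}(k_1+k_3+N,\,-k_1-k_2-N,\,N)^{((-1,-1),(1\,3))}$; (ii) the $\mathfrak{BI}$-modules $\mathscr M_n(x_3)/(\mathscr M_n(x_2)\cap\mathscr M_n(x_3))$ and $\mathscr M_n/\mathscr M_n(x_2)$ are each isomorphic to $W_2\oplus W_2$, where $W_2=O_{t_2-1}(k_1,\,-K-n-1,\,k_3)^{(1\,3)}$; (iii) the $\mathfrak{BI}$-modules $\mathscr M_n(x_2)/(\mathscr M_n(x_2)\cap\mathscr M_n(x_3))$ and $\mathscr M_n/\mathscr M_n(x_3)$ are each isomorphic to $W_3\oplus W_3$, where $W_3=O_{t_3-1}(k_1,\,-K-n-1,\,k_2)^{(1\,3\,2)}$. Moreover, if $k_1\geq0$, then $W_1,W_2,W_3$ are irreducible and are isomorphic to $E_{n-t_2-t_3}(N,\,k_1+k_2+N,\,k_1+k_3+N)^{(1,-1)}$, $O_{t_2-1}(k_3,\,-K-n-1,\,k_1)$ and $O_{t_3-1}(k_2,\,k_1,\,-K-n-1)$, respectively.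
   Context: Fix real numbers $k_1,k_2,k_3$. For $i=1,2,3$ let $R_i$ be the operator on functions on $\mathbb R^3$ replacing $x_i$ by $-x_i$, and $T_if=\frac{\partial f}{\partial x_i}+k_i\frac{f-R_if}{x_i}$ (Dunkl operators). Let $\sigma_1=\begin{pmatrix}0&1\\1&0\end{pmatrix}$, $\sigma_2=\begin{pmatrix}0&-\sqrt{-1}\\ \sqrt{-1}&0\end{pmatrix}$, $\sigma_3=\begin{pmatrix}1&0\\0&-1\end{pmatrix}$, and let $e_i$ act on $\mathbb C^2$ by $\sigma_i$. Tensor products are over $\mathbb R$; $\mathbb R[\cdots]_m$ denotes homogeneous polynomials of degree $m$. Let $\mathbf D=e_1\otimes T_1+e_2\otimes T_2+e_3\otimes T_3$ and $\mathscr M_n=\ker(\mathbf D|_{\mathbb C^2\otimes\mathbb R[x_1,x_2,x_3]_n})$. For $i=1,2,3$ set $t_i=-2k_i$ if $2k_i$ is an odd negative integer, and $t_i=\infty$ otherwise. For $i=1,2,3$, $\mathscr M_n(x_i)=\mathscr M_n\cap\bigoplus_{j=t_i}^n\mathbb C^2\otimes(x_i^j\cdot\mathbb R[x_p,x_q]_{n-j})$ where $\{p,q\}=\{1,2,3\}\setminus\{i\}$ (it is $\{0\}$ if $n<t_i$); it is a $\mathfrak{BI}$-submodule of $\mathscr M_n$. $\mathfrak{BI}$ is the unital associative $\mathbb C$-algebra generated by $X,Y,Z$ with relations saying that $\{X,Y\}-Z$, $\{Y,Z\}-X$, $\{Z,X\}-Y$ commute with $X,Y,Z$ ($\{A,B\}=AB+BA$).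 $\mathscr M_n$ is a $\mathfrak{BI}$-module via $X=(\sqrt{-1}\,e_1\otimes(x_3T_2-x_2T_3)+\tfrac12)R_2R_3+k_2R_3+k_3R_2$, $Y=(\sqrt{-1}\,e_2\otimes(x_1T_3-x_3T_1)+\tfrac12)R_1R_3+k_3R_1+k_1R_3$, $Z=(\sqrt{-1}\,e_3\otimes(x_2T_1-x_1T_2)+\tfrac12)R_1R_2+k_1R_2+k_2R_1$, operators composed right to left, $R_i$ acting on the polynomial factor. Twisting: for a $\mathfrak{BI}$-module $V$ and algebra automorphism $\varepsilon$, $V^\varepsilon$ is $V$ with action $x\cdot v=\varepsilon(x)v$. A permutation $\sigma\in\mathfrak S_3$ denotes the automorphism sending the generator with index $i$ in $(X,Y,Z)$ to the generator with index $\sigma(i)$; the sign automorphisms are $(1,-1)\colon X\mapsto X,Y\mapsto -Y,Z\mapsto -Z$; $(-1,1)\colon X\mapsto -X,Y\mapsto Y,Z\mapsto -Z$; $(-1,-1)\colon X\mapsto -X,Y\mapsto -Y,Z\mapsto Z$; a pair $(\epsilon,\sigma)$ denotes the composite $\epsilon\circ\sigma$. For $a,b,c\in\mathbb C$ and an integer $d\geq0$, let $\theta_i=\frac{(-1)^i(2a-d+2i)}{2}$, $\theta^*_i=\frac{(-1)^i(2b-d+2i)}{2}$ ($0\le i\le d$). For odd $d$, $E_d(a,b,c)$ is the $\mathfrak{BI}$-module $\mathbb C^{d+1}$ in which, w.r.t. a basis $v_0,\dots,v_d$, $X$ acts by the lower bidiagonal matrix with diagonal $(\theta_i)$ and subdiagonal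 entries $1$, $Y$ by the upper bidiagonal matrix with diagonal $(\theta^*_i)$ and superdiagonal $(\varphi_1,\dots,\varphi_d)$ with $\varphi_i=i(d-i+1)$ ($i$ even), $\varphi_i=c^2-\frac{(2a+2b-d+2i-1)^2}{4}$ ($i$ odd), and $Z=\{X,Y\}-\big(c^2-a^2-b^2+\frac{(d+1)^2}{4}\big)$. For even $d$, $O_d(a,b,c)$ is defined in the same way but with $\varphi_i=\frac{i(d+1-2i-2a-2b-2c)}{2}$ ($i$ even), $\varphi_i=\frac{(i-d-1)(d+1-2i-2a-2b+2c)}{2}$ ($i$ odd), and $Z=\{X,Y\}-(2ab-c(d+1))$. *)

theory Defs
  imports Complex_Main "HOL-Library.Extended_Nat"
begin

text \<open>An element of C^2 (x)_R R[x1,x2,x3] is encoded by its coefficient function: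
  f (s,a,b,c) is the coefficient of e_s (x) x1^a x2^b x3^c, where s in {0,1} indexes
  the standard basis of C^2.\<close>

type_synonym pvec = "nat \<times> nat \<times> nat \<times> nat \<Rightarrow> complex"

definition expo :: "nat \<Rightarrow> nat \<times> nat \<times> nat \<times> nat \<Rightarrow> nat" where
  "expo i p = (case p of (s,a,b,c) \<Rightarrow> if i = 1 then a else if i = 2 then b else c)"

definition incr :: "nat \<Rightarrow> nat \<times> nat \<times> nat \<times> nat \<Rightarrow> nat \<times> nat \<times> nat \<times> nat" where
  "incr i p = (case p of (s,a,b,c) \<Rightarrow>
     if i = 1 then (s,a+1,b,c) else if i = 2 then (s,a,b+1,c) else (s,a,b,c+1))"

definition decr :: "nat \<Rightarrow> nat \<times> nat \<times> nat \<times> nat \<Rightarrow> nat \<times> nat \<times> nat \<times> nat" where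
  "decr i p = (case p of (s,a,b,c) \<Rightarrow>
     if i = 1 then (s,a-1,b,c) else if i = 2 then (s,a,b-1,c) else (s,a,b,c-1))"

definition Pdeg :: "nat \<Rightarrow> pvec set" where
  "Pdeg n = {f. \<forall>s a b c. f (s,a,b,c) \<noteq> 0 \<longrightarrow> s < 2 \<and> a + b + c = n}"

definition mulx :: "nat \<Rightarrow> pvec \<Rightarrow> pvec" where
  "mulx i f p = (if 1 \<le> expo i p then f (decr i p) else 0)"

definition refl :: "nat \<Rightarrow> pvec \<Rightarrow> pvec" where
  "refl i f p = (-1::complex) ^ (expo i p) * f p"

text \<open>Dunkl operator T_i with multiplicity function kk:
  T_i (x_i^m \<cdot> rest) = (m + k_i (1 - (-1)^m)) x_i^(m-1) \<cdot> rest.\<close>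
definition dunkl :: "(nat \<Rightarrow> real) \<Rightarrow> nat \<Rightarrow> pvec \<Rightarrow> pvec" where
  "dunkl kk i f p = (let m = expo i p + 1 in
      complex_of_real (real m + kk i * (1 - (-1) ^ m)) * f (incr i p))"

definition sig :: "nat \<Rightarrow> nat \<Rightarrow> nat \<Rightarrow> complex" where
  "sig j s t =
     (if j = 1 then (if (s,t) = (0,1) \<or> (s,t) = (1,0) then 1 else 0)
      else if j = 2 then (if (s,t) = (0,1) then - \<i> else if (s,t) = (1,0) then \<i> else 0)
      else if j = 3 then (if (s,t) = (0,0) then 1 else if (s,t) = (1,1) then -1 else 0)
      else 0)"

definition emat :: "nat \<Rightarrow> pvec \<Rightarrow> pvec" where
  "emat j f p = (\<Sum>t<2. sig j (fst p) t * f (t, snd p))"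

definition kfun :: "real \<Rightarrow> real \<Rightarrow> real \<Rightarrow> nat \<Rightarrow> real" where
  "kfun k1 k2 k3 i = (if i = 1 then k1 else if i = 2 then k2 else k3)"

definition Dop :: "real \<Rightarrow> real \<Rightarrow> real \<Rightarrow> pvec \<Rightarrow> pvec" where
  "Dop k1 k2 k3 f p = (\<Sum>j\<in>{1,2,3::nat}. emat j (dunkl (kfun k1 k2 k3) j f) p)"

definition Mn :: "real \<Rightarrow> real \<Rightarrow> real \<Rightarrow> nat \<Rightarrow> pvec set" where
  "Mn k1 k2 k3 n = {f \<in> Pdeg n. Dop k1 k2 k3 f = (\<lambda>_. 0)}"

definition tval :: "real \<Rightarrow> enat" where
  "tval k = (if \<exists>m::nat. odd m \<and> 2 * k = - real m then enat (nat \<lfloor>- 2 * k\<rfloor>) else \<infinity>)"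

definition Mnx :: "real \<Rightarrow> real \<Rightarrow> real \<Rightarrow> nat \<Rightarrow> nat \<Rightarrow> pvec set" where
  "Mnx k1 k2 k3 n i = {f \<in> Mn k1 k2 k3 n.
      \<forall>p. f p \<noteq> 0 \<longrightarrow> tval (kfun k1 k2 k3 i) \<le> enat (expo i p)}"

definition ang :: "(nat \<Rightarrow> real) \<Rightarrow> nat \<Rightarrow> nat \<Rightarrow> nat \<Rightarrow> pvec \<Rightarrow> pvec" where
  "ang kk i j l f = (let g = refl j (refl l f) in
     (\<lambda>p. \<i> * emat i (\<lambda>q. mulx l (dunkl kk j g) q - mulx j (dunkl kk l g) q) p
          + g p / 2 + complex_of_real (kk j) * refl l f p + complex_of_real (kk l) * refl j f p))"

text \<open>Generators X (index 1), Y (index 2), Z (index 3) of BI acting on polynomials.\<close>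
definition BIgen :: "real \<Rightarrow> real \<Rightarrow> real \<Rightarrow> nat \<Rightarrow> pvec \<Rightarrow> pvec" where
  "BIgen k1 k2 k3 i f =
     (if i = 1 then ang (kfun k1 k2 k3) 1 2 3 f
      else if i = 2 then ang (kfun k1 k2 k3) 2 3 1 f
      else if i = 3 then ang (kfun k1 k2 k3) 3 1 2 f
      else f)"

text \<open>A BI-module is represented by a complex subspace S of a coordinate space
  'i \<Rightarrow> complex together with the action of the generators: index 1 = X, 2 = Y, 3 = Z.\<close>
type_synonym 'i bimod = "('i \<Rightarrow> complex) set \<times> (nat \<Rightarrow> ('i \<Rightarrow> complex) \<Rightarrow> ('i \<Rightarrow> complex))"

definition lin_on :: "('i \<Rightarrow> complex) set \<Rightarrow> (('i \<Rightarrow> complex) \<Rightarrow> ('j \<Rightarrow> complex)) \<Rightarrow> bool" where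
  "lin_on S f \<longleftrightarrow> (\<forall>u\<in>S. \<forall>v\<in>S. f (\<lambda>x. u x + v x) = (\<lambda>y. f u y + f v y)) \<and>
                  (\<forall>c. \<forall>u\<in>S. f (\<lambda>x. c * u x) = (\<lambda>y. c * f u y))"

definition bimod_iso :: "'i bimod \<Rightarrow> 'j bimod \<Rightarrow> bool" where
  "bimod_iso M M' \<longleftrightarrow> (\<exists>f. lin_on (fst M) f \<and> bij_betw f (fst M) (fst M') \<and>
      (\<forall>i\<in>{1,2,3}. \<forall>v\<in>fst M. f (snd M i v) = snd M' i (f v)))"

text \<open>(fst M)/U is isomorphic to M': there is a surjective linear intertwining map
  from M onto M' whose kernel is exactly U (first isomorphism theorem).\<close>
definition quot_iso :: "'i bimod \<Rightarrow> ('i \<Rightarrow> complex) set \<Rightarrow> 'j bimod \<Rightarrow> bool" where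
  "quot_iso M U M' \<longleftrightarrow> (\<exists>f. lin_on (fst M) f \<and> f ` (fst M) = fst M' \<and>
      {v \<in> fst M. f v = (\<lambda>_. 0)} = U \<and>
      (\<forall>i\<in>{1,2,3}. \<forall>v\<in>fst M. f (snd M i v) = snd M' i (f v)))"

definition subspace_of :: "('i \<Rightarrow> complex) set \<Rightarrow> bool" where
  "subspace_of U \<longleftrightarrow> (\<lambda>_. 0) \<in> U \<and> (\<forall>u\<in>U. \<forall>v\<in>U. (\<lambda>x. u x + v x) \<in> U) \<and>
                    (\<forall>c. \<forall>u\<in>U. (\<lambda>x. c * u x) \<in> U)"

definition bimod_irreducible :: "'i bimod \<Rightarrow> bool" where
  "bimod_irreducible M \<longleftrightarrow> fst M \<noteq> {\<lambda>_. 0} \<and>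
     (\<forall>U \<subseteq> fst M. subspace_of U \<and> (\<forall>i\<in>{1,2,3}. \<forall>v\<in>U. snd M i v \<in> U)
        \<longrightarrow> U = {\<lambda>_. 0} \<or> U = fst M)"

definition dsum2 :: "'i bimod \<Rightarrow> ('i + 'i) bimod" where
  "dsum2 M = ({w. (\<lambda>x. w (Inl x)) \<in> fst M \<and> (\<lambda>x. w (Inr x)) \<in> fst M},
      \<lambda>i w y. case y of Inl x \<Rightarrow> snd M i (\<lambda>x. w (Inl x)) x
                      | Inr x \<Rightarrow> snd M i (\<lambda>x. w (Inr x)) x)"

text \<open>Twisting by the automorphism eps o sigma, where sigma permutes the generator
  indices and eps multiplies the generator with index j by sg j:
  the generator with index i acts as sg (sigma i) times the original generator sigma i.\<close>
definition twist :: "(nat \<Rightarrow> complex) \<Rightarrow> (nat \<Rightarrow> nat) \<Rightarrow> 'i bimod \<Rightarrow> 'i bimod" where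
  "twist sg \<sigma> M = (fst M, \<lambda>i v y. sg (\<sigma> i) * snd M (\<sigma> i) v y)"

definition sgnaut :: "complex \<Rightarrow> complex \<Rightarrow> nat \<Rightarrow> complex" where
  "sgnaut e1 e2 i = (if i = 1 then e1 else if i = 2 then e2 else if i = 3 then e1 * e2 else 1)"

definition perm13 :: "nat \<Rightarrow> nat" where
  "perm13 i = (if i = 1 then 3 else if i = 3 then 1 else i)"

definition perm132 :: "nat \<Rightarrow> nat" where
  "perm132 i = (if i = 1 then 3 else if i = 3 then 2 else if i = 2 then 1 else i)"

definition bidiag :: "nat \<Rightarrow> (nat \<Rightarrow> complex) \<Rightarrow> (nat \<Rightarrow> complex) \<Rightarrow> (nat \<Rightarrow> complex)
     \<Rightarrow> complex \<Rightarrow> nat bimod" where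
  "bidiag d th ths phi zc =
    (let Xo = (\<lambda>v j. if j \<le> d then th j * v j + (if 1 \<le> j then v (j - 1) else 0) else 0);
         Yo = (\<lambda>v j. if j \<le> d then ths j * v j + (if j < d then phi (j + 1) * v (j + 1) else 0) else 0)
     in ({v. \<forall>j>d. v j = 0},
         \<lambda>i. if i = 1 then Xo else if i = 2 then Yo
             else if i = 3 then (\<lambda>v j. Xo (Yo v) j + Yo (Xo v) j - zc * v j)
             else (\<lambda>v. v)))"

definition thetaL :: "complex \<Rightarrow> nat \<Rightarrow> nat \<Rightarrow> complex" where
  "thetaL a d i = (-1) ^ i * (2 * a - of_nat d + 2 * of_nat i) / 2"

definition Emod :: "complex \<Rightarrow> complex \<Rightarrow> complex \<Rightarrow> nat \<Rightarrow> nat bimod" where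
  "Emod a b c d = bidiag d (thetaL a d) (thetaL b d)
     (\<lambda>i. if even i then of_nat (i * (d - i + 1))
          else c ^ 2 - (2 * a + 2 * b - of_nat d + 2 * of_nat i - 1) ^ 2 / 4)
     (c ^ 2 - a ^ 2 - b ^ 2 + (of_nat d + 1) ^ 2 / 4)"

definition Omod :: "complex \<Rightarrow> complex \<Rightarrow> complex \<Rightarrow> nat \<Rightarrow> nat bimod" where
  "Omod a b c d = bidiag d (thetaL a d) (thetaL b d)
     (\<lambda>i. if even i then of_nat i * (of_nat d + 1 - 2 * of_nat i - 2 * a - 2 * b - 2 * c) / 2
          else (of_nat i - of_nat d - 1) * (of_nat d + 1 - 2 * of_nat i - 2 * a - 2 * b + 2 * c) / 2)
     (2 * a * b - c * (of_nat d + 1))"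

end

theory Submission
  imports Defs "HOL-Library.Function_Algebras"
begin

text \<open>
  Since n < t1, the Dunkl--Dirac equation determines an element of M_n from its restriction to x1 = 0, and
  every pair of homogeneous polynomials of degree n in x2, x3 occurs as such a restriction.  On
  restrictions the generators commute with e_1, so M_n splits into two isomorphic copies, one for each
  eigenvalue of e_1.  In the basis x2^b x3^(n-b) the generator Z is lower and Y is upper bidiagonal.  The
  off-diagonal entries vanish where b = t2 or n - b = t3 is crossed; this produces the submodules, and
  rescaling the basis turns the three blocks into W_1, W_2, W_3.

  For k1 >= 0, a module of type E or O is generated by an eigenvector of its second generator; so a
  homomorphism out of it exists as soon as the target has an eigenvector with the first eigenvalue
  and the second generator of the target avoids finitely many eigenvalues.  Irreducibility makes such
  a homomorphism injective, and equality of dimensions makes it bijective.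
\<close>

section \<open>Bidiagonal modules\<close>

text \<open>In the basis x2^b x3^(n-b) the entries degenerate only through Dunkl operators: T_2
  kills x2^t2 and T_3 kills x3^t3. At the cut b = t2 only the entry of Y vanishes, at the cut n - b
  = t3 only that of Z. The matrices are therefore block triangular but not block diagonal, which is
  why the outer blocks appear as quotients. X is merely tridiagonal there and has to play the third
  generator; this forces the permutations (1 3) and (1 3 2), the latter because the last block is
  read by increasing powers of x3. The middle block starts at the odd exponent t2, which reverses
  the signs of Y and Z; this is the sign twist (-1,-1). The isomorphisms for k1 >= 0 compare a
  bidiagonal generator with a tridiagonal one, so no rescaling of the basis gives them. They are
  possible because the scalars by which the central elements act are permuted along with (a,b,c)
  and, for type E, are even in b, so that source and target satisfy the same relations. The bounds
  on the parameters that follow from k1 >= 0 keep the relevant eigenvalues apart.\<close>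

definition coords :: "nat \<Rightarrow> (nat \<Rightarrow> complex) set" where
  "coords d = {v. \<forall>j>d. v j = 0}"

abbreviation bidiag_op :: "nat \<Rightarrow> (nat \<Rightarrow> complex) \<Rightarrow> (nat \<Rightarrow> complex) \<Rightarrow> (nat \<Rightarrow> complex) \<Rightarrow> complex
    \<Rightarrow> nat \<Rightarrow> (nat \<Rightarrow> complex) \<Rightarrow> (nat \<Rightarrow> complex)" where
  "bidiag_op d th ths phi z \<equiv> snd (bidiag d th ths phi z)"

lemma fst_bidiag: "fst (bidiag d th ths phi z) = coords d"
  by (simp add: bidiag_def coords_def Let_def)

lemma bidiag_op1: "bidiag_op d th ths phi z (Suc 0) v j =
    (if j \<le> d then th j * v j + (if j = 0 then 0 else v (j - 1)) else 0)"
  by (simp add: bidiag_def Let_def)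

lemma bidiag_op2: "bidiag_op d th ths phi z 2 v j =
    (if j \<le> d then ths j * v j + (if j < d then phi (Suc j) * v (Suc j) else 0) else 0)"
  by (simp add: bidiag_def Let_def)

lemma bidiag_op3: "bidiag_op d th ths phi z 3 v j =
    bidiag_op d th ths phi z (Suc 0) (bidiag_op d th ths phi z 2 v) j
      + bidiag_op d th ths phi z 2 (bidiag_op d th ths phi z (Suc 0) v) j - z * v j"
  by (simp add: bidiag_def Let_def)

definition zcoef :: "(nat \<Rightarrow> complex) \<Rightarrow> (nat \<Rightarrow> complex) \<Rightarrow> (nat \<Rightarrow> complex) \<Rightarrow> complex
    \<Rightarrow> nat \<Rightarrow> complex" where
  "zcoef th ths phi z i = 2 * th i * ths i + phi i + phi (Suc i) - z"

lemma bidiag_op3_row: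
  assumes "phi 0 = 0" "phi (Suc d) = 0" "v \<in> coords d" "j \<le> d"
  shows "bidiag_op d th ths phi z 3 v j = zcoef th ths phi z j * v j
     + (if j = 0 then 0 else (ths (j - 1) + ths j) * v (j - 1))
     + phi (Suc j) * (th j + th (Suc j)) * v (Suc j)"
proof (cases j)
  case 0
  show ?thesis
  proof (cases "d = 0")
    case True
    then show ?thesis using assms 0 by (simp add: bidiag_op3 bidiag_op2 bidiag_op1 zcoef_def coords_def algebra_simps)
  next
    case False
    then show ?thesis using assms 0 by (simp add: bidiag_op3 bidiag_op2 bidiag_op1 zcoef_def coords_def algebra_simps)
  qed
next
  case (Suc k)
  show ?thesis
  proof (cases "j < d")
    case True
    then show ?thesis using assms Suc by (simp add: bidiag_op3 bidiag_op2 bidiag_op1 zcoef_def coords_def algebra_simps)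
  next
    case False
    then have "j = d" using assms by simp
    then show ?thesis using assms Suc by (simp add: bidiag_op3 bidiag_op2 bidiag_op1 zcoef_def coords_def algebra_simps)
  qed
qed

text \<open>Scalar identities that imply the Bannai--Ito relations {X,Y} = Z + z3, {Y,Z} = X + z1,
  {Z,X} = Y + z2 for bidiagonal X and Y; zcoef is the diagonal of Z.\<close>

locale bi_seq =
  fixes d :: nat and th ths phi :: "nat \<Rightarrow> complex" and z1 z2 z3 :: complex
  assumes th_step: "\<And>i. th (Suc i) = - th i - (-1) ^ i"
    and ths_step: "\<And>i. ths (Suc i) = - ths i - (-1) ^ i"
    and phi0: "phi 0 = 0" and phid: "phi (Suc d) = 0"
    and zcoef_step: "\<And>i. zcoef th ths phi z3 (Suc i) = - 1 - zcoef th ths phi z3 i"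
    and zcoef_th: "\<And>i. 2 * zcoef th ths phi z3 i * th i + (-1) ^ i * (phi i - phi (Suc i)) = ths i + z2"
    and zcoef_ths: "\<And>i. 2 * zcoef th ths phi z3 i * ths i + (-1) ^ i * (phi i - phi (Suc i)) = th i + z1"
begin

abbreviation "B \<equiv> bidiag_op d th ths phi z3"
abbreviation "zz \<equiv> zcoef th ths phi z3"

lemma B_closed: "i \<in> {1,2,3} \<Longrightarrow> v \<in> coords d \<Longrightarrow> B i v \<in> coords d"
  by (auto simp: coords_def bidiag_op1 bidiag_op2 bidiag_op3)

lemma B1_row: "j \<le> d \<Longrightarrow> B (Suc 0) v j = th j * v j + (if j = 0 then 0 else v (j - 1))"
  by (simp add: bidiag_op1)

lemma B2_row: "j \<le> d \<Longrightarrow> B 2 v j = ths j * v j + phi (Suc j) * v (Suc j)"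
  using phid by (auto simp: bidiag_op2 not_less)

lemma B3_row: "j \<le> d \<Longrightarrow> v \<in> coords d \<Longrightarrow> B 3 v j = zz j * v j
     - (if j = 0 then 0 else (-1) ^ (j - 1) * v (j - 1)) - (-1) ^ j * phi (Suc j) * v (Suc j)"
  using phi0 phid by (cases j) (simp_all add: bidiag_op3_row th_step ths_step algebra_simps)

text \<open>Row \<open>Suc j\<close> lies outside the matrix when \<open>j = d\<close>. The factor
  \<open>phi (Suc j)\<close> is zero there, so the row formulas can be used for all
  \<open>j \<le> d\<close> without a case distinction.\<close>

lemma phi_B1: "j \<le> d \<Longrightarrow> phi (Suc j) * B (Suc 0) v (Suc j) = phi (Suc j) * (th (Suc j) * v (Suc j) + v j)"
  using phid by (cases "j = d") (auto simp: bidiag_op1)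

lemma phi_B2: "j \<le> d \<Longrightarrow> phi (Suc j) * B 2 v (Suc j) =
    phi (Suc j) * (ths (Suc j) * v (Suc j) + phi (Suc (Suc j)) * v (Suc (Suc j)))"
  using phid by (cases "j = d") (auto simp: B2_row)

lemma phi_B3: "j \<le> d \<Longrightarrow> v \<in> coords d \<Longrightarrow> phi (Suc j) * B 3 v (Suc j) =
    phi (Suc j) * (zz (Suc j) * v (Suc j) - (-1) ^ j * v j + (-1) ^ j * phi (Suc (Suc j)) * v (Suc (Suc j)))"
  using phid by (cases "j = d") (auto simp: B3_row)

lemma anticomm12: "B (Suc 0) (B 2 v) j + B 2 (B (Suc 0) v) j = B 3 v j + z3 * v j"
  by (simp add: bidiag_op3)

text \<open>Entrywise comparison. The off-diagonal entries of Z alternate in sign, so the entry two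
  places below the diagonal cancels; \<open>zcoef_step\<close> removes the entry just below the
  diagonal, and \<open>zcoef_th\<close> is the diagonal itself.\<close>

lemma anticomm13:
  assumes v: "v \<in> coords d"
  shows "B (Suc 0) (B 3 v) j + B 3 (B (Suc 0) v) j = B 2 v j + z2 * v j"
proof (cases "j \<le> d")
  case False
  then show ?thesis using v B_closed[of "Suc 0" v] B_closed[of 3 v]
    by (simp add: bidiag_op1 bidiag_op2 bidiag_op3 coords_def)
next
  case j: True
  have cl: "B (Suc 0) v \<in> coords d" using B_closed[of "Suc 0" v] v by simp
  have E: "(-1::complex) ^ j * (-1) ^ j = 1" by (simp flip: power_mult_distrib)
  have p: "phi (Suc j) * B (Suc 0) v (Suc j) = phi (Suc j) * (th (Suc j) * v (Suc j) + v j)"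
    by (rule phi_B1[OF j])
  show ?thesis
  proof (cases j)
    case 0
    show ?thesis
      using p zcoef_th[of 0] by (simp add: B1_row B2_row B3_row v cl 0 th_step phi0) algebra
  next
    case (Suc k)
    have k: "k \<le> d" using j Suc by simp
    have pk: "(-1::complex) ^ k * (-1) ^ k = 1" by (simp flip: power_mult_distrib)
    have r: "B (Suc 0) (B 3 v) j = th j * B 3 v j + B 3 v k" using j Suc by (simp add: B1_row)
    have r2: "B 3 v j = zz j * v j - (-1) ^ k * v k + (-1) ^ k * phi (Suc j) * v (Suc j)"
      using j Suc v by (simp add: B3_row)
    have r3: "B 3 v k = zz k * v k
     - (if k = 0 then 0 else (-1) ^ (k - 1) * v (k - 1)) - (-1) ^ k * phi j * v j"
      using j Suc v by (simp add: B3_row)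
    have r4: "B 3 (B (Suc 0) v) j = zz j * (th j * v j + v k)
        - (-1) ^ k * (th k * v k + (if k = 0 then 0 else v (k - 1)))
        + (-1) ^ k * (phi (Suc j) * (th (Suc j) * v (Suc j) + v j))"
      using j k Suc v cl by (simp add: B3_row phi_B1[symmetric] mult.assoc) (simp add: B1_row)
    have e: "(if k = 0 then 0 else (-1) ^ (k - 1) * v (k - 1)) = - ((-1) ^ k) * (if k = 0 then 0 else v (k - 1))"
      by (cases k) auto
    have t1: "th j = - th k - (-1) ^ k" "th (Suc j) = - th j + (-1) ^ k"
      using Suc th_step[of k] th_step[of j] by simp_all
    have t2: "zz j = - 1 - zz k" using Suc zcoef_step[of k] by simp
    have t3: "2 * zz j * th j - (-1) ^ k * (phi j - phi (Suc j)) = ths j + z2"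
      using Suc zcoef_th[of j] by simp
    \<comment> \<open>\<open>s\<close> and \<open>a\<close> hide the power of -1 and the boundary
      case \<open>k = 0\<close>, so that a polynomial identity modulo \<open>s * s = 1\<close> is
      left.\<close>
    define s a where "s = (-1::complex) ^ k" and "a = (if k = 0 then 0 else v (k - 1))"
    show ?thesis unfolding r r2 r3 r4 e B2_row[OF j]
      using t1 t2 t3 pk unfolding s_def[symmetric] a_def[symmetric] by algebra
  qed
qed

lemma anticomm23:
  assumes v: "v \<in> coords d"
  shows "B 2 (B 3 v) j + B 3 (B 2 v) j = B (Suc 0) v j + z1 * v j"
proof (cases "j \<le> d")
  case False
  then show ?thesis using v B_closed[of 2 v] B_closed[of 3 v]
    by (simp add: bidiag_op1 bidiag_op2 bidiag_op3 coords_def)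
next
  case j: True
  have cl: "B 2 v \<in> coords d" using B_closed[of 2 v] v by simp
  have pj: "(-1::complex) ^ j * (-1) ^ j = 1" by (simp flip: power_mult_distrib)
  have cl3: "B 3 v \<in> coords d" using B_closed[of 3 v] v by simp
  have r1: "B 2 (B 3 v) j = ths j * B 3 v j + phi (Suc j) *
     (zz (Suc j) * v (Suc j) - (-1) ^ j * v j + (-1) ^ j * phi (Suc (Suc j)) * v (Suc (Suc j)))"
    unfolding B2_row[OF j, of "B 3 v"] phi_B3[OF j v] ..
  have r2: "B 3 (B 2 v) j = zz j * B 2 v j
     - (if j = 0 then 0 else (-1) ^ (j - 1) * B 2 v (j - 1)) - (-1) ^ j *
     (phi (Suc j) * (ths (Suc j) * v (Suc j) + phi (Suc (Suc j)) * v (Suc (Suc j))))"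
    by (simp only: B3_row[OF j cl] phi_B2[OF j, symmetric] mult.assoc)
  have r3: "(if j = 0 then 0 else (-1) ^ (j - 1) * B 2 v (j - 1)) =
    - ((-1) ^ j) * ((if j = 0 then 0 else ths (j - 1) * v (j - 1)) + phi j * v j)"
    using j by (cases j) (auto simp: B2_row phi0)
  have r4: "(if j = 0 then 0 else (-1) ^ (j - 1) * v (j - 1)) =
    - ((-1) ^ j) * (if j = 0 then 0 else v (j - 1))" by (cases j) auto
  have r5: "(if j = 0 then 0 else ths (j - 1) * v (j - 1)) = (- ths j + (-1) ^ j) * (if j = 0 then 0 else v (j - 1))"
    by (cases j) (auto simp: ths_step)
  define s a where "s = (-1::complex) ^ j" and "a = (if j = 0 then 0 else v (j - 1))"
  show ?thesis
    unfolding r1 r2 r3 r5 unfolding B3_row[OF j v] B2_row[OF j] B1_row[OF j] r4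
    using ths_step[of j] zcoef_step[of j] zcoef_ths[of j] pj
    unfolding s_def[symmetric] a_def[symmetric] by algebra
qed

end

section \<open>Homomorphisms and irreducibility\<close>

lemma lin_on_add: "lin_on S f \<Longrightarrow> u \<in> S \<Longrightarrow> v \<in> S \<Longrightarrow> f (\<lambda>x. u x + v x) = (\<lambda>y. f u y + f v y)"
  by (simp add: lin_on_def)

lemma lin_on_scale: "lin_on S f \<Longrightarrow> u \<in> S \<Longrightarrow> f (\<lambda>x. c * u x) = (\<lambda>y. c * f u y)"
  by (simp add: lin_on_def)

lemma lin_on_comb:
  assumes "lin_on S f" "subspace_of S" "u \<in> S" "v \<in> S"
  shows "f (\<lambda>x. a * u x + b * v x) = (\<lambda>y. a * f u y + b * f v y)"
proof -
  have "(\<lambda>x. a * u x) \<in> S" "(\<lambda>x. b * v x) \<in> S" using assms by (auto simp: subspace_of_def)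
  then show ?thesis using assms by (simp add: lin_on_add[OF assms(1)] lin_on_scale[OF assms(1)])
qed

lemma subspace_of_comb: "subspace_of S \<Longrightarrow> u \<in> S \<Longrightarrow> v \<in> S \<Longrightarrow> (\<lambda>x. a * u x + b * v x) \<in> S"
  by (simp add: subspace_of_def)

lemma subspace_of_sum:
  assumes "subspace_of S" "finite I" "\<And>i. i \<in> I \<Longrightarrow> g i \<in> S"
  shows "(\<lambda>x. \<Sum>i\<in>I. c i * g i x) \<in> S"
  using assms(2,3)
proof (induction I rule: finite_induct)
  case empty
  then show ?case using assms by (simp add: subspace_of_def)
next
  case (insert i I)
  have "(\<lambda>x. c i * g i x + 1 * (\<Sum>i\<in>I. c i * g i x)) \<in> S"
    by (rule subspace_of_comb) (use insert assms in auto)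
  then show ?case using insert by simp
qed

lemma lin_on_sum:
  assumes "lin_on S f" "subspace_of S" "finite I" "\<And>i. i \<in> I \<Longrightarrow> g i \<in> S"
  shows "f (\<lambda>x. \<Sum>i\<in>I. c i * g i x) = (\<lambda>y. \<Sum>i\<in>I. c i * f (g i) y)"
  using assms(3,4)
proof (induction I rule: finite_induct)
  case empty
  have "(\<lambda>_. 0) \<in> S" using assms by (simp add: subspace_of_def)
  from lin_on_scale[OF assms(1) this, of 0] show ?case by simp
next
  case (insert i I)
  have "f (\<lambda>x. c i * g i x + 1 * (\<Sum>i\<in>I. c i * g i x))
      = (\<lambda>y. c i * f (g i) y + 1 * f (\<lambda>x. \<Sum>i\<in>I. c i * g i x) y)"
    by (rule lin_on_comb[OF assms(1,2)])
      (use insert assms in \<open>auto intro!: subspace_of_sum\<close>)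
  then show ?case using insert by simp
qed

section \<open>Coordinate spaces and bijectivity from injectivity\<close>

lemma subspace_coords: "subspace_of (coords d)"
  by (auto simp: subspace_of_def coords_def)

definition unit_at :: "nat \<Rightarrow> nat \<Rightarrow> complex" where
  "unit_at i j = (if i = j then 1 else 0)"

lemma unit_at_coords: "i \<le> d \<Longrightarrow> unit_at i \<in> coords d"
  by (auto simp: unit_at_def coords_def)

lemma coords_expand: "v \<in> coords d \<Longrightarrow> v = (\<lambda>x. \<Sum>i\<le>d. v i * unit_at i x)"
proof
  fix x
  assume v: "v \<in> coords d"
  have "(\<Sum>i\<le>d. v i * unit_at i x) = (\<Sum>i\<le>d. if i = x then v i else 0)"
    by (rule sum.cong) (auto simp: unit_at_def)
  then show "v x = (\<Sum>i\<le>d. v i * unit_at i x)" using v by (auto simp: coords_def)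
qed

text \<open>Dimension count: the images of the \<open>Suc d\<close> unit vectors are independent,
  and a vector outside their span would give \<open>d + 2\<close> independent vectors in a space
  spanned by \<open>d + 1\<close>.\<close>

lemma bij_betw_coords:
  assumes lin: "lin_on (coords d) f" and cl: "\<And>v. v \<in> coords d \<Longrightarrow> f v \<in> coords d"
    and ker: "\<And>v. v \<in> coords d \<Longrightarrow> f v = (\<lambda>_. 0) \<Longrightarrow> v = (\<lambda>_. 0)"
  shows "bij_betw f (coords d) (coords d)"
proof -
  define sc where "sc = (\<lambda>(c::complex) (u::nat \<Rightarrow> complex) j. c * u j)"
  interpret vs: vector_space sc
    by unfold_locales (auto simp: sc_def fun_eq_iff algebra_simps)
  interpret vp: vector_space_pair sc sc ..
  \<comment> \<open>Composing with this truncation extends \<open>f\<close>, which is linear only on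
    \<open>coords d\<close>, to a linear map on all sequences.\<close>
  define t where "t = (\<lambda>(v::nat \<Rightarrow> complex) j. if j \<le> d then v j else 0)"
  define g where "g = (\<lambda>v. f (t v))"
  have t_fs: "t v \<in> coords d" for v by (auto simp: t_def coords_def)
  have t_id: "v \<in> coords d \<Longrightarrow> t v = v" for v by (auto simp: t_def coords_def fun_eq_iff)
  have lg: "Vector_Spaces.linear sc sc g"
  proof
    show "g (u + v) = g u + g v" for u v
    proof -
      have "t (u + v) = (\<lambda>x. t u x + t v x)" by (auto simp: t_def)
      then show ?thesis by (simp add: g_def lin_on_add[OF lin t_fs t_fs] plus_fun_def)
    qed
    show "g (sc c v) = sc c (g v)" for c v
    proof -
      have "t (sc c v) = (\<lambda>x. c * t v x)" by (auto simp: t_def sc_def)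
      then show ?thesis by (simp add: g_def lin_on_scale[OF lin t_fs] sc_def)
    qed
  qed
  have sum_fun: "(\<Sum>i\<in>I. F i) x = (\<Sum>i\<in>I. F i x)" for F :: "'k \<Rightarrow> nat \<Rightarrow> complex" and I x
    by (induction I rule: infinite_finite_induct) auto
  define E where "E = unit_at ` {..d}"
  have injE: "inj_on unit_at {..d}"
    by (rule inj_onI) (metis unit_at_def zero_neq_one)
  have finE: "finite E" and cardE: "card E = Suc d"
    by (auto simp: E_def card_image[OF injE])
  have sub: "vs.subspace (coords d)"
    unfolding vs.subspace_def by (auto simp: coords_def sc_def)
  have expand: "v \<in> vs.span E" if "v \<in> coords d" for v
  proof -
    have "v = (\<Sum>i\<le>d. sc (v i) (unit_at i))"
    proof
      fix x
      have "(\<Sum>i\<le>d. sc (v i) (unit_at i)) x = (\<Sum>i\<le>d. v i * unit_at i x)"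
        by (simp only: sum_fun sc_def)
      then show "v x = (\<Sum>i\<le>d. sc (v i) (unit_at i)) x"
        using coords_expand[OF that, THEN fun_cong, of x] by (simp only:)
    qed
    also have "\<dots> \<in> vs.span E"
      by (intro vs.span_sum vs.span_scale vs.span_base) (auto simp: E_def)
    finally show ?thesis .
  qed
  have span: "vs.span E = coords d"
  proof
    have "E \<subseteq> coords d" by (auto simp: E_def unit_at_coords)
    then show "vs.span E \<subseteq> coords d" by (rule vs.span_minimal[OF _ sub])
  qed (use expand in auto)
  have indE: "vs.independent E"
  proof (rule vs.independent_if_scalars_zero[OF finE])
    fix c x assume z: "(\<Sum>x\<in>E. sc (c x) x) = 0" and x: "x \<in> E"
    then obtain i where i: "i \<le> d" "x = unit_at i" by (auto simp: E_def)
    have "(\<Sum>x\<in>E. sc (c x) x) i = (\<Sum>k\<le>d. c (unit_at k) * unit_at k i)"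
      by (simp add: E_def sum.reindex[OF injE] sum_fun sc_def)
    also have "\<dots> = (\<Sum>k\<le>d. if k = i then c (unit_at k) else 0)"
      by (rule sum.cong) (auto simp: unit_at_def)
    also have "\<dots> = c x" using i by simp
    finally show "c x = 0" using z by simp
  qed
  have injg: "inj_on g (vs.span E)"
    unfolding vp.linear_inj_on_iff_eq_0[OF lg vs.subspace_span]
    using ker by (auto simp: span g_def t_id zero_fun_def)
  have ind: "vs.independent (g ` E)"
    by (rule vp.linear_independent_injective_image[OF lg indE injg])
  have "card (g ` E) = Suc d"
    using card_image[of g E] inj_on_subset[OF injg] vs.span_superset cardE by auto
  have "x \<in> vs.span (g ` E)" if x: "x \<in> coords d" for x
  proof (rule ccontr)
    assume n: "x \<notin> vs.span (g ` E)"
    then have "vs.independent (insert x (g ` E))" using ind vs.independent_insert by auto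
    moreover have "insert x (g ` E) \<subseteq> vs.span E"
      using x cl t_fs unfolding span by (auto simp: g_def)
    ultimately have "card (insert x (g ` E)) \<le> card E"
      using vs.independent_span_bound[OF finE] by blast
    moreover have "x \<notin> g ` E" using n vs.span_base by blast
    ultimately show False using \<open>card (g ` E) = Suc d\<close> cardE finE by simp
  qed
  then have "coords d \<subseteq> g ` coords d"
    using vp.linear_span_image[OF lg, of E] span by auto
  then have "coords d \<subseteq> f ` coords d" by (auto simp: g_def t_id)
  moreover have "inj_on f (coords d)"
    using injg unfolding span by (simp add: inj_on_def g_def t_id)
  ultimately show ?thesis using cl by (auto simp: bij_betw_def)
qed

text \<open>The arguments are bare actions, since all modules compared here live on the same
  \<open>coords d\<close>; a twist by a permutation is then the substitution
  \<open>\<lambda>i. A (\<sigma> i)\<close>.\<close>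

definition bihom :: "nat \<Rightarrow> ((nat \<Rightarrow> complex) \<Rightarrow> (nat \<Rightarrow> complex)) \<Rightarrow> (nat \<Rightarrow> (nat \<Rightarrow> complex) \<Rightarrow> (nat \<Rightarrow> complex))
    \<Rightarrow> (nat \<Rightarrow> (nat \<Rightarrow> complex) \<Rightarrow> (nat \<Rightarrow> complex)) \<Rightarrow> bool" where
  "bihom d f A A' \<longleftrightarrow> lin_on (coords d) f \<and> (\<forall>v\<in>coords d. f v \<in> coords d) \<and>
     (\<forall>v\<in>coords d. f (A 1 v) = A' 1 (f v) \<and> f (A 2 v) = A' 2 (f v) \<and> f (A 3 v) = A' 3 (f v))"

lemma bihom_comp: "bihom d f A A' \<Longrightarrow> bihom d g A' A'' \<Longrightarrow> bihom d (g \<circ> f) A A''"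
  by (auto simp: bihom_def lin_on_def)

lemma bihom_bij:
  assumes hom: "bihom d f A A'" and irr: "bimod_irreducible (coords d, A)"
    and cl: "\<And>v i. v \<in> coords d \<Longrightarrow> i \<in> {1,2,3} \<Longrightarrow> A i v \<in> coords d"
    and cl': "\<And>i. i \<in> {1,2,3} \<Longrightarrow> lin_on (coords d) (A' i)"
    and e: "e \<in> coords d" "f e \<noteq> (\<lambda>_. 0)"
  shows "bij_betw f (coords d) (coords d)"
proof (rule bij_betw_coords)
  show lin: "lin_on (coords d) f" and clf: "\<And>v. v \<in> coords d \<Longrightarrow> f v \<in> coords d" using hom by (auto simp: bihom_def)
  define U where "U = {v \<in> coords d. f v = (\<lambda>_. 0)}"
  have z: "(\<lambda>_. 0) \<in> coords d" by (simp add: coords_def)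
  have "subspace_of U"
    using lin_on_add[OF lin] lin_on_scale[OF lin] lin_on_scale[OF lin z, of 0]
      subspace_coords[of d] z
    by (auto simp: subspace_of_def U_def)
  moreover have "A i v \<in> U" if "i \<in> {1,2,3}" "v \<in> U" for i v
  proof -
    have "A' i (\<lambda>_. 0) = (\<lambda>_. 0)" using lin_on_scale[OF cl'[OF that(1)] z, of 0] by simp
    then show ?thesis using hom that cl by (auto simp: U_def bihom_def)
  qed
  moreover have "U \<subseteq> coords d" "U \<noteq> coords d" using e by (auto simp: U_def)
  ultimately have "U = {\<lambda>_. 0}" using irr by (auto simp: bimod_irreducible_def)
  then show "\<And>v. v \<in> coords d \<Longrightarrow> f v = (\<lambda>_. 0) \<Longrightarrow> v = (\<lambda>_. 0)" by (auto simp: U_def)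
qed

text \<open>The central elements {X,Y} - Z, {Y,Z} - X, {Z,X} - Y act by the scalars
  \<open>z3\<close>, \<open>z1\<close>, \<open>z2\<close>. A nonzero homomorphism can only exist
  between modules with the same three scalars.\<close>

definition bi_rep :: "nat \<Rightarrow> (nat \<Rightarrow> (nat \<Rightarrow> complex) \<Rightarrow> (nat \<Rightarrow> complex))
    \<Rightarrow> complex \<Rightarrow> complex \<Rightarrow> complex \<Rightarrow> bool" where
  "bi_rep d A z1 z2 z3 \<longleftrightarrow>
     (\<forall>i\<in>{1,2,3}. lin_on (coords d) (A i) \<and> (\<forall>v\<in>coords d. A i v \<in> coords d)) \<and>
     (\<forall>v\<in>coords d. \<forall>j. A 1 (A 2 v) j + A 2 (A 1 v) j = A 3 v j + z3 * v j \<and>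
        A 2 (A 3 v) j + A 3 (A 2 v) j = A 1 v j + z1 * v j \<and>
        A 1 (A 3 v) j + A 3 (A 1 v) j = A 2 v j + z2 * v j)"

lemma bi_rep_perm13: "bi_rep d A z1 z2 z3 \<Longrightarrow> bi_rep d (\<lambda>i. A (perm13 i)) z3 z2 z1"
  by (auto simp: bi_rep_def perm13_def add.commute)

definition perm12 :: "nat \<Rightarrow> nat" where
  "perm12 i = (if i = 1 then 2 else if i = 2 then 1 else i)"

lemma bi_rep_perm12: "bi_rep d A z1 z2 z3 \<Longrightarrow> bi_rep d (\<lambda>i. A (perm12 i)) z2 z1 z3"
  by (auto simp: bi_rep_def perm12_def add.commute)

lemma lin_on_bidiag_op: "i \<in> {1,2,3} \<Longrightarrow> lin_on S (bidiag_op d th ths phi z i)"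
  by (auto simp: lin_on_def fun_eq_iff bidiag_op1 bidiag_op2 bidiag_op3 algebra_simps)

definition no_eigvec :: "nat \<Rightarrow> ((nat \<Rightarrow> complex) \<Rightarrow> (nat \<Rightarrow> complex)) \<Rightarrow> complex \<Rightarrow> bool" where
  "no_eigvec d T l \<longleftrightarrow> (\<forall>v\<in>coords d. (\<forall>j. T v j = l * v j) \<longrightarrow> v = (\<lambda>_. 0))"

context bi_seq
begin

lemma bi_rep_B: "bi_rep d B z1 z2 z3"
  unfolding bi_rep_def using B_closed lin_on_bidiag_op anticomm12 anticomm23 anticomm13 by auto

text \<open>Back substitution: a triangular matrix has only its diagonal entries as
  eigenvalues.\<close>

lemma upper_no_eigvec:
  assumes n: "\<And>j. j \<le> d \<Longrightarrow> ths j \<noteq> l"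
  shows "no_eigvec d (B 2) l"
  unfolding no_eigvec_def
proof (intro ballI impI ext)
  fix v j assume v: "v \<in> coords d" and e: "\<forall>j. B 2 v j = l * v j"
  have "v (d - i) = 0" if "i \<le> d" for i
    using that
  proof (induction i)
    case 0
    have "v (Suc d) = 0" using v by (simp add: coords_def)
    then show ?case using e[rule_format, of d] n[of d] by (simp add: B2_row)
  next
    case (Suc i)
    have "Suc (d - Suc i) = d - i" using Suc by simp
    then show ?case using e[rule_format, of "d - Suc i"] n[of "d - Suc i"] Suc by (simp add: B2_row)
  qed
  from this[of "d - j"] show "v j = 0" using v by (cases "j \<le> d") (auto simp: coords_def)
qed

lemma lower_no_eigvec:
  assumes n: "\<And>j. j \<le> d \<Longrightarrow> th j \<noteq> l"
  shows "no_eigvec d (B 1) l"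
  unfolding no_eigvec_def
proof (intro ballI impI ext)
  fix v j assume v: "v \<in> coords d" and e: "\<forall>j. B 1 v j = l * v j"
  show "v j = 0"
  proof (cases "j \<le> d")
    case True
    then show ?thesis
    proof (induction j)
      case 0
      then show ?case using e[rule_format, of 0] n[of 0] by (simp add: B1_row)
    next
      case (Suc j)
      then show ?case using e[rule_format, of "Suc j"] n[of "Suc j"] by (simp add: B1_row)
    qed
  next
    case False
    then show ?thesis using v by (auto simp: coords_def)
  qed
qed

text \<open>Back substitution from the value 1 in the last place. \<open>E i\<close> is the
  coordinate at \<open>d - i\<close>, and the quotients make sense because \<open>ths d\<close>
  occurs only once on the diagonal.\<close>

lemma upper_eigvec:
  assumes n: "\<And>j. j < d \<Longrightarrow> ths j \<noteq> ths d"
  obtains e where "e \<in> coords d" "e d = 1" "\<And>j. B 2 e j = ths d * e j"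
proof -
  define E where "E = rec_nat (1::complex) (\<lambda>i x. phi (d - i) * x / (ths d - ths (d - Suc i)))"
  define e where "e = (\<lambda>j. if j \<le> d then E (d - j) else 0)"
  have "B 2 e j = ths d * e j" for j
  proof (cases "j < d")
    case True
    then have s: "d - j = Suc (d - Suc j)" "d - (d - Suc j) = Suc j" "d - (d - j) = j" by auto
    have "e j = phi (Suc j) * e (Suc j) / (ths d - ths j)"
      using True by (simp add: e_def s(1)) (simp add: E_def s)
    then show ?thesis using True n[of j] by (simp add: B2_row field_simps)
  next
    case False
    then show ?thesis using phid by (cases "j = d") (auto simp: B2_row e_def bidiag_op2)
  qed
  then show ?thesis by (intro that[of e]) (auto simp: e_def E_def coords_def)
qed

text \<open>Forward substitution from the value 1 in the first place.\<close>

lemma lower_eigvec: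
  assumes n: "\<And>j. 0 < j \<Longrightarrow> j \<le> d \<Longrightarrow> th j \<noteq> th 0"
  obtains e where "e \<in> coords d" "e 0 = 1" "\<And>j. B 1 e j = th 0 * e j"
proof -
  define E where "E = rec_nat (1::complex) (\<lambda>i x. x / (th 0 - th (Suc i)))"
  define e where "e = (\<lambda>j. if j \<le> d then E j else 0)"
  have "B 1 e j = th 0 * e j" for j
  proof (cases "j \<le> d")
    case True
    then show ?thesis using n[of j] by (cases j) (simp_all add: B1_row e_def E_def field_simps)
  next
    case False
    then show ?thesis by (simp add: bidiag_op1 e_def)
  qed
  then show ?thesis by (intro that[of e]) (auto simp: e_def E_def coords_def)
qed

text \<open>The images of the basis vectors are forced to be w 0 = e, w (Suc i) = (A 1 - th i) w i.  The relations
  determine A 2 (w (Suc (Suc i))) from the two preceding values, and w (Suc d) vanishes because it is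
  an eigenvector of A 2 for the excluded eigenvalue ths (Suc d).\<close>

lemma bihom_exists:
  assumes rep: "bi_rep d A z1 z2 z3" and e: "e \<in> coords d" and e0: "\<And>j. A 2 e j = ths 0 * e j"
    and init: "\<And>j. A 2 (A 1 e) j = (ths 1) * (A 1 e j) + (phi 1 - th 0 * ths 1 + th 0 * ths 0) * e j"
    and no_eig: "no_eigvec d (A 2) (ths (Suc d))"
  obtains f where "bihom d f B A" "f (unit_at 0) = e"
proof -
  define w where "w = rec_nat e (\<lambda>i u j. A 1 u j - th i * u j)"
  have w0: "w 0 = e" and wS: "w (Suc i) = (\<lambda>j. A 1 (w i) j - th i * w i j)" for i
    by (simp_all add: w_def)
  have lin: "lin_on (coords d) (A i)" and cl: "v \<in> coords d \<Longrightarrow> A i v \<in> coords d" if "i \<in> {1,2,3}" for i v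
    using rep that by (auto simp: bi_rep_def)
  have cl: "v \<in> coords d \<Longrightarrow> A 1 v \<in> coords d" "v \<in> coords d \<Longrightarrow> A 2 v \<in> coords d" "v \<in> coords d \<Longrightarrow> A 3 v \<in> coords d" for v
    using rep by (auto simp: bi_rep_def)
  have comb: "A i (\<lambda>x. a * u x + b * v x) = (\<lambda>y. a * A i u y + b * A i v y)"
    if "i \<in> {1,2,3}" "u \<in> coords d" "v \<in> coords d" for i a b u v
    using lin_on_comb[OF lin[OF that(1)] subspace_coords that(2,3)] .
  have wf: "w i \<in> coords d" for i
  proof (induction i)
    case 0
    then show ?case using e by (simp add: w0)
  next
    case (Suc i)
    then have "(\<lambda>x. 1 * A 1 (w i) x + (- th i) * w i x) \<in> coords d"
      by (intro subspace_of_comb[OF subspace_coords] cl)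
    then show ?case by (simp add: wS)
  qed
  have A1w: "A 1 (w i) = (\<lambda>x. th i * w i x + 1 * w (Suc i) x)" for i
    by (simp add: wS)
  note A1w' = A1w[unfolded One_nat_def]
  \<comment> \<open>The induction carries two consecutive values. At \<open>i = 0\<close> the
    truncated index \<open>i - 1\<close> is harmless because \<open>phi 0 = 0\<close>.\<close>
  have main: "A 2 (w i) = (\<lambda>x. ths i * w i x + phi i * w (i - 1) x) \<and>
       A 2 (w (Suc i)) = (\<lambda>x. ths (Suc i) * w (Suc i) x + phi (Suc i) * w i x)" for i
  proof (induction i)
    case 0
    have "A 2 (w (Suc 0)) = (\<lambda>x. 1 * A 2 (A 1 e) x + (- th 0) * A 2 e x)"
      using comb[of 2 "A 1 e" e 1 "- th 0"] e cl by (simp add: wS w0)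
    then have h: "A 2 (w (Suc 0)) x = A 2 (A (Suc 0) e) x - th 0 * A 2 e x" for x by simp
    have h': "A (Suc 0) e x = w (Suc 0) x + th 0 * e x" for x by (simp add: wS w0)
    have "A 2 (w (Suc 0)) x = ths (Suc 0) * w (Suc 0) x + phi (Suc 0) * w 0 x" for x
      using e0[of x] init[of x] h[of x] by (simp add: w0 h' algebra_simps)
    then show ?case using e0 by (auto simp: w0 phi0)
  next
    case (Suc i)
    have A3: "A 3 (w k) x = A 1 (A 2 (w k)) x + A 2 (A 1 (w k)) x - z3 * w k x" for k x
      using rep wf[of k] by (auto simp: bi_rep_def)
    have R: "A 3 (w i) x = zz i * w i x + (- ((-1) ^ i)) * w (Suc i) x + (phi i * (-1) ^ i) * w (i - 1) x" for x
    proof -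
      have 1: "A 1 (A 2 (w i)) x = ths i * A 1 (w i) x + phi i * A 1 (w (i - 1)) x"
        using Suc comb[of 1 "w i" "w (i-1)"] wf by simp
      have 2: "A 2 (A 1 (w i)) x = th i * A 2 (w i) x + A 2 (w (Suc i)) x"
        using comb[of 2 "w i" "w (Suc i)" "th i" 1] wf by (simp add: A1w')
      have 3: "phi i * A 1 (w (i - 1)) x = phi i * ((- th i + (-1) ^ i) * w (i - 1) x + w i x)"
        by (cases i) (simp_all add: phi0 A1w' th_step)
      show ?thesis unfolding A3 1 2 3
        using Suc by (simp add: A1w' ths_step zcoef_def algebra_simps)
    qed
    define S where "S = (\<lambda>x. (- ((-1) ^ i)) * w (Suc i) x + (phi i * (-1) ^ i) * w (i - 1) x)"
    have Sfs: "S \<in> coords d" unfolding S_def by (intro subspace_of_comb[OF subspace_coords] wf)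
    have R': "A 3 (w i) = (\<lambda>x. zz i * w i x + 1 * S x)"
      by (rule ext) (simp add: R S_def)
    \<comment> \<open>The relation {A 1, A 3} = A 2 + z2 at \<open>w i\<close> contains a single
      unknown, \<open>A 2 (w (Suc (Suc i)))\<close>. It enters with coefficient 1, through
      \<open>A 3 (w (Suc i))\<close>.\<close>
    have E: "A 2 (w (Suc (Suc i))) x = ths (Suc (Suc i)) * w (Suc (Suc i)) x + phi (Suc (Suc i)) * w (Suc i) x" for x
    proof -
      have rel: "A 1 (A 3 (w i)) x + A 3 (A 1 (w i)) x = A 2 (w i) x + z2 * w i x"
        using rep wf[of i] by (auto simp: bi_rep_def)
      have a: "A 1 (A 3 (w i)) x = zz i * A 1 (w i) x + (- ((-1) ^ i)) * A 1 (w (Suc i)) x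
          + ((-1) ^ i) * (phi i * A 1 (w (i - 1)) x)"
      proof -
        have "A 1 S x = (- ((-1) ^ i)) * A 1 (w (Suc i)) x + (phi i * (-1) ^ i) * A 1 (w (i - 1)) x"
          unfolding S_def by (subst comb[OF _ wf wf]) auto
        moreover have "A 1 (A 3 (w i)) x = zz i * A 1 (w i) x + A 1 S x"
          unfolding R' by (subst comb[OF _ wf Sfs]) auto
        ultimately show ?thesis by simp
      qed
      have a3: "phi i * A 1 (w (i - 1)) x = phi i * ((- th i + (-1) ^ i) * w (i - 1) x + w i x)"
        by (cases i) (simp_all add: phi0 A1w' th_step)
      have b: "A 3 (A 1 (w i)) x = th i * A 3 (w i) x + A 3 (w (Suc i)) x"
        using comb[of 3 "w i" "w (Suc i)" "th i" 1] wf by (simp add: A1w')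
      have c: "A 1 (A 2 (w (Suc i))) x = ths (Suc i) * A 1 (w (Suc i)) x + phi (Suc i) * A 1 (w i) x"
        using Suc comb[of 1 "w (Suc i)" "w i"] wf by simp
      have c2: "A 2 (A 1 (w (Suc i))) x = th (Suc i) * A 2 (w (Suc i)) x + A 2 (w (Suc (Suc i))) x"
        using comb[of 2 "w (Suc i)" "w (Suc (Suc i))" "th (Suc i)" 1] wf by (simp add: A1w')
      have d: "A 2 (w i) x = ths i * w i x + phi i * w (i - 1) x"
         "A 2 (w (Suc i)) x = ths (Suc i) * w (Suc i) x + phi (Suc i) * w i x"
        using Suc by simp_all
      have pw: "(-1::complex) ^ i * (-1) ^ i = 1" by (simp flip: power_mult_distrib)
      have t: "th (Suc i) = - th i - (-1) ^ i" "ths (Suc i) = - ths i - (-1) ^ i"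
         "ths (Suc (Suc i)) = - ths (Suc i) + (-1) ^ i"
        using th_step ths_step[of i] ths_step[of "Suc i"] by auto
      have z: "2 * th (Suc i) * ths (Suc i) + phi (Suc i) + phi (Suc (Suc i)) - z3 = - 1 - zz i"
        using zcoef_step[of i] by (simp add: zcoef_def)
      have z': "2 * zz i * th i + (-1) ^ i * (phi i - phi (Suc i)) = ths i + z2"
        by (rule zcoef_th)
      define s where "s = (-1::complex) ^ i"
      show ?thesis
        using rel pw t z z' unfolding a a3 b
        unfolding R A3[of "Suc i"] c c2
        unfolding d A1w s_def[symmetric]
        by algebra
    qed
    show ?case using Suc E by auto
  qed
  have wd: "w (Suc d) = (\<lambda>_. 0)"
    using no_eig wf[of "Suc d"] main[of d] phid by (simp add: no_eigvec_def)
  define f where "f = (\<lambda>v x. \<Sum>i\<le>d. v i * w i x)"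
  have "lin_on (coords d) f"
    by (auto simp: lin_on_def f_def fun_eq_iff algebra_simps sum.distrib sum_distrib_left)
  moreover have ff: "f v \<in> coords d" for v unfolding f_def
    by (rule subspace_of_sum[OF subspace_coords]) (auto simp: wf)
  moreover have h1: "f (B 1 v) = A 1 (f v)" if v: "v \<in> coords d" for v
  proof
    fix x
    have "A 1 (f v) x = (\<Sum>i\<le>d. v i * A 1 (w i) x)"
      using lin_on_sum[OF lin[of 1] subspace_coords, of "{..d}" w v] wf by (simp add: f_def)
    also have "\<dots> = (\<Sum>i\<le>d. v i * th i * w i x) + (\<Sum>i<Suc d. v i * w (Suc i) x)"
      by (simp add: A1w' algebra_simps sum.distrib lessThan_Suc_atMost)
    also have "(\<Sum>i<Suc d. v i * w (Suc i) x) = (\<Sum>i<d. v i * w (Suc i) x)"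
      by (simp add: wd)
    also have "\<dots> = (\<Sum>i\<le>d. (if i = 0 then 0 else v (i - 1)) * w i x)"
      by (simp add: sum.atMost_shift)
    finally show "f (B 1 v) x = A 1 (f v) x"
      by (simp add: f_def B1_row algebra_simps sum.distrib)
  qed
  moreover have h2: "f (B 2 v) = A 2 (f v)" if v: "v \<in> coords d" for v
  proof
    fix x
    have "A 2 (f v) x = (\<Sum>i\<le>d. v i * A 2 (w i) x)"
      using lin_on_sum[OF lin[of 2] subspace_coords, of "{..d}" w v] wf by (simp add: f_def)
    also have "\<dots> = (\<Sum>i\<le>d. v i * ths i * w i x) + (\<Sum>i\<le>d. v i * phi i * w (i - 1) x)"
      using main by (simp add: algebra_simps sum.distrib)
    also have "(\<Sum>i\<le>d. v i * phi i * w (i - 1) x) = (\<Sum>i<d. v (Suc i) * phi (Suc i) * w i x)"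
      by (simp add: sum.atMost_shift phi0)
    also have "\<dots> = (\<Sum>i\<le>d. v (Suc i) * phi (Suc i) * w i x)"
      by (rule sum.mono_neutral_left) (auto simp: phid not_less le_antisym)
    finally show "f (B 2 v) x = A 2 (f v) x"
      by (simp add: f_def B2_row algebra_simps sum.distrib)
  qed
  moreover have "f (B 3 v) = A 3 (f v)" if v: "v \<in> coords d" for v
  proof
    fix x
    have bb: "B 1 v \<in> coords d" "B 2 v \<in> coords d" using B_closed v by auto
    have "B 3 v = (\<lambda>j. B 1 (B 2 v) j + B 2 (B 1 v) j - z3 * v j)" by (rule ext) (simp add: bidiag_op3)
    then have "f (B 3 v) x = f (B 1 (B 2 v)) x + f (B 2 (B 1 v)) x - z3 * f v x"
      by (simp add: f_def algebra_simps sum.distrib sum_subtractf sum_distrib_left)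
    also have "\<dots> = A 1 (A 2 (f v)) x + A 2 (A 1 (f v)) x - z3 * f v x"
      using bb v by (simp only: h1 h2)
    also have "\<dots> = A 3 (f v) x" using rep ff[of v] by (auto simp: bi_rep_def)
    finally show "f (B 3 v) x = A 3 (f v) x" .
  qed
  ultimately have "bihom d f B A" by (auto simp: bihom_def)
  moreover have "f (unit_at 0) = e"
    by (rule ext) (simp add: f_def unit_at_def sum.atMost_shift w0)
  ultimately show ?thesis using that by blast
qed

end

lemma bidiag_pair: "bidiag d th ths phi z = (coords d, bidiag_op d th ths phi z)"
  by (rule prod_eqI) (simp_all add: fst_bidiag)

context bi_seq
begin

text \<open>A 1 + A 3 maps the s-eigenspace of A 2 to its (1 - s)-eigenspace up to a multiple of the identity; as
  the latter is zero, e is an eigenvector of A 1 + A 3.\<close>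

lemma bihom_exists_eig:
  assumes rep: "bi_rep d A z1 z2 z3" and e: "e \<in> coords d" and e0: "\<And>j. A 2 e j = ths 0 * e j"
    and half: "2 * ths 0 \<noteq> 1"
    and no_eig0: "no_eigvec d (A 2) (1 - ths 0)" and no_eig: "no_eigvec d (A 2) (ths (Suc d))"
  obtains f where "bihom d f B A" "f (unit_at 0) = e"
proof -
  define s where "s = ths 0"
  \<comment> \<open>Adding the relations for {A 1, A 2} and {A 2, A 3} at \<open>e\<close> gives A 2
    t = (1 - s) t + (z1 + z3) e for t = A 1 e + A 3 e. With this \<open>rho\<close>, the vector u =
    t - rho e satisfies A 2 u = (1 - s) u.\<close>
  define rho where "rho = (z1 + z3) / (2 * s - 1)"
  have lin: "lin_on (coords d) (A i)" and cl: "v \<in> coords d \<Longrightarrow> A i v \<in> coords d" if "i \<in> {1,2,3}" for i v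
    using rep that by (auto simp: bi_rep_def)
  have c13: "A 1 e \<in> coords d" "A 3 e \<in> coords d" using cl[of 1 e] cl[of 3 e] e by auto
  have Ae: "A 2 e = (\<lambda>j. s * e j)" using e0 by (simp add: s_def fun_eq_iff)
  define t u where "t = (\<lambda>x. 1 * A 1 e x + 1 * A 3 e x)" and "u = (\<lambda>x. 1 * t x + (- rho) * e x)"
  have tf: "t \<in> coords d" unfolding t_def by (rule subspace_of_comb[OF subspace_coords c13])
  have uf: "u \<in> coords d" unfolding u_def by (rule subspace_of_comb[OF subspace_coords tf e])
  have A2t: "A 2 t = (\<lambda>x. 1 * A 2 (A 1 e) x + 1 * A 2 (A 3 e) x)"
    unfolding t_def by (rule lin_on_comb[OF lin subspace_coords c13]) simp
  have A2u: "A 2 u = (\<lambda>x. 1 * A 2 t x + (- rho) * A 2 e x)"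
    unfolding u_def by (rule lin_on_comb[OF lin subspace_coords tf e]) simp
  have sc: "A i (A 2 e) = (\<lambda>j. s * A i e j)" if "i \<in> {1,2,3}" for i
    unfolding Ae by (rule lin_on_scale[OF lin e]) (rule that)
  have r1: "s * A 1 e x + A 2 (A 1 e) x = A 3 e x + z3 * e x" for x
    using rep e sc[of 1] by (auto simp: bi_rep_def)
  have r2: "A 2 (A 3 e) x + s * A 3 e x = A 1 e x + z1 * e x" for x
    using rep e sc[of 3] by (auto simp: bi_rep_def)
  have init: "A 2 (A 1 e) j = (ths 1) * (A 1 e j) + (phi 1 - th 0 * ths 1 + th 0 * ths 0) * e j" for j
    proof -
    have rho: "rho * (2 * s - 1) = z1 + z3" using half by (simp add: rho_def s_def)
    have "A 2 u x = (1 - ths 0) * u x" for x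
    proof -
      define p q p' q' where "p = A 1 e x" and "q = A 3 e x" and "p' = A 2 (A 1 e) x" and "q' = A 2 (A 3 e) x"
      have 1: "p' = q + z3 * e x - s * p" "q' = p + z1 * e x - s * q"
        using r1[of x] r2[of x] by (simp_all add: p_def q_def p'_def q'_def algebra_simps)
      have 2: "z1 = rho * (2 * s - 1) - z3" using rho by simp
      show ?thesis
        unfolding A2u A2t unfolding u_def t_def Ae s_def[symmetric] p_def[symmetric] q_def[symmetric]
          p'_def[symmetric] q'_def[symmetric] unfolding 1 2 by (simp add: algebra_simps)
    qed
    with no_eig0 uf have "u = (\<lambda>_. 0)" by (simp add: no_eigvec_def)
    then have "u j = 0" by (rule fun_cong)
    then have A3: "A 3 e j = rho * e j - A 1 e j" by (simp add: u_def t_def algebra_simps)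
    have "2 * (2 * th 0 * s + phi 1 - z3) * s - phi 1 = th 0 + z1"
      using zcoef_ths[of 0] by (simp add: zcoef_def s_def phi0)
    then have z1: "z1 = 2 * (2 * th 0 * s + phi 1 - z3) * s - phi 1 - th 0" by (simp add: algebra_simps)
    \<comment> \<open>\<open>zcoef_ths\<close> at 0 ties \<open>phi 1\<close> to \<open>z1\<close>;
      division by \<open>2 * s - 1\<close> turns this into the value of \<open>phi 1\<close> that
      the initial condition of \<open>bihom_exists\<close> demands.\<close>
    have "(2 * s - 1) * (rho + z3 - th 0 * (2 * s + 1)) = rho * (2 * s - 1) + (2 * s - 1) * (z3 - th 0 * (2 * s + 1))"
      by (simp add: algebra_simps)
    also have "\<dots> = (2 * s - 1) * phi 1" unfolding rho z1 by (simp add: algebra_simps)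
    finally have "(2 * s - 1) * phi 1 = (2 * s - 1) * (rho + z3 - th 0 * (2 * s + 1))" by (rule sym)
    then have 1: "phi 1 = rho + z3 - th 0 * (2 * s + 1)" using half by (simp add: s_def)
    have 2: "ths 1 = - s - 1" using ths_step[of 0] by (simp add: s_def)
    have 3: "A 2 (A 1 e) j = A 3 e j + z3 * e j - s * A 1 e j" using r1[of j] by (simp add: algebra_simps)
    show ?thesis
      unfolding 3 A3 s_def[symmetric] 1 2 by (simp add: algebra_simps)
  qed
  from bihom_exists[of A e, OF rep e e0 init no_eig] that show thesis by blast
qed

text \<open>X - th i sends \<open>unit_at i\<close> to \<open>unit_at (Suc i)\<close>, so
  \<open>unit_at 0\<close> generates the module under X alone.\<close>

lemma full_of_closed:
  assumes U: "subspace_of U" "U \<subseteq> coords d" and cl: "\<And>v. v \<in> U \<Longrightarrow> B 1 v \<in> U" and "unit_at 0 \<in> U"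
  shows "U = coords d"
proof -
  have "unit_at i \<in> U" if "i \<le> d" for i
    using that
  proof (induction i)
    case (Suc i)
    then have "(\<lambda>x. 1 * B 1 (unit_at i) x + (- th i) * unit_at i x) \<in> U"
      by (intro subspace_of_comb[OF U(1)] cl) auto
    moreover have "(\<lambda>x. 1 * B 1 (unit_at i) x + (- th i) * unit_at i x) = unit_at (Suc i)"
      using Suc.prems by (auto simp: bidiag_op1 unit_at_def fun_eq_iff)
    ultimately show ?case by simp
  qed (use assms in simp)
  then have "v \<in> U" if "v \<in> coords d" for v
    by (subst coords_expand[OF that], intro subspace_of_sum[OF U(1)]) auto
  then show ?thesis using U by auto
qed

text \<open>Take u in the submodule with minimal top index m.  Both Y - ths m and a suitable combination of X, Z, 1
  map u to a vector with smaller top index, which vanishes by minimality.  For m > 0 the coefficients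
  at m - 1 of these two vectors give an algebraic relation excluded by the assumptions.\<close>

lemma irreducible:
  assumes ph: "\<And>k. k < d \<Longrightarrow> phi (Suc k) \<noteq> 0" and D: "\<And>k. k < d \<Longrightarrow> 2 * ths k + (-1) ^ k \<noteq> 0"
    and g: "\<And>k. k < d \<Longrightarrow> (2 * ths k + (-1) ^ k)\<^sup>2
      - 2 * (th k - (-1) ^ k * zz k) * (2 * ths k + (-1) ^ k) - 2 * phi (Suc k) \<noteq> 0"
  shows "bimod_irreducible (coords d, B)"
  unfolding bimod_irreducible_def fst_conv snd_conv
proof (intro conjI allI impI)
  have "unit_at 0 \<in> coords d" "unit_at 0 0 \<noteq> 0" by (auto simp: unit_at_def coords_def)
  then show "coords d \<noteq> {\<lambda>_. 0}" by auto
next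
  fix U assume U: "U \<subseteq> coords d" and "subspace_of U \<and> (\<forall>i\<in>{1, 2, 3}. \<forall>v\<in>U. B i v \<in> U)"
  then have sub: "subspace_of U" and cl: "v \<in> U \<Longrightarrow> B 1 v \<in> U" "v \<in> U \<Longrightarrow> B 2 v \<in> U" "v \<in> U \<Longrightarrow> B 3 v \<in> U" for v
    by auto
  have "U = coords d" if "U \<noteq> {\<lambda>_. 0}"
  proof -
    define P where "P = (\<lambda>m. \<exists>u\<in>U. u m \<noteq> 0 \<and> (\<forall>j>m. u j = 0))"
    have "(\<lambda>_. 0) \<in> U" using sub by (simp add: subspace_of_def)
    then have "\<exists>u\<in>U. u \<noteq> (\<lambda>_. 0)" using that by blast
    then obtain u x where u: "u \<in> U" "u x \<noteq> 0" by (auto simp: fun_eq_iff)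
    have fin: "finite {j. u j \<noteq> 0}"
      by (rule finite_subset[of _ "{..d}"]) (use U u in \<open>auto simp: coords_def not_le[symmetric]\<close>)
    define M where "M = Max {j. u j \<noteq> 0}"
    have "u j = 0" if "j > M" for j
    proof (rule ccontr)
      assume "u j \<noteq> 0"
      then have "j \<le> M" unfolding M_def by (intro Max_ge fin) simp
      then show False using that by simp
    qed
    moreover have "M \<in> {j. u j \<noteq> 0}" unfolding M_def by (rule Max_in[OF fin]) (use u in blast)
    ultimately have "P M" unfolding P_def using u(1) by blast
    then have PL: "P (LEAST m. P m)" by (rule LeastI)
    define m where "m = (LEAST m. P m)"
    have small: "\<not> P k" if "k < m" for k using that not_less_Least unfolding m_def by blast
    from PL obtain u where u: "u \<in> U" "u m \<noteq> 0" "\<And>j. m < j \<Longrightarrow> u j = 0"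
      by (auto simp: P_def m_def)
    have uf: "u \<in> coords d" using u U by auto
    have md: "m \<le> d" using u(2) uf by (auto simp: coords_def not_le[symmetric])
    have "m = 0"
    proof (cases m)
      case (Suc k)
      have kd: "k < d" "k \<le> d" using md Suc by auto
      have none: "y k = 0" if "y \<in> U" "\<And>j. m \<le> j \<Longrightarrow> y j = 0" for y
        using small[of k] that Suc by (auto simp: P_def Suc_le_eq)
      define s where "s = (-1::complex) ^ k"
      have ss: "s * s = 1" by (simp add: s_def flip: power_mult_distrib)
      define y where "y = (\<lambda>x. 1 * B 2 u x + (- ths m) * u x)"
      have "y k = 0"
      proof (rule none)
        show "y \<in> U" unfolding y_def by (intro subspace_of_comb[OF sub] cl u)
        show "y j = 0" if "m \<le> j" for j
          using that u(3)[of j] u(3)[of "Suc j"] md phid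
          by (cases "j = m"; cases "j \<le> d") (auto simp: y_def B2_row bidiag_op2)
      qed
      then have e1: "ths k * u k + phi m * u m - ths m * u k = 0"
        using kd by (simp add: y_def B2_row Suc)
      \<comment> \<open>In X - s Z the entry in row \<open>Suc m\<close>, column \<open>m\<close>
        cancels, so applying it to \<open>u\<close> creates nothing above \<open>m\<close>. In row
        \<open>m\<close> the two subdiagonal contributions add up to \<open>2 * u k\<close>, and
        \<open>r\<close> is chosen to cancel the whole coordinate.\<close>
      define r where "r = (th m - s * zz m) + 2 * u k / u m"
      have r: "r * u m = (th m - s * zz m) * u m + 2 * u k" using u by (simp add: r_def field_simps)
      define x where "x = (\<lambda>x. 1 * (1 * B 1 u x + (- s) * B 3 u x) + (- r) * u x)"
      have row1: "B 1 u j = th j * u j + (if j = 0 then 0 else u (j - 1))" if "j \<le> d" for j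
        using B1_row[OF that] by simp
      have "x k = 0"
      proof (rule none)
        show "x \<in> U" unfolding x_def by (intro subspace_of_comb[OF sub] cl u)
        show "x j = 0" if "m \<le> j" for j
        proof -
          have mj: "m \<le> j" by fact
          consider "j > d" | "j = m" "j \<le> d" | "j = Suc m" "j \<le> d" | "j > Suc m" "j \<le> d"
            using mj by (cases "j \<le> d"; cases "j = m"; cases "j = Suc m") auto
          then show ?thesis
          proof cases
            case 1
            then show ?thesis using u(3)[of j] md by (simp add: x_def bidiag_op1 bidiag_op2 bidiag_op3)
          next
            case 2
            then show ?thesis using u(3)[of "Suc m"] r ss Suc
              unfolding x_def row1[OF 2(2)] B3_row[OF 2(2) uf] by (simp add: s_def[symmetric] algebra_simps)
          next
            case 3
            then show ?thesis using u(3)[of "Suc m"] u(3)[of "Suc (Suc m)"] r ss Suc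
              unfolding x_def row1[OF 3(2)] B3_row[OF 3(2) uf] by (simp add: s_def[symmetric] algebra_simps)
          next
            case 4
            then show ?thesis using u(3)[of j] u(3)[of "Suc j"] u(3)[of "j - 1"]
              unfolding x_def row1[OF 4(2)] B3_row[OF 4(2) uf] by simp
          qed
        qed
      qed
      moreover have "x k = (th k - s * zz k) * u k + phi m * u m - r * u k"
      proof -
        define a where "a = (if k = 0 then 0 else u (k - 1))"
        have "(if k = 0 then 0 else (-1) ^ (k - 1) * u (k - 1)) = - s * a"
          by (cases k) (auto simp: a_def s_def)
        then show ?thesis
          using ss unfolding x_def row1[OF kd(2)] B3_row[OF kd(2) uf] a_def[symmetric] s_def[symmetric] Suc[symmetric]
          by algebra
      qed
      ultimately have e2: "(th k - s * zz k) * u k + phi m * u m - r * u k = 0" by simp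
      have t: "th m = - th k - s" "ths m = - ths k - s" "zz m = - 1 - zz k"
        using th_step[of k] ths_step[of k] zcoef_step[of k] Suc by (simp_all add: s_def)
      have e3: "(2 * ths k + s) * u k + phi m * u m = 0" using e1 t by algebra
      have e4: "2 * (th k - s * zz k) * u k * u m + phi m * (u m)\<^sup>2 - 2 * (u k)\<^sup>2 = 0"
        using e2 r t ss by algebra
      \<comment> \<open>Eliminating \<open>u k\<close> between \<open>e3\<close> and
        \<open>e4\<close> leaves exactly the expression that \<open>g\<close> declares
        nonzero.\<close>
      have "phi m * (u m)\<^sup>2 * ((2 * ths k + s)\<^sup>2 - 2 * (th k - s * zz k) * (2 * ths k + s) - 2 * phi m) = 0"
        using e3 e4 by algebra
      then show ?thesis using g[OF kd(1)] ph[OF kd(1)] u(2) Suc by (simp add: s_def)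
    qed
    then have "unit_at 0 = (\<lambda>x. inverse (u 0) * u x)"
      using u by (auto simp: unit_at_def fun_eq_iff)
    then have "unit_at 0 \<in> U" using u sub by (simp add: subspace_of_def)
    then show ?thesis using full_of_closed[OF sub U cl(1)] by simp
  qed
  then show "U = {\<lambda>_. 0} \<or> U = coords d" by blast
qed

end

section \<open>The families E and O\<close>

definition zE :: "complex \<Rightarrow> complex \<Rightarrow> complex \<Rightarrow> nat \<Rightarrow> complex" where
  "zE a b c d = c\<^sup>2 - a\<^sup>2 - b\<^sup>2 + (of_nat d + 1)\<^sup>2 / 4"

definition zO :: "complex \<Rightarrow> complex \<Rightarrow> complex \<Rightarrow> nat \<Rightarrow> complex" where
  "zO a b c d = 2 * a * b - c * (of_nat d + 1)"

text \<open>Subtraction is complex here, not truncated: the values agree with those in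
  \<open>Emod\<close> for \<open>i \<le> d\<close>, and for odd \<open>d\<close> the value at
  \<open>Suc d\<close> becomes 0, as \<open>bi_seq\<close> requires.\<close>

definition phiE :: "complex \<Rightarrow> complex \<Rightarrow> complex \<Rightarrow> nat \<Rightarrow> nat \<Rightarrow> complex" where
  "phiE a b c d i = (if even i then of_nat i * (of_nat d - of_nat i + 1)
     else c\<^sup>2 - (2 * a + 2 * b - of_nat d + 2 * of_nat i - 1)\<^sup>2 / 4)"

definition phiO :: "complex \<Rightarrow> complex \<Rightarrow> complex \<Rightarrow> nat \<Rightarrow> nat \<Rightarrow> complex" where
  "phiO a b c d i =
     (if even i then of_nat i * (of_nat d + 1 - 2 * of_nat i - 2 * a - 2 * b - 2 * c) / 2
      else (of_nat i - of_nat d - 1) * (of_nat d + 1 - 2 * of_nat i - 2 * a - 2 * b + 2 * c) / 2)"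

lemma bidiag_cong:
  assumes "\<And>i. 1 \<le> i \<Longrightarrow> i \<le> d \<Longrightarrow> phi i = phi' i"
  shows "bidiag d th ths phi z = bidiag d th ths phi' z"
proof -
  have "(\<lambda>v j. if j \<le> d then ths j * v j + (if j < d then phi (j + 1) * v (j + 1) else 0) else 0)
    = (\<lambda>(v::nat \<Rightarrow> complex) j. if j \<le> d then ths j * v j + (if j < d then phi' (j + 1) * v (j + 1) else 0) else 0)"
    using assms by (intro ext) auto
  then show ?thesis unfolding bidiag_def by simp
qed

lemma Emod_bidiag: "Emod a b c d = bidiag d (thetaL a d) (thetaL b d) (phiE a b c d) (zE a b c d)"
  unfolding Emod_def zE_def
proof (rule bidiag_cong)
  fix i assume "i \<le> d"
  then have "of_nat (i * (d - i + 1)) = (of_nat i * (of_nat d - of_nat i + 1) :: complex)"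
    by (simp only: of_nat_mult of_nat_add of_nat_diff of_nat_1)
  then show "(if even i then of_nat (i * (d - i + 1))
      else c\<^sup>2 - (2 * a + 2 * b - of_nat d + 2 * of_nat i - 1)\<^sup>2 / 4) = phiE a b c d i"
    by (simp add: phiE_def)
qed

lemma Omod_bidiag: "Omod a b c d = bidiag d (thetaL a d) (thetaL b d) (phiO a b c d) (zO a b c d)"
  unfolding Omod_def zO_def phiO_def ..

lemma thetaL_Suc: "thetaL a d (Suc i) = - thetaL a d i - (-1) ^ i"
  by (simp add: thetaL_def field_simps)

text \<open>The three central scalars come from one formula by cyclic permutation of (a,b,c). This
  symmetry makes it possible to compare modules after a permutation of the generators.\<close>

lemma bi_seq_E:
  assumes "odd d"
  shows "bi_seq d (thetaL a d) (thetaL b d) (phiE a b c d) (zE b c a d) (zE c a b d) (zE a b c d)"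
proof
  fix i
  show "zcoef (thetaL a d) (thetaL b d) (phiE a b c d) (zE a b c d) (Suc i)
     = - 1 - zcoef (thetaL a d) (thetaL b d) (phiE a b c d) (zE a b c d) i"
    by (cases "even i") (simp_all add: zcoef_def thetaL_def phiE_def zE_def field_simps power2_eq_square)
  show "2 * zcoef (thetaL a d) (thetaL b d) (phiE a b c d) (zE a b c d) i * thetaL a d i
      + (-1) ^ i * (phiE a b c d i - phiE a b c d (Suc i)) = thetaL b d i + zE c a b d"
    by (cases "even i") (simp_all add: zcoef_def thetaL_def phiE_def zE_def field_simps power2_eq_square)
  show "2 * zcoef (thetaL a d) (thetaL b d) (phiE a b c d) (zE a b c d) i * thetaL b d i
      + (-1) ^ i * (phiE a b c d i - phiE a b c d (Suc i)) = thetaL a d i + zE b c a d"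
    by (cases "even i") (simp_all add: zcoef_def thetaL_def phiE_def zE_def field_simps power2_eq_square)
qed (use assms in \<open>simp_all add: thetaL_Suc phiE_def\<close>)

lemma bi_seq_O:
  assumes "even d"
  shows "bi_seq d (thetaL a d) (thetaL b d) (phiO a b c d) (zO b c a d) (zO c a b d) (zO a b c d)"
proof
  fix i
  show "zcoef (thetaL a d) (thetaL b d) (phiO a b c d) (zO a b c d) (Suc i)
     = - 1 - zcoef (thetaL a d) (thetaL b d) (phiO a b c d) (zO a b c d) i"
    by (cases "even i") (simp_all add: zcoef_def thetaL_def phiO_def zO_def field_simps power2_eq_square)
  show "2 * zcoef (thetaL a d) (thetaL b d) (phiO a b c d) (zO a b c d) i * thetaL a d i
      + (-1) ^ i * (phiO a b c d i - phiO a b c d (Suc i)) = thetaL b d i + zO c a b d"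
    by (cases "even i") (simp_all add: zcoef_def thetaL_def phiO_def zO_def field_simps power2_eq_square)
  show "2 * zcoef (thetaL a d) (thetaL b d) (phiO a b c d) (zO a b c d) i * thetaL b d i
      + (-1) ^ i * (phiO a b c d i - phiO a b c d (Suc i)) = thetaL a d i + zO b c a d"
    by (cases "even i") (simp_all add: zcoef_def thetaL_def phiO_def zO_def field_simps power2_eq_square)
qed (use assms in \<open>simp_all add: thetaL_Suc phiO_def\<close>)

lemma thetaL_even: "even i \<Longrightarrow> 2 * thetaL b d i = 2 * b - of_nat d + 2 * of_nat i"
  and thetaL_odd: "odd i \<Longrightarrow> 2 * thetaL b d i = - (2 * b - of_nat d + 2 * of_nat i)"
  by (simp_all add: thetaL_def)

lemma double_cancel: "2 * x = 2 * y \<Longrightarrow> x = (y :: complex)"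
  by simp

text \<open>For indices of equal parity the two values differ by i - j up to sign; for opposite
  parity their equality is the linear equation 2b + i + j = d.\<close>

lemma thetaL_neq:
  assumes "i \<noteq> j" "2 * b + of_nat i + of_nat j \<noteq> of_nat d"
  shows "thetaL b d i \<noteq> thetaL b d j"
proof
  assume eq: "thetaL b d i = thetaL b d j"
  show False
  proof (cases "even i = even j")
    case True
    then have "(of_nat i :: complex) = of_nat j" using eq by (cases "even i") (auto simp: thetaL_def)
    then show False using assms(1) by simp
  next
    case False
    then have "2 * thetaL b d i = 2 * b - of_nat d + 2 * of_nat i \<and> 2 * thetaL b d j = - (2 * b - of_nat d + 2 * of_nat j)
        \<or> 2 * thetaL b d i = - (2 * b - of_nat d + 2 * of_nat i) \<and> 2 * thetaL b d j = 2 * b - of_nat d + 2 * of_nat j"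
      using thetaL_even thetaL_odd by blast
    then have "2 * (2 * b + of_nat i + of_nat j) = 2 * of_nat d"
      using eq by algebra
    then have "2 * b + of_nat i + of_nat j = of_nat d" by (rule double_cancel)
    then show False using assms(2) by simp
  qed
qed

text \<open>Serves the assumption \<open>no_eig0\<close> of \<open>bihom_exists_eig\<close>. For odd
  \<open>j\<close> equality would mean j + 1 = 0.\<close>

lemma thetaL_neq_reflect:
  assumes "2 * b + of_nat j \<noteq> of_nat d + 1"
  shows "thetaL b d j \<noteq> 1 - thetaL b d 0"
proof
  assume eq: "thetaL b d j = 1 - thetaL b d 0"
  show False
  proof (cases "even j")
    case True
    then have "2 * (2 * b + of_nat j) = 2 * (of_nat d + 1)"
      using eq thetaL_even[OF True, of b d] thetaL_even[of 0 b d] by simp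
    then have "2 * b + of_nat j = of_nat d + 1" by (rule double_cancel)
    then show False using assms by simp
  next
    case False
    have "2 * of_nat (Suc j) = 2 * (0::complex)"
      using eq thetaL_odd[OF False, of b d] thetaL_even[of 0 b d] by simp algebra
    then have "of_nat (Suc j) = (0::complex)" by (rule double_cancel)
    then show False by (simp only: of_nat_eq_0_iff)
  qed
qed

section \<open>Homomorphisms for permuted generators and changed parameters\<close>

context bi_seq
begin

text \<open>The permutation (1 3) fixes Y, so \<open>unit_at 0\<close> remains an eigenvector for
  the first eigenvalue and can be the image of the generator. The assumption \<open>init\<close> is
  coordinate 0 of what \<open>bihom_exists\<close> asks about Y Z \<open>unit_at 0\<close>; the
  other coordinates agree in any case.\<close>

lemma bihom_swap13:
  assumes src: "bi_seq d th' ths phi' z3 z2 z1"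
    and init: "(zz 0 - th' 0) * (ths 0 - ths 1) = phi 1 + phi' 1"
    and ev: "\<And>j. j \<le> d \<Longrightarrow> ths j \<noteq> ths (Suc d)"
  obtains f where "bihom d f (bidiag_op d th' ths phi' z1) (\<lambda>i. B (perm13 i))" "f (unit_at 0) = unit_at 0"
proof -
  interpret S: bi_seq d th' ths phi' z3 z2 z1 by (rule src)
  have e: "unit_at 0 \<in> coords d" by (simp add: unit_at_coords)
  have p: "B (perm13 1) = B 3" "B (perm13 2) = B 2" by (simp_all add: perm13_def)
  have e0: "B (perm13 2) (unit_at 0) j = ths 0 * unit_at 0 j" for j
    by (auto simp: p bidiag_op2 unit_at_def)
  have b3: "B 3 (unit_at 0) j = (if j = 0 then zz 0 else if j = 1 \<and> 1 \<le> d then - 1 else 0)" for j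
  proof (cases "j \<le> d")
    case True
    then show ?thesis by (auto simp: B3_row[OF _ e] unit_at_def)
  next
    case False
    then show ?thesis using B_closed[of 3, OF _ e] by (auto simp: coords_def)
  qed
  have "B (perm13 2) (B (perm13 1) (unit_at 0)) j = ths 1 * B (perm13 1) (unit_at 0) j +
      (phi' 1 - th' 0 * ths 1 + th' 0 * ths 0) * unit_at 0 j" for j
  proof (cases "j = 0")
    case True
    have "phi (Suc 0) * B 3 (unit_at 0) (Suc 0) = - phi (Suc 0)"
    proof (cases "d = 0")
      case True
      then have "phi (Suc 0) = 0" using phid by simp
      then show ?thesis by simp
    qed (simp add: b3)
    then have "B 2 (B 3 (unit_at 0)) 0 = ths 0 * zz 0 - phi 1"
      by (simp add: B2_row b3)
    moreover have "B 3 (unit_at 0) 0 = zz 0" by (simp add: b3)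
    moreover have "ths 0 * zz 0 - phi 1 = ths 1 * zz 0 + (phi' 1 - th' 0 * ths 1 + th' 0 * ths 0)"
      using init by algebra
    ultimately show ?thesis unfolding p True by (simp add: unit_at_def)
  next
    case False
    then show ?thesis unfolding p by (auto simp: bidiag_op2 b3 unit_at_def)
  qed
  moreover have "no_eigvec d (B (perm13 2)) (ths (Suc d))"
    unfolding p by (rule upper_no_eigvec[OF ev])
  ultimately show ?thesis
    using S.bihom_exists[of "\<lambda>i. B (perm13 i)" "unit_at 0", OF bi_rep_perm13[OF bi_rep_B] e e0] that by blast
qed

end

lemma zE_swap: "zE a b c d = zE b a c d" by (simp add: zE_def)
lemma zO_swap: "zO a b c d = zO b a c d" by (simp add: zO_def)

abbreviation "Eop a b c d \<equiv> snd (Emod a b c d)"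
abbreviation "Oop a b c d \<equiv> snd (Omod a b c d)"

text \<open>By \<open>thetaL_neq\<close>, the assumption on \<open>b\<close> keeps
  \<open>thetaL b d (Suc d)\<close>, the value one step beyond the diagonal of Y, off that
  diagonal.\<close>

lemma bihom_E_swap13:
  assumes d: "odd d" and b: "\<And>j. j \<le> d \<Longrightarrow> 2 * b + of_nat j + 1 \<noteq> 0"
  obtains f where "bihom d f (Eop a b c d) (\<lambda>i. Eop c b a d (perm13 i))" "f (unit_at 0) = unit_at 0"
proof -
  interpret T: bi_seq d "thetaL c d" "thetaL b d" "phiE c b a d" "zE b a c d" "zE a c b d" "zE c b a d"
    by (rule bi_seq_E[OF d])
  have s: "bi_seq d (thetaL a d) (thetaL b d) (phiE a b c d) (zE c b a d) (zE a c b d) (zE b a c d)"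
    using bi_seq_E[OF d, of a b c] by (simp add: zE_swap)
  have "thetaL b d j \<noteq> thetaL b d (Suc d)" if "j \<le> d" for j
    by (rule thetaL_neq) (use b[OF that] that in \<open>auto simp: algebra_simps\<close>)
  moreover have "(T.zz 0 - thetaL a d 0) * (thetaL b d 0 - thetaL b d 1) = phiE c b a d 1 + phiE a b c d 1"
    by (simp add: zcoef_def thetaL_def phiE_def zE_def field_simps power2_eq_square)
  ultimately show ?thesis
    using T.bihom_swap13[OF s] that unfolding Emod_bidiag zE_swap[of b a] by blast
qed

lemma bihom_O_swap13:
  assumes d: "even d" and b: "\<And>j. j \<le> d \<Longrightarrow> 2 * b + of_nat j + 1 \<noteq> 0"
  obtains f where "bihom d f (Oop a b c d) (\<lambda>i. Oop c b a d (perm13 i))" "f (unit_at 0) = unit_at 0"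
proof -
  interpret T: bi_seq d "thetaL c d" "thetaL b d" "phiO c b a d" "zO b a c d" "zO a c b d" "zO c b a d"
    by (rule bi_seq_O[OF d])
  have s: "bi_seq d (thetaL a d) (thetaL b d) (phiO a b c d) (zO c b a d) (zO a c b d) (zO b a c d)"
    using bi_seq_O[OF d, of a b c] by (simp add: zO_swap)
  have "thetaL b d j \<noteq> thetaL b d (Suc d)" if "j \<le> d" for j
    by (rule thetaL_neq) (use b[OF that] that in \<open>auto simp: algebra_simps\<close>)
  moreover have "(T.zz 0 - thetaL a d 0) * (thetaL b d 0 - thetaL b d 1) = phiO c b a d 1 + phiO a b c d 1"
    by (simp add: zcoef_def thetaL_def phiO_def zO_def field_simps power2_eq_square)
  ultimately show ?thesis
    using T.bihom_swap13[OF s] that unfolding Omod_bidiag zO_swap[of b a] by blast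
qed

text \<open>The central scalars of type E are even in \<open>b\<close>, and for odd \<open>d\<close>
  the last diagonal entry \<open>thetaL b d d\<close> of Y in the target is the first one,
  \<open>thetaL (- b) d 0\<close>, in the source. So the generator goes to the eigenvector for the
  last diagonal entry. The bound on \<open>r\<close> makes that entry simple and keeps the two
  eigenvalues excluded in \<open>bihom_exists_eig\<close> off the diagonal.\<close>

lemma bihom_E_neg:
  fixes r :: real
  assumes d: "odd d" and b: "b = of_real r" "2 * r > real d + 1"
  obtains f where "bihom d f (Eop a (- b) c d) (Eop a b c d)" "f (unit_at 0) \<noteq> (\<lambda>_. 0)"
proof -
  have ne: "2 * b + x \<noteq> y" if "x = of_real x'" "y = of_real y'" "2 * r + x' \<noteq> y'" for x y x' y'
  proof -
    have "2 * b + x = of_real (2 * r + x')" using that b by simp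
    then have "2 * b + x = y \<longleftrightarrow> 2 * r + x' = y'"
      unfolding that(2) by (simp only: of_real_eq_iff)
    then show ?thesis using that(3) by blast
  qed
  interpret T: bi_seq d "thetaL a d" "thetaL b d" "phiE a b c d" "zE b c a d" "zE c a b d" "zE a b c d"
    by (rule bi_seq_E[OF d])
  have z: "zE (- b) c a d = zE b c a d" "zE c a (- b) d = zE c a b d" "zE a (- b) c d = zE a b c d"
    by (simp_all add: zE_def)
  interpret S: bi_seq d "thetaL a d" "thetaL (- b) d" "phiE a (- b) c d" "zE b c a d" "zE c a b d" "zE a b c d"
    using bi_seq_E[OF d, of a "- b" c] unfolding z .
  have t0: "thetaL (- b) d 0 = thetaL b d d" using d by (simp add: thetaL_def)
  have "thetaL b d j \<noteq> thetaL b d d" if "j < d" for j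
    by (rule thetaL_neq) (use that ne[of "of_nat j" "real j" 0 0] b(2) in auto)
  then obtain e where e: "e \<in> coords d" "e d = 1" "\<And>j. T.B 2 e j = thetaL (- b) d 0 * e j"
    using T.upper_eigvec unfolding t0 by blast
  have n0: "no_eigvec d (T.B 2) (1 - thetaL (- b) d 0)"
  proof (rule T.upper_no_eigvec)
    fix j assume j: "j \<le> d"
    show "thetaL b d j \<noteq> 1 - thetaL (- b) d 0"
    proof
      assume eq: "thetaL b d j = 1 - thetaL (- b) d 0"
      show False
      proof (cases "even j")
        case True
        have "2 * of_nat j = 2 * (of_nat (d + 1) :: complex)"
          using eq thetaL_even[OF True, of b d] thetaL_even[of 0 "- b" d] by simp algebra
        then have "of_nat j = (of_nat (d + 1) :: complex)" by (rule double_cancel)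
        then show False using j by (simp only: of_nat_eq_iff)
      next
        case False
        have "2 * (2 * b + (of_nat j + 1)) = 2 * 0"
          using eq thetaL_odd[OF False, of b d] thetaL_even[of 0 "- b" d] by simp algebra
        then have "2 * b + (of_nat j + 1) = 0" by (rule double_cancel)
        then show False using ne[of "of_nat j + 1" "real j + 1" 0 0] b(2) by simp
      qed
    qed
  qed
  have n1: "no_eigvec d (T.B 2) (thetaL (- b) d (Suc d))"
  proof (rule T.upper_no_eigvec)
    fix j assume j: "j \<le> d"
    show "thetaL b d j \<noteq> thetaL (- b) d (Suc d)"
    proof
      assume eq: "thetaL b d j = thetaL (- b) d (Suc d)"
      show False
      proof (cases "even j")
        case True
        have "2 * (2 * b + of_nat j) = 2 * (of_nat d + 1)"
          using eq thetaL_even[OF True, of b d] thetaL_even[of "Suc d" "- b" d] d by simp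
        then have "2 * b + of_nat j = of_nat d + 1" by (rule double_cancel)
        then show False using ne[of "of_nat j" "real j" "of_nat d + 1" "real d + 1"] b(2) by simp
      next
        case False
        have "2 * of_nat (Suc j) = 2 - 2 * thetaL b d j - 2 * b + of_nat d"
          using thetaL_odd[OF False, of b d] by simp
        also have "\<dots> = 2 * (0::complex)"
          unfolding eq using thetaL_even[of "Suc d" "- b" d] d by simp
        finally have "2 * of_nat (Suc j) = 2 * (0::complex)" .
        then have "of_nat (Suc j) = (0::complex)" by (rule double_cancel)
        then show False by (simp only: of_nat_eq_0_iff)
      qed
    qed
  qed
  have h: "2 * thetaL (- b) d 0 \<noteq> 1"
  proof
    assume "2 * thetaL (- b) d 0 = 1"
    then have "2 * b + (of_nat d + 1) = 0" using thetaL_even[of 0 "- b" d] by simp algebra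
    then show False using ne[of "of_nat d + 1" "real d + 1" 0 0] b(2) by simp
  qed
  from e have ez: "e \<noteq> (\<lambda>_. 0)" by auto
  obtain f where f: "bihom d f S.B T.B" "f (unit_at 0) = e"
    using S.bihom_exists_eig[OF T.bi_rep_B e(1,3) h n0 n1] by blast
  show ?thesis by (rule that[of f]) (use f ez in \<open>simp_all add: Emod_bidiag z\<close>)
qed

text \<open>After (1 2) the second generator of the target is the lower bidiagonal matrix with
  diagonal \<open>thetaL b d\<close>. Its eigenvector for the first diagonal entry is the image of
  the generator, and the bound on \<open>r\<close> separates the eigenvalues involved.\<close>

lemma bihom_O_swap12:
  fixes r :: real
  assumes d: "even d" and b: "b = of_real r" "2 * r + real d + 1 < 0"
  obtains f where "bihom d f (Oop a b c d) (\<lambda>i. Oop b a c d (perm12 i))" "f (unit_at 0) \<noteq> (\<lambda>_. 0)"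
proof -
  have ne: "2 * b + x \<noteq> y" if "x = of_real x'" "y = of_real y'" "2 * r + x' \<noteq> y'" for x y x' y'
  proof -
    have "2 * b + x = of_real (2 * r + x')" using that b by simp
    then have "2 * b + x = y \<longleftrightarrow> 2 * r + x' = y'"
      unfolding that(2) by (simp only: of_real_eq_iff)
    then show ?thesis using that(3) by blast
  qed
  interpret T: bi_seq d "thetaL b d" "thetaL a d" "phiO b a c d" "zO a c b d" "zO c b a d" "zO b a c d"
    by (rule bi_seq_O[OF d])
  interpret S: bi_seq d "thetaL a d" "thetaL b d" "phiO a b c d" "zO c b a d" "zO a c b d" "zO b a c d"
    using bi_seq_O[OF d, of a b c] by (simp add: zO_swap)
  have p: "T.B (perm12 2) = T.B 1" by (simp add: perm12_def)
  have th: "thetaL b d j \<noteq> thetaL b d 0" if "0 < j" "j \<le> d" for j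
    by (rule thetaL_neq) (use that ne[of "of_nat j" "real j" "of_nat d" "real d"] b(2) in auto)
  obtain e where e: "e \<in> coords d" "e 0 = 1" "\<And>j. T.B 1 e j = thetaL b d 0 * e j"
    using T.lower_eigvec[OF th] by blast
  have e3: "T.B (perm12 2) e j = thetaL b d 0 * e j" for j by (simp only: p e(3))
  have n0: "no_eigvec d (T.B (perm12 2)) (1 - thetaL b d 0)"
    unfolding p
  proof (intro T.lower_no_eigvec thetaL_neq_reflect)
    fix j assume "j \<le> d"
    then show "2 * b + of_nat j \<noteq> of_nat d + 1"
      using ne[of "of_nat j" "real j" "of_nat d + 1" "real d + 1"] b(2) by simp
  qed
  have n1: "no_eigvec d (T.B (perm12 2)) (thetaL b d (Suc d))"
    unfolding p
  proof (intro T.lower_no_eigvec thetaL_neq)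
    fix j assume "j \<le> d"
    then have "real j \<le> real d" by simp
    have "2 * b + (of_nat j + of_nat (Suc d)) \<noteq> of_nat d"
      by (rule ne[of _ "real j + real (Suc d)" _ "real d"]) (use b(2) \<open>real j \<le> real d\<close> in auto)
    then show "2 * b + of_nat j + of_nat (Suc d) \<noteq> of_nat d"
      unfolding add.assoc .
  next
    fix j assume "j \<le> d"
    then show "j \<noteq> Suc d" by simp
  qed
  have h: "2 * thetaL b d 0 \<noteq> 1"
  proof
    assume "2 * thetaL b d 0 = 1"
    then have "2 * b + 0 = of_nat d + 1" using thetaL_even[of 0 b d] by simp algebra
    then show False using ne[of 0 0 "of_nat d + 1" "real d + 1"] b(2) by simp
  qed
  from e have ez: "e \<noteq> (\<lambda>_. 0)" by auto
  obtain f where f: "bihom d f S.B (\<lambda>i. T.B (perm12 i))" "f (unit_at 0) = e"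
    using S.bihom_exists_eig[OF bi_rep_perm12[OF T.bi_rep_B] e(1) e3 h n0 n1] by blast
  show ?thesis by (rule that[of f]) (use f ez in \<open>simp_all add: Omod_bidiag zO_swap[of a b]\<close>)
qed

text \<open>The expression to be avoided in \<open>irreducible\<close> factors. For even
  \<open>k\<close> it is -2 times the entry of \<open>phiE a (- b) c d\<close> at the reflected
  index \<open>d - k\<close>; for odd \<open>k\<close> it is a product of linear factors of the form
  2b + i - d, covered by \<open>e\<close>.\<close>

lemma irreducible_E:
  assumes d: "odd d"
    and o: "\<And>m. 1 \<le> m \<Longrightarrow> m \<le> d \<Longrightarrow> odd m \<Longrightarrow> c\<^sup>2 \<noteq> (2 * a + 2 * b - of_nat d + 2 * of_nat m - 1)\<^sup>2 / 4
       \<and> c\<^sup>2 \<noteq> (2 * a - 2 * b + of_nat d - 2 * of_nat m + 1)\<^sup>2 / 4"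
    and e: "\<And>i. i \<le> 2 * d \<Longrightarrow> 2 * b + of_nat i \<noteq> of_nat d"
  shows "bimod_irreducible (Emod a b c d)"
proof -
  interpret bi_seq d "thetaL a d" "thetaL b d" "phiE a b c d" "zE b c a d" "zE c a b d" "zE a b c d"
    by (rule bi_seq_E[OF d])
  show ?thesis unfolding Emod_bidiag
  proof (subst bidiag_pair, rule irreducible)
    fix k assume k: "k < d"
    define s where "s = (-1::complex) ^ k"
    have ss: "s * s = 1" by (simp add: s_def flip: power_mult_distrib)
    have t: "thetaL x d k = s * (2 * x - of_nat d + 2 * of_nat k) / 2" for x
      by (simp add: thetaL_def s_def)
    have S: "of_nat (Suc k) = 1 + (of_nat k :: complex)" by simp
    have "2 * thetaL b d k + s = s * (2 * b + of_nat (2 * k + 1) - of_nat d)"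
      unfolding t by (simp add: algebra_simps diff_divide_distrib add_divide_distrib)
    then show D: "2 * thetaL b d k + (-1) ^ k \<noteq> 0"
      using e[of "2 * k + 1"] k by (auto simp: s_def)
    show P: "phiE a b c d (Suc k) \<noteq> 0"
    proof (cases "even k")
      case True
      then show ?thesis using o[of "Suc k"] k by (simp add: phiE_def)
    next
      case False
      have "(of_nat d - of_nat k :: complex) = of_nat (d - k)" using k by (simp add: of_nat_diff)
      moreover have "of_nat (d - k) \<noteq> (0::complex)" using k by (simp only: of_nat_eq_0_iff)
      ultimately have "of_nat d - of_nat k \<noteq> (0::complex)" by (simp only: not_False_eq_True)
      moreover have "of_nat (Suc k) \<noteq> (0::complex)" by (simp only: of_nat_eq_0_iff)
      ultimately show ?thesis using False by (simp add: phiE_def)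
    qed
    show "(2 * thetaL b d k + (-1) ^ k)\<^sup>2 - 2 * (thetaL a d k - (-1) ^ k * zz k) * (2 * thetaL b d k + (-1) ^ k)
          - 2 * phiE a b c d (Suc k) \<noteq> 0" (is "?g \<noteq> 0")
    proof (cases "even k")
      case True
      then have phi: "phiE a b c d k = of_nat k * (of_nat d - of_nat k + 1)"
        "phiE a b c d (Suc k) = c\<^sup>2 - (2 * a + 2 * b - of_nat d + 2 * of_nat (Suc k) - 1)\<^sup>2 / 4"
        by (simp_all add: phiE_def)
      have g: "?g = -2 * (c\<^sup>2 - (2 * a - 2 * b + of_nat d - 2 * of_nat (Suc k) + 1)\<^sup>2 / 4)"
        using ss unfolding zcoef_def zE_def s_def[symmetric] t phi S of_nat_add by algebra
      have "c\<^sup>2 - (2 * a - 2 * b + of_nat d - 2 * of_nat (Suc k) + 1)\<^sup>2 / 4 \<noteq> 0"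
        using o[of "Suc k"] k True unfolding right_minus_eq by auto
      then show ?thesis unfolding g mult_eq_0_iff by simp
    next
      case False
      then have phi: "phiE a b c d k = c\<^sup>2 - (2 * a + 2 * b - of_nat d + 2 * of_nat k - 1)\<^sup>2 / 4"
        "phiE a b c d (Suc k) = of_nat (Suc k) * (of_nat d - of_nat (Suc k) + 1)"
        by (simp_all add: phiE_def)
      have g: "?g = 2 * (2 * b + of_nat k - of_nat d) * (2 * b + of_nat (d + Suc k) - of_nat d)"
        using ss unfolding zcoef_def zE_def s_def[symmetric] t phi S of_nat_add by algebra
      have "2 * b + of_nat k - of_nat d \<noteq> 0" "2 * b + of_nat (d + Suc k) - of_nat d \<noteq> 0"
        using e[of k] e[of "d + Suc k"] k unfolding right_minus_eq by auto
      then show ?thesis unfolding g mult_eq_0_iff by simp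
    qed
  qed
qed

text \<open>Here the expression to be avoided splits into a factor 2b + i - d, covered by
  \<open>e\<close>, and the second expression in \<open>od\<close> (even \<open>k\<close>) or
  \<open>ev\<close> (odd \<open>k\<close>).\<close>

lemma irreducible_O:
  assumes d: "even d"
    and ev: "\<And>m. 1 \<le> m \<Longrightarrow> m \<le> d \<Longrightarrow> even m \<Longrightarrow> of_nat d + 1 - 2 * of_nat m - 2 * a - 2 * b - 2 * c \<noteq> 0
       \<and> 2 * b - of_nat d - 1 + 2 * of_nat m - 2 * a - 2 * c \<noteq> 0"
    and od: "\<And>m. 1 \<le> m \<Longrightarrow> m \<le> d \<Longrightarrow> odd m \<Longrightarrow> of_nat d + 1 - 2 * of_nat m - 2 * a - 2 * b + 2 * c \<noteq> 0
       \<and> 2 * b - 2 * a + 2 * c - of_nat d - 1 + 2 * of_nat m \<noteq> 0"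
    and e: "\<And>i. i \<le> 2 * d \<Longrightarrow> 2 * b + of_nat i \<noteq> of_nat d"
  shows "bimod_irreducible (Omod a b c d)"
proof -
  interpret bi_seq d "thetaL a d" "thetaL b d" "phiO a b c d" "zO b c a d" "zO c a b d" "zO a b c d"
    by (rule bi_seq_O[OF d])
  show ?thesis unfolding Omod_bidiag
  proof (subst bidiag_pair, rule irreducible)
    fix k assume k: "k < d"
    have nz: "of_nat (Suc k) \<noteq> (0::complex)" "of_nat (d - k) \<noteq> (0::complex)"
      using k by (simp_all only: of_nat_eq_0_iff)
    have dk: "of_nat (Suc k) - of_nat d - 1 = (- of_nat (d - k) :: complex)"
      using k by (simp add: of_nat_diff)
    define s where "s = (-1::complex) ^ k"
    have ss: "s * s = 1" by (simp add: s_def flip: power_mult_distrib)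
    have t: "thetaL x d k = s * (2 * x - of_nat d + 2 * of_nat k) / 2" for x
      by (simp add: thetaL_def s_def)
    have S: "of_nat (Suc k) = 1 + (of_nat k :: complex)" by simp
    have "2 * thetaL b d k + s = s * (2 * b + of_nat (2 * k + 1) - of_nat d)"
      unfolding t by (simp add: algebra_simps diff_divide_distrib add_divide_distrib)
    then show D: "2 * thetaL b d k + (-1) ^ k \<noteq> 0"
      using e[of "2 * k + 1"] k by (auto simp: s_def)
    show P: "phiO a b c d (Suc k) \<noteq> 0"
    proof (cases "even k")
      case True
      then show ?thesis using od[of "Suc k"] k nz unfolding phiO_def dk by simp
    next
      case False
      then show ?thesis using ev[of "Suc k"] k nz unfolding phiO_def by simp
    qed
    show "(2 * thetaL b d k + (-1) ^ k)\<^sup>2 - 2 * (thetaL a d k - (-1) ^ k * zz k) * (2 * thetaL b d k + (-1) ^ k)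
          - 2 * phiO a b c d (Suc k) \<noteq> 0" (is "?g \<noteq> 0")
    proof (cases "even k")
      case True
      then have phi: "phiO a b c d k = of_nat k * (of_nat d + 1 - 2 * of_nat k - 2 * a - 2 * b - 2 * c) / 2"
        "phiO a b c d (Suc k) = (of_nat (Suc k) - of_nat d - 1) * (of_nat d + 1 - 2 * of_nat (Suc k) - 2 * a - 2 * b + 2 * c) / 2"
        by (simp_all add: phiO_def)
      have "?g = (2 * b + of_nat (d + Suc k) - of_nat d) * (2 * b - 2 * a + 2 * c - of_nat d - 1 + 2 * of_nat (Suc k))"
        using ss unfolding zcoef_def zO_def s_def[symmetric] t phi S of_nat_add by algebra
      moreover have "2 * b + of_nat (d + Suc k) - of_nat d \<noteq> 0" using e[of "d + Suc k"] k by simp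
      ultimately show ?thesis using od[of "Suc k"] k True by simp
    next
      case False
      then have phi: "phiO a b c d k = (of_nat k - of_nat d - 1) * (of_nat d + 1 - 2 * of_nat k - 2 * a - 2 * b + 2 * c) / 2"
        "phiO a b c d (Suc k) = of_nat (Suc k) * (of_nat d + 1 - 2 * of_nat (Suc k) - 2 * a - 2 * b - 2 * c) / 2"
        by (simp_all add: phiO_def)
      have "?g = (2 * b + of_nat k - of_nat d) * (2 * b - of_nat d - 1 + 2 * of_nat (Suc k) - 2 * a - 2 * c)"
        using ss unfolding zcoef_def zO_def s_def[symmetric] t phi S of_nat_add by algebra
      moreover have "2 * b + of_nat k - of_nat d \<noteq> 0" using e[of k] k by simp
      ultimately show ?thesis using ev[of "Suc k"] k False by simp
    qed
  qed
qed

section \<open>Restriction to the plane x1 = 0\<close>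

text \<open>The Dunkl analogue of the integer m: T_i x_i^m = \<open>cnum\<close> k_i m x_i^(m-1). It
  vanishes only at m = 0 and, if t_i is finite, at m = t_i.\<close>

definition cnum :: "real \<Rightarrow> nat \<Rightarrow> complex" where
  "cnum k m = of_nat m + of_real k * (1 - (-1) ^ m)"

lemma dunkl_cnum: "dunkl kk i f p = cnum (kk i) (expo i p + 1) * f (incr i p)"
  by (simp add: dunkl_def cnum_def Let_def)

lemma tval_enat:
  assumes "tval k = enat t"
  shows "odd t" "2 * k = - real t"
proof -
  obtain m where m: "odd m" "2 * k = - real m"
    using assms by (auto simp: tval_def split: if_splits)
  then have "\<exists>m. odd m \<and> 2 * k = - real m" by blast
  then have "tval k = enat (nat \<lfloor>- 2 * k\<rfloor>)" by (simp add: tval_def)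
  also have "- 2 * k = real m" using m by simp
  finally have "t = m" using assms by simp
  then show "odd t" "2 * k = - real t" using m by auto
qed

lemma cnum_of_real: "cnum k m = of_real (real m + k * (1 - (-1) ^ m))"
  by (simp add: cnum_def)

lemma cnum_zero_iff: "cnum k m = 0 \<longleftrightarrow> m = 0 \<or> odd m \<and> 2 * k = - real m"
  unfolding cnum_of_real of_real_eq_0_iff by (cases "even m") auto

text \<open>This is how n < t1 enters: in degree n, the Dirac equation can be solved for each next
  power of x1.\<close>

lemma cnum_nonzero:
  assumes "enat n < tval k" "a < n"
  shows "cnum k (Suc a) \<noteq> 0"
proof
  assume "cnum k (Suc a) = 0"
  then have "odd (Suc a)" "2 * k = - real (Suc a)" unfolding cnum_zero_iff by auto
  then have "\<exists>m. odd m \<and> 2 * k = - real m" by blast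
  then have "tval k = enat (nat \<lfloor>- 2 * k\<rfloor>)" by (simp add: tval_def)
  also have "- 2 * k = real (Suc a)" using \<open>2 * k = - real (Suc a)\<close> by simp
  finally show False using assms by simp
qed

lemma sum_lt2: "(\<Sum>t<2. g t) = g 0 + g (1::nat)" for g :: "nat \<Rightarrow> complex"
  by (simp add: numeral_2_eq_2)

text \<open>Both spinor components of the Dirac equation, solved for the T_1 term; the result is a
  recursion on the power of x1.\<close>

lemma Mn_iff:
  "f \<in> Mn k1 k2 k3 n \<longleftrightarrow> f \<in> Pdeg n \<and> (\<forall>a b c.
     cnum k1 (Suc a) * f (0, Suc a, b, c)
       = - \<i> * cnum k2 (Suc b) * f (0, a, Suc b, c) + cnum k3 (Suc c) * f (Suc 0, a, b, Suc c) \<and>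
     cnum k1 (Suc a) * f (Suc 0, Suc a, b, c)
       = \<i> * cnum k2 (Suc b) * f (Suc 0, a, Suc b, c) - cnum k3 (Suc c) * f (0, a, b, Suc c))"
proof -
  have D0: "Dop k1 k2 k3 f (0, a, b, c) = cnum k1 (Suc a) * f (Suc 0, Suc a, b, c)
     - \<i> * cnum k2 (Suc b) * f (Suc 0, a, Suc b, c) + cnum k3 (Suc c) * f (0, a, b, Suc c)"
    and D1: "Dop k1 k2 k3 f (Suc 0, a, b, c) = cnum k1 (Suc a) * f (0, Suc a, b, c)
     + \<i> * cnum k2 (Suc b) * f (0, a, Suc b, c) - cnum k3 (Suc c) * f (Suc 0, a, b, Suc c)" for a b c
    by (simp_all add: Dop_def emat_def sum_lt2 sig_def dunkl_cnum expo_def incr_def kfun_def)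
  have D2: "Dop k1 k2 k3 f (s, a, b, c) = 0" if "s \<ge> 2" for s a b c
    using that by (simp add: Dop_def emat_def sum_lt2 sig_def)
  have "Dop k1 k2 k3 f = (\<lambda>_. 0) \<longleftrightarrow> (\<forall>a b c. Dop k1 k2 k3 f (0, a, b, c) = 0 \<and> Dop k1 k2 k3 f (Suc 0, a, b, c) = 0)"
  proof
    assume h: "\<forall>a b c. Dop k1 k2 k3 f (0, a, b, c) = 0 \<and> Dop k1 k2 k3 f (Suc 0, a, b, c) = 0"
    show "Dop k1 k2 k3 f = (\<lambda>_. 0)"
    proof
      fix p :: "nat \<times> nat \<times> nat \<times> nat"
      obtain s a b c where p: "p = (s, a, b, c)" by (cases p)
      show "Dop k1 k2 k3 f p = 0"
        using h D2[of s a b c] less_2_cases[of s] unfolding p by (cases "s < 2") auto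
    qed
  qed simp
  then show ?thesis unfolding Mn_def mem_Collect_eq D0 D1
    by (auto simp: algebra_simps eq_neg_iff_add_eq_0 add_eq_0_iff)
qed

text \<open>The component of f restricted to x1 = 0 in the e-eigenspace of e_1 (e = 1 or e = -1), at x2^b x3^c.
  The factor e^b makes both eigenspaces carry the same matrices.\<close>

definition restr :: "complex \<Rightarrow> pvec \<Rightarrow> nat \<Rightarrow> nat \<Rightarrow> complex" where
  "restr e f b c = e ^ b * (f (0, 0, b, c) + e * f (Suc 0, 0, b, c))"

text \<open>X involves only x2, x3, T_2, T_3 and reflections, so it passes to the restriction
  without the Dirac equation. The eigenvalue of e_1 is absorbed by the factor e^b, because the
  off-diagonal terms change b by one.\<close>

lemma restr_BIgen1:
  assumes e: "e = 1 \<or> e = -1"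
  shows "restr e (BIgen k1 k2 k3 (Suc 0) f) b c =
      ((-1) ^ (b + c) / 2 + of_real k2 * (-1) ^ c + of_real k3 * (-1) ^ b) * restr e f b c
      + \<i> * (-1) ^ (b + c) * ((if c = 0 then 0 else cnum k2 (Suc b) * restr e f (Suc b) (c - 1))
          - (if b = 0 then 0 else cnum k3 (Suc c) * restr e f (b - 1) (Suc c)))"
  using e
  by (cases b; cases c)
    (auto simp: restr_def BIgen_def ang_def Let_def refl_def emat_def sum_lt2 sig_def mulx_def
      dunkl_cnum expo_def incr_def decr_def kfun_def algebra_simps power_add)

text \<open>The term with T_1 reads the coefficient linear in x1. The Dirac equation at power 0 of
  x1 replaces it by T_2 and T_3 terms of the restriction: the T_3 part joins the diagonal, the T_2
  part is the superdiagonal.\<close>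

lemma restr_BIgen2:
  assumes e: "e = 1 \<or> e = -1" and f: "f \<in> Mn k1 k2 k3 n"
  shows "restr e (BIgen k1 k2 k3 2 f) b c =
      ((-1) ^ c * (cnum k3 c + 1 / 2 + of_real k1) + of_real k3) * restr e f b c
      - (if c = 0 then 0 else \<i> * (-1) ^ c * cnum k2 (Suc b) * restr e f (Suc b) (c - 1))"
proof (cases c)
  case 0
  then show ?thesis
    by (simp add: restr_def BIgen_def ang_def Let_def refl_def emat_def sum_lt2 sig_def mulx_def
      dunkl_cnum expo_def incr_def decr_def kfun_def algebra_simps power_add) (simp add: cnum_def)
next
  case (Suc c')
  have 1: "BIgen k1 k2 k3 2 f (0, 0, b, c) = ((-1) ^ c * (1 / 2 + of_real k1) + of_real k3) * f (0, 0, b, c)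
        - (-1) ^ c * (cnum k1 (Suc 0) * f (Suc 0, Suc 0, b, c'))"
    and 2: "BIgen k1 k2 k3 2 f (Suc 0, 0, b, c) = ((-1) ^ c * (1 / 2 + of_real k1) + of_real k3) * f (Suc 0, 0, b, c)
        + (-1) ^ c * (cnum k1 (Suc 0) * f (0, Suc 0, b, c'))"
    unfolding Suc
    by (simp_all add: BIgen_def ang_def Let_def refl_def emat_def sum_lt2 sig_def mulx_def
      dunkl_cnum expo_def incr_def decr_def kfun_def algebra_simps)
  have 3: "cnum k1 (Suc 0) * f (0, Suc 0, b, c')
       = - \<i> * cnum k2 (Suc b) * f (0, 0, Suc b, c') + cnum k3 (Suc c') * f (Suc 0, 0, b, Suc c')"
     and 4: "cnum k1 (Suc 0) * f (Suc 0, Suc 0, b, c')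
       = \<i> * cnum k2 (Suc b) * f (Suc 0, 0, Suc b, c') - cnum k3 (Suc c') * f (0, 0, b, Suc c')"
    using f unfolding Mn_iff by blast+
  show ?thesis using e
  proof
    assume "e = 1"
    then show ?thesis unfolding restr_def 1 2 3 4 unfolding Suc by (simp add: algebra_simps)
  next
    assume e: "e = -1"
    show ?thesis unfolding restr_def 1 2 3 4 unfolding Suc e
      by (simp add: algebra_simps)
  qed
qed

text \<open>As for Y with x2 and x3 exchanged, which moves the off-diagonal entry below the
  diagonal.\<close>

lemma restr_BIgen3:
  assumes e: "e = 1 \<or> e = -1" and f: "f \<in> Mn k1 k2 k3 n"
  shows "restr e (BIgen k1 k2 k3 3 f) b c =
      ((-1) ^ b * (cnum k2 b + 1 / 2 + of_real k1) + of_real k2) * restr e f b c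
      + (if b = 0 then 0 else \<i> * (-1) ^ b * cnum k3 (Suc c) * restr e f (b - 1) (Suc c))"
proof (cases b)
  case 0
  then show ?thesis
    by (simp add: restr_def BIgen_def ang_def Let_def refl_def emat_def sum_lt2 sig_def mulx_def
      dunkl_cnum expo_def incr_def decr_def kfun_def algebra_simps power_add) (simp add: cnum_def)
next
  case (Suc b')
  have 1: "BIgen k1 k2 k3 3 f (0, 0, b, c) = ((-1) ^ b * (1 / 2 + of_real k1) + of_real k2) * f (0, 0, b, c)
        + \<i> * (-1) ^ b * (cnum k1 (Suc 0) * f (0, Suc 0, b', c))"
    and 2: "BIgen k1 k2 k3 3 f (Suc 0, 0, b, c) = ((-1) ^ b * (1 / 2 + of_real k1) + of_real k2) * f (Suc 0, 0, b, c)
        - \<i> * (-1) ^ b * (cnum k1 (Suc 0) * f (Suc 0, Suc 0, b', c))"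
    unfolding Suc
    by (simp_all add: BIgen_def ang_def Let_def refl_def emat_def sum_lt2 sig_def mulx_def
      dunkl_cnum expo_def incr_def decr_def kfun_def algebra_simps)
  have 3: "cnum k1 (Suc 0) * f (0, Suc 0, b', c)
       = - \<i> * cnum k2 (Suc b') * f (0, 0, Suc b', c) + cnum k3 (Suc c) * f (Suc 0, 0, b', Suc c)"
     and 4: "cnum k1 (Suc 0) * f (Suc 0, Suc 0, b', c)
       = \<i> * cnum k2 (Suc b') * f (Suc 0, 0, Suc b', c) - cnum k3 (Suc c) * f (0, 0, b', Suc c)"
    using f unfolding Mn_iff by blast+
  show ?thesis using e
  proof
    assume "e = 1"
    then show ?thesis unfolding restr_def 1 2 3 4 unfolding Suc by (simp add: algebra_simps)
  next
    assume e: "e = -1"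
    show ?thesis unfolding restr_def 1 2 3 4 unfolding Suc e
      by (simp add: algebra_simps)
  qed
qed

section \<open>Reconstruction of an element of M_n from its restriction to x1 = 0\<close>

lemma Mn_supp: "f \<in> Mn k1 k2 k3 n \<Longrightarrow> \<not> (s < 2 \<and> a + b + c = n) \<Longrightarrow> f (s, a, b, c) = 0"
  unfolding Mn_def Pdeg_def by blast

text \<open>\<open>Q\<close> is a region of exponents in which the recursion reads only from the
  region itself, apart from terms with coefficient 0. Induction on the power of x1 spreads the
  vanishing from x1 = 0.\<close>

lemma Mn_vanish:
  assumes f: "f \<in> Mn k1 k2 k3 n" and k1: "enat n < tval k1"
    and Q2: "\<And>b c. Q b c \<Longrightarrow> Q (Suc b) c \<or> cnum k2 (Suc b) = 0"
    and Q3: "\<And>b c. Q b c \<Longrightarrow> Q b (Suc c) \<or> cnum k3 (Suc c) = 0"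
    and base: "\<And>s b c. Q b c \<Longrightarrow> b + c = n \<Longrightarrow> f (s, 0, b, c) = 0"
    and Q: "Q b c"
  shows "f (s, a, b, c) = 0"
  using Q
proof (induction a arbitrary: s b c)
  case 0
  show ?case
  proof (cases "b + c = n")
    case False
    then show ?thesis using Mn_supp[OF f, of s 0 b c] by simp
  qed (use base 0 in simp)
next
  case (Suc a)
  have z: "cnum k2 (Suc b) * f (t, a, Suc b, c) = 0" "cnum k3 (Suc c) * f (t, a, b, Suc c) = 0" for t
    using Suc.IH[of "Suc b" c t] Suc.IH[of b "Suc c" t] Q2[OF Suc.prems] Q3[OF Suc.prems] by auto
  have "cnum k1 (Suc a) * f (0, Suc a, b, c)
       = - \<i> * cnum k2 (Suc b) * f (0, a, Suc b, c) + cnum k3 (Suc c) * f (Suc 0, a, b, Suc c)"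
     "cnum k1 (Suc a) * f (Suc 0, Suc a, b, c)
       = \<i> * cnum k2 (Suc b) * f (Suc 0, a, Suc b, c) - cnum k3 (Suc c) * f (0, a, b, Suc c)"
    using f unfolding Mn_iff by blast+
  then have eqs: "cnum k1 (Suc a) * f (0, Suc a, b, c) = 0" "cnum k1 (Suc a) * f (Suc 0, Suc a, b, c) = 0"
    unfolding mult.assoc z by simp_all
  show ?case
  proof (cases "s < 2 \<and> a < n")
    case True
    then show ?thesis using eqs cnum_nonzero[OF k1, of a] less_2_cases[of s] by auto
  next
    case False
    then show ?thesis using Mn_supp[OF f, of s "Suc a" b c] by auto
  qed
qed

lemma Mn_extend:
  assumes k1: "enat n < tval k1"
  shows "\<exists>f\<in>Mn k1 k2 k3 n. \<forall>b\<le>n. f (0, 0, b, n - b) = u0 b \<and> f (Suc 0, 0, b, n - b) = u1 b"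
proof -
  define F :: "nat \<Rightarrow> nat \<Rightarrow> nat \<Rightarrow> nat \<Rightarrow> complex" where
    "F = rec_nat (\<lambda>s b c. if b + c = n then (if s = 0 then u0 b else if s = 1 then u1 b else 0) else 0)
      (\<lambda>a G s b c. (if s = 0 then - \<i> * cnum k2 (Suc b) * G 0 (Suc b) c + cnum k3 (Suc c) * G 1 b (Suc c)
         else if s = 1 then \<i> * cnum k2 (Suc b) * G 1 (Suc b) c - cnum k3 (Suc c) * G 0 b (Suc c) else 0)
         / cnum k1 (Suc a))"
  have F0: "F 0 s b c = (if b + c = n then (if s = 0 then u0 b else if s = 1 then u1 b else 0) else 0)" for s b c
    by (simp add: F_def)
  have FS: "F (Suc a) s b c = (if s = 0 then - \<i> * cnum k2 (Suc b) * F a 0 (Suc b) c + cnum k3 (Suc c) * F a 1 b (Suc c)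
         else if s = 1 then \<i> * cnum k2 (Suc b) * F a 1 (Suc b) c - cnum k3 (Suc c) * F a 0 b (Suc c) else 0)
         / cnum k1 (Suc a)" for a s b c
    by (simp add: F_def)
  have supp: "F a s b c = 0" if "\<not> (s < 2 \<and> a + b + c = n)" for a s b c
    using that
  proof (induction a arbitrary: s b c)
    case 0
    then show ?case by (auto simp: F0)
  next
    case (Suc a)
    then show ?case using Suc.IH[of _ "Suc b" c] Suc.IH[of _ b "Suc c"] by (auto simp: FS)
  qed
  define f :: pvec where "f = (\<lambda>(s, a, b, c). F a s b c)"
  have fF: "f (s, a, b, c) = F a s b c" for s a b c by (simp add: f_def)
  have "f \<in> Pdeg n" 
    unfolding Pdeg_def mem_Collect_eq fF using supp by blast
  moreover have "cnum k1 (Suc a) * f (0, Suc a, b, c)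
       = - \<i> * cnum k2 (Suc b) * f (0, a, Suc b, c) + cnum k3 (Suc c) * f (Suc 0, a, b, Suc c) \<and>
     cnum k1 (Suc a) * f (Suc 0, Suc a, b, c)
       = \<i> * cnum k2 (Suc b) * f (Suc 0, a, Suc b, c) - cnum k3 (Suc c) * f (0, a, b, Suc c)" for a b c
  proof (cases "a < n")
    case True
    then show ?thesis using cnum_nonzero[OF k1 True] by (simp add: fF FS)
  next
    \<comment> \<open>For \<open>a \<ge> n\<close> the divisor \<open>cnum k1 (Suc a)\<close> may be
      0, but all terms of the equation belong to total degree above \<open>n\<close> and
      vanish.\<close>
    case False
    then have "F (Suc a) s b c = 0" "F a s (Suc b) c = 0" "F a s b (Suc c) = 0" for s
      by (auto intro!: supp)
    then show ?thesis by (simp add: fF)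
  qed
  ultimately have "f \<in> Mn k1 k2 k3 n" unfolding Mn_iff by blast
  moreover have "\<forall>b\<le>n. f (0, 0, b, n - b) = u0 b \<and> f (Suc 0, 0, b, n - b) = u1 b"
    by (simp add: fF F0)
  ultimately show ?thesis by blast
qed

text \<open>By Mn_vanish, suitable conditions on the restriction to x1 = 0 propagate to all powers of x1; this covers
  M_n(x2), M_n(x3) and their intersection.\<close>

definition MnZ :: "real \<Rightarrow> real \<Rightarrow> real \<Rightarrow> nat \<Rightarrow> nat set \<Rightarrow> pvec set" where
  "MnZ k1 k2 k3 n Z = {f \<in> Mn k1 k2 k3 n. \<forall>b\<in>Z. b \<le> n \<longrightarrow> (\<forall>s. f (s, 0, b, n - b) = 0)}"

lemma MnZ_D: "f \<in> MnZ k1 k2 k3 n Z \<Longrightarrow> b \<in> Z \<Longrightarrow> b \<le> n \<Longrightarrow> f (s, 0, b, n - b) = 0"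
  and MnZ_Mn: "f \<in> MnZ k1 k2 k3 n Z \<Longrightarrow> f \<in> Mn k1 k2 k3 n"
  by (simp_all add: MnZ_def)
lemma MnZ_restr:
  "MnZ k1 k2 k3 n Z = {f \<in> Mn k1 k2 k3 n. \<forall>b\<in>Z. b \<le> n \<longrightarrow> (\<forall>e\<in>{1,-1}. restr e f b (n - b) = 0)}"
proof -
  have "(\<forall>s. f (s, 0, b, n - b) = 0) \<longleftrightarrow> (\<forall>e\<in>{1,-1}. restr e f b (n - b) = 0)" if f: "f \<in> Mn k1 k2 k3 n" for f b
  proof -
    have 2: "f (s, 0, b, n - b) = 0" if "\<not> s < 2" for s
      using Mn_supp[OF f, of s 0 b "n - b"] that by auto
    have "(\<forall>s. f (s, 0, b, n - b) = 0) \<longleftrightarrow> f (0, 0, b, n - b) = 0 \<and> f (Suc 0, 0, b, n - b) = 0"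
    proof (intro iffI allI)
      fix s
      assume "f (0, 0, b, n - b) = 0 \<and> f (Suc 0, 0, b, n - b) = 0"
      then show "f (s, 0, b, n - b) = 0" using 2[of s] less_2_cases[of s] by (cases "s < 2") auto
    qed simp
    also have "\<dots> \<longleftrightarrow> (\<forall>e\<in>{1,-1}. restr e f b (n - b) = 0)"
      by (auto simp: restr_def add_eq_0_iff)
    finally show ?thesis .
  qed
  then show ?thesis unfolding MnZ_def by (intro Collect_cong conj_cong refl ball_cong imp_cong) auto
qed

lemma MnZ_Un: "MnZ k1 k2 k3 n (Z \<union> Z') = MnZ k1 k2 k3 n Z \<inter> MnZ k1 k2 k3 n Z'"
  unfolding MnZ_def by auto
lemma MnZ_empty: "MnZ k1 k2 k3 n {} = Mn k1 k2 k3 n"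
  by (simp add: MnZ_def)

lemma MnZ_all:
  assumes k1: "enat n < tval k1" and Z: "{..n} \<subseteq> Z"
  shows "MnZ k1 k2 k3 n Z = {\<lambda>_. 0}"
proof -
  have "(\<lambda>_. 0) \<in> MnZ k1 k2 k3 n Z" by (simp add: MnZ_def Mn_iff Pdeg_def)
  moreover have "f p = 0" if f: "f \<in> MnZ k1 k2 k3 n Z" for f p
  proof -
    have base: "f (s, 0, b, c) = 0" if "b + c = n" for s b c
    proof -
      have "b \<in> Z" "b \<le> n" "n - b = c" using Z that by auto
      then show ?thesis using MnZ_D[OF f, of b s] by simp
    qed
    obtain s a b c where p: "p = (s, a, b, c)" by (cases p)
    show "f p = 0" unfolding p
      by (rule Mn_vanish[OF MnZ_Mn[OF f] k1, where Q = "\<lambda>_ _. True"]) (simp_all add: base)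
  qed
  ultimately show ?thesis by (auto simp: fun_eq_iff)
qed

text \<open>The region b < t2 can only be left from b = t2 - 1 to b = t2, and that step has
  coefficient \<open>cnum k2 t2 = 0\<close>. So \<open>Mn_vanish\<close> applies to it.\<close>

lemma Mnx2_eq_MnZ:
  assumes k1: "enat n < tval k1" and t: "tval k2 = enat t2"
  shows "Mnx k1 k2 k3 n 2 = MnZ k1 k2 k3 n {b. b < t2}"
proof -
  have z: "cnum k2 t2 = 0" using tval_enat[OF t] by (simp add: cnum_zero_iff)
  have v: "f (s, a, b, c) = 0" if f: "f \<in> MnZ k1 k2 k3 n {b. b < t2}" and "b < t2" for f s a b c
  proof (rule Mn_vanish[OF MnZ_Mn[OF f] k1, where Q = "\<lambda>b _. b < t2"])
    fix b :: nat assume "b < t2"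
    then show "Suc b < t2 \<or> cnum k2 (Suc b) = 0" using z by (cases "Suc b = t2") auto
  next
    fix s b c assume "b < t2" "b + c = n"
    then show "f (s, 0, b, c) = 0" using MnZ_D[OF f, of b s] by (simp add: \<open>b + c = n\<close>[symmetric])
  qed (use that in simp_all)
  have *: "f \<in> Mnx k1 k2 k3 n 2 \<longleftrightarrow> f \<in> Mn k1 k2 k3 n \<and> (\<forall>s a b c. b < t2 \<longrightarrow> f (s, a, b, c) = 0)" for f
    by (auto simp: Mnx_def expo_def kfun_def t not_le[symmetric] simp del: not_le)
  show ?thesis
  proof (intro set_eqI iffI)
    fix f assume "f \<in> Mnx k1 k2 k3 n 2"
    then show "f \<in> MnZ k1 k2 k3 n {b. b < t2}" by (simp add: * MnZ_def)
  next
    fix f assume "f \<in> MnZ k1 k2 k3 n {b. b < t2}"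
    then show "f \<in> Mnx k1 k2 k3 n 2" using v MnZ_Mn by (simp add: *)
  qed
qed
lemma Mnx3_eq_MnZ:
  assumes k1: "enat n < tval k1" and t: "tval k3 = enat t3"
  shows "Mnx k1 k2 k3 n 3 = MnZ k1 k2 k3 n {b. n < b + t3}"
proof -
  have z: "cnum k3 t3 = 0" using tval_enat[OF t] by (simp add: cnum_zero_iff)
  have v: "f (s, a, b, c) = 0" if f: "f \<in> MnZ k1 k2 k3 n {b. n < b + t3}" and "c < t3" for f s a b c
  proof (rule Mn_vanish[OF MnZ_Mn[OF f] k1, where Q = "\<lambda>_ c. c < t3"])
    fix c :: nat assume "c < t3"
    then show "Suc c < t3 \<or> cnum k3 (Suc c) = 0" using z by (cases "Suc c = t3") auto
  next
    fix s b c assume "c < t3" "b + c = n"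
    then show "f (s, 0, b, c) = 0" using MnZ_D[OF f, of b s] by (simp add: \<open>b + c = n\<close>[symmetric])
  qed (use that in simp_all)
  have *: "f \<in> Mnx k1 k2 k3 n 3 \<longleftrightarrow> f \<in> Mn k1 k2 k3 n \<and> (\<forall>s a b c. c < t3 \<longrightarrow> f (s, a, b, c) = 0)" for f
    by (auto simp: Mnx_def expo_def kfun_def t not_le[symmetric] simp del: not_le)
  show ?thesis
  proof (intro set_eqI iffI)
    fix f assume "f \<in> Mnx k1 k2 k3 n 3"
    then show "f \<in> MnZ k1 k2 k3 n {b. n < b + t3}" by (auto simp: * MnZ_def)
  next
    fix f assume "f \<in> MnZ k1 k2 k3 n {b. n < b + t3}"
    then show "f \<in> Mnx k1 k2 k3 n 3" using v MnZ_Mn by (simp add: *)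
  qed
qed
text \<open>The scaled coordinates at the exponents \<open>h i\<close>, taken in both eigenspaces of
  e_1, give the map to the direct sum. It is onto because restrictions are arbitrary and
  \<open>h i\<close> avoids \<open>Z\<close>. What remains for each block is the matrix identity
  \<open>tw\<close>.\<close>

lemma quot_iso_restriction:
  fixes Wop :: "nat \<Rightarrow> (nat \<Rightarrow> complex) \<Rightarrow> (nat \<Rightarrow> complex)"
  assumes k1: "enat n < tval k1"
    and inj: "inj_on h {..d}" and le: "\<And>i. i \<le> d \<Longrightarrow> h i \<le> n" and disj: "\<And>i. i \<le> d \<Longrightarrow> h i \<notin> Z"
    and mu: "\<And>i. i \<le> d \<Longrightarrow> mu i \<noteq> 0"
    and tw: "\<And>f e m. f \<in> MnZ k1 k2 k3 n Z \<Longrightarrow> e = 1 \<or> e = -1 \<Longrightarrow> m \<in> {1,2,3} \<Longrightarrow>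
       Wop m (\<lambda>i. if i \<le> d then mu i * restr e f (h i) (n - h i) else 0)
         = (\<lambda>i. if i \<le> d then mu i * restr e (BIgen k1 k2 k3 m f) (h i) (n - h i) else 0)"
  shows "quot_iso (MnZ k1 k2 k3 n Z, BIgen k1 k2 k3) (MnZ k1 k2 k3 n (Z \<union> h ` {..d})) (dsum2 (coords d, Wop))"
proof -
  define part where "part = (\<lambda>e f i. if i \<le> d then mu i * restr e f (h i) (n - h i) else 0)"
  define F where "F = (\<lambda>f x. case x of Inl i \<Rightarrow> part 1 f i | Inr i \<Rightarrow> part (-1) f i)"
  have car: "fst (dsum2 (coords d, Wop)) = {w. (\<lambda>x. w (Inl x)) \<in> coords d \<and> (\<lambda>x. w (Inr x)) \<in> coords d}"
    by (simp add: dsum2_def)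
  have "lin_on (MnZ k1 k2 k3 n Z) F"
    by (auto simp: lin_on_def F_def part_def restr_def fun_eq_iff algebra_simps split: sum.splits)
  moreover have "F ` MnZ k1 k2 k3 n Z = fst (dsum2 (coords d, Wop))"
  proof
    show "F ` MnZ k1 k2 k3 n Z \<subseteq> fst (dsum2 (coords d, Wop))"
      unfolding car by (auto simp: F_def part_def coords_def)
    show "fst (dsum2 (coords d, Wop)) \<subseteq> F ` MnZ k1 k2 k3 n Z"
    proof
      fix w assume "w \<in> fst (dsum2 (coords d, Wop))"
      then have w: "w (Inl i) = 0" "w (Inr i) = 0" if "d < i" for i
        using that unfolding car by (auto simp: coords_def)
      define g where "g = the_inv_into {..d} h"
      have g: "i \<le> d \<Longrightarrow> g (h i) = i" for i using inj by (simp add: g_def the_inv_into_f_f)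
      define p where "p = (\<lambda>b. if b \<in> h ` {..d} then w (Inl (g b)) / mu (g b) else 0)"
      define q where "q = (\<lambda>b. if b \<in> h ` {..d} then w (Inr (g b)) / mu (g b) else 0)"
      \<comment> \<open>These values invert \<open>restr\<close> for e = 1 and e = -1
        simultaneously; the factor (-1)^b undoes the e^b in \<open>restr\<close>.\<close>
      obtain f where f: "f \<in> Mn k1 k2 k3 n"
        "\<And>b. b \<le> n \<Longrightarrow> f (0, 0, b, n - b) = (p b + (-1) ^ b * q b) / 2"
        "\<And>b. b \<le> n \<Longrightarrow> f (Suc 0, 0, b, n - b) = (p b - (-1) ^ b * q b) / 2"
        using Mn_extend[OF k1, of k2 k3 "\<lambda>b. (p b + (-1) ^ b * q b) / 2" "\<lambda>b. (p b - (-1) ^ b * q b) / 2"] by blast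
      have r: "restr 1 f b (n - b) = p b" "restr (-1) f b (n - b) = q b" if "b \<le> n" for b
      proof -
        have half: "(x + y) / 2 + (x - y) / 2 = x" "(x + y) / 2 + - 1 * ((x - y) / 2) = y" for x y :: complex
          by (simp_all add: field_simps)
        show "restr 1 f b (n - b) = p b"
          unfolding restr_def f(2)[OF that] f(3)[OF that] using half(1) by simp
        have "restr (-1) f b (n - b) = (-1) ^ b * ((-1) ^ b * q b)"
          unfolding restr_def f(2)[OF that] f(3)[OF that] half(2) ..
        then show "restr (-1) f b (n - b) = q b" by (simp flip: mult.assoc power_mult_distrib)
      qed
      have "f \<in> MnZ k1 k2 k3 n Z"
        using f(1) r disj by (auto simp: MnZ_restr p_def q_def)
      moreover have "F f = w"
      proof
        fix x
        show "F f x = w x"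
          using w g mu le r by (cases x) (auto simp: F_def part_def p_def q_def not_le)
      qed
      ultimately show "w \<in> F ` MnZ k1 k2 k3 n Z" by blast
    qed
  qed
  moreover have "{f \<in> MnZ k1 k2 k3 n Z. F f = (\<lambda>_. 0)} = MnZ k1 k2 k3 n (Z \<union> h ` {..d})"
  proof -
    have "F f = (\<lambda>_. 0) \<longleftrightarrow> (\<forall>i\<le>d. \<forall>e\<in>{1,-1}. restr e f (h i) (n - h i) = 0)" for f
    proof
      assume z: "F f = (\<lambda>_. 0)"
      then have "part 1 f i = 0" "part (-1) f i = 0" for i
        using fun_cong[OF z, of "Inl i"] fun_cong[OF z, of "Inr i"] unfolding F_def sum.case by simp_all
      then show "\<forall>i\<le>d. \<forall>e\<in>{1,-1}. restr e f (h i) (n - h i) = 0"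
        using mu unfolding part_def by (metis insert_iff mult_eq_0_iff singletonD)
    qed (auto simp: F_def part_def fun_eq_iff split: sum.splits)
    then show ?thesis using le unfolding MnZ_Un by (auto simp: MnZ_restr)
  qed
  moreover have "F (BIgen k1 k2 k3 m f) = snd (dsum2 (coords d, Wop)) m (F f)"
    if "m \<in> {1,2,3}" "f \<in> MnZ k1 k2 k3 n Z" for m f
  proof
    fix x
    show "F (BIgen k1 k2 k3 m f) x = snd (dsum2 (coords d, Wop)) m (F f) x"
      using fun_cong[OF tw[OF that(2) _ that(1), of 1]] fun_cong[OF tw[OF that(2) _ that(1), of "-1"]]
      by (cases x) (simp_all add: dsum2_def F_def part_def)
  qed
  ultimately show ?thesis unfolding quot_iso_def by auto
qed

lemma bimod_iso_of_quot_iso: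
  assumes q: "quot_iso (S, G) {\<lambda>_. 0} W" and S: "subspace_of S"
  shows "bimod_iso (S, G) W"
proof -
  obtain f where f: "lin_on S f" "f ` S = fst W" "{v \<in> S. f v = (\<lambda>_. 0)} = {\<lambda>_. 0}"
    "\<forall>i\<in>{1,2,3}. \<forall>v\<in>S. f (G i v) = snd W i (f v)"
    using q by (auto simp: quot_iso_def)
  have "inj_on f S"
  proof
    fix u v assume uv: "u \<in> S" "v \<in> S" "f u = f v"
    have "(\<lambda>x. 1 * u x + (-1) * v x) \<in> S" by (rule subspace_of_comb[OF S uv(1,2)])
    moreover have "f (\<lambda>x. 1 * u x + (-1) * v x) = (\<lambda>_. 0)"
      using lin_on_comb[OF f(1) S uv(1,2), of 1 "-1"] uv(3) by simp
    ultimately have "(\<lambda>x. 1 * u x + (-1) * v x) = (\<lambda>_. 0)" using f(3) by blast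
    then show "u = v" by (simp add: fun_eq_iff)
  qed
  then show ?thesis using f unfolding bimod_iso_def bij_betw_def by auto
qed

lemma subspace_Mn: "subspace_of (Mn k1 k2 k3 n)"
proof -
  have "(\<lambda>_. 0) \<in> Mn k1 k2 k3 n" by (simp add: Mn_iff Pdeg_def)
  moreover have "(\<lambda>x. u x + v x) \<in> Mn k1 k2 k3 n" if "u \<in> Mn k1 k2 k3 n" "v \<in> Mn k1 k2 k3 n" for u v
    using that unfolding Mn_iff
    by (auto simp: Pdeg_def distrib_left) (metis add.right_neutral)+
  moreover have "(\<lambda>x. c * u x) \<in> Mn k1 k2 k3 n" if "u \<in> Mn k1 k2 k3 n" for u c
  proof -
    have *: "a * (c * b) = c * (a * b)" for a b :: complex by simp
    show ?thesis using that unfolding Mn_iff by (auto simp: Pdeg_def * right_diff_distrib' distrib_left)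
  qed
  ultimately show ?thesis by (auto simp: subspace_of_def)
qed

lemma subspace_MnZ: "subspace_of (MnZ k1 k2 k3 n Z)"
  using subspace_Mn[of k1 k2 k3 n] by (auto simp: subspace_of_def MnZ_def)

lemma scaling_exists:
  fixes L :: "nat \<Rightarrow> complex"
  assumes "\<And>i. i < d \<Longrightarrow> L (Suc i) \<noteq> 0"
  obtains mu where "\<And>i. i \<le> d \<Longrightarrow> mu i \<noteq> 0" "\<And>i. i < d \<Longrightarrow> mu (Suc i) * L (Suc i) = mu i"
proof -
  define mu where "mu = (\<lambda>i. inverse (\<Prod>j<i. L (Suc j)))"
  show ?thesis
  proof (rule that[of mu])
    show "i \<le> d \<Longrightarrow> mu i \<noteq> 0" for i using assms by (simp add: mu_def)
    show "i < d \<Longrightarrow> mu (Suc i) * L (Suc i) = mu i" for i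
      using assms[of i] by (simp add: mu_def field_simps)
  qed
qed

text \<open>The rows of the three generators after rescaling, with sub- and superdiagonal entries L and U in place
  of 1 and phi.\<close>

definition bidiag_row where
  "bidiag_row d th ths zz L U m rho i =
    (if m = (1::nat) then th i * rho i + (if i = (0::nat) then 0 else L i * rho (i - 1))
     else if m = 2 then ths i * rho i + (if i = d then 0 else U i * rho (Suc i))
     else zz i * rho i - (if i = 0 then 0 else (-1) ^ (i - 1) * L i * rho (i - 1))
        - (if i = d then 0 else (-1) ^ i * U i * (rho (Suc i) :: complex)))"

text \<open>A diagonal change of basis preserves products of opposite off-diagonal entries. Once the
  subdiagonal \<open>L\<close> is normalised to 1, the superdiagonal must be
  \<open>U i * L (Suc i)\<close>.\<close>

lemma (in bi_seq) B_scaled: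
  assumes mu: "\<And>i. i < d \<Longrightarrow> mu (Suc i) * L (Suc i) = mu i"
    and phi: "\<And>i. i < d \<Longrightarrow> phi (Suc i) = U i * L (Suc i)"
    and m: "m \<in> {1,2,3}"
  shows "B m (\<lambda>i. if i \<le> d then mu i * rho i else 0) = (\<lambda>i. if i \<le> d then mu i * bidiag_row d th ths zz L U m rho i else 0)"
proof
  fix i
  define v where "v = (\<lambda>i. if i \<le> d then mu i * rho i else 0)"
  have v: "v \<in> coords d" by (simp add: v_def coords_def)
  show "B m (\<lambda>i. if i \<le> d then mu i * rho i else 0) i = (if i \<le> d then mu i * bidiag_row d th ths zz L U m rho i else 0)"
  proof (cases "i \<le> d")
    case False
    then show ?thesis using B_closed[OF m v] by (simp add: v_def coords_def)
  next
    case i: True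
    have lo: "v (i - 1) = mu i * L i * rho (i - 1)" if "i \<noteq> 0"
    proof -
      have "i - 1 < d" "i - 1 \<le> d" "Suc (i - 1) = i" using that i by auto
      then show ?thesis using mu[of "i - 1"] unfolding v_def by (simp only: if_True)
    qed
    have up: "phi (Suc i) * v (Suc i) = mu i * (if i = d then 0 else U i * rho (Suc i))"
    proof (cases "i = d")
      case False
      then have "i < d" using i by simp
      then show ?thesis using phi[of i] mu[of i] by (simp add: v_def) (metis mult.assoc mult.commute)
    qed (simp add: phid)
    have vi: "v i = mu i * rho i" using i by (simp add: v_def)
    have "B m v i = mu i * bidiag_row d th ths zz L U m rho i"
    proof -
      consider "m = 1" | "m = 2" | "m = 3" using m by auto
      then show ?thesis
      proof cases
        case 1
        then show ?thesis using lo by (simp add: B1_row[OF i] bidiag_row_def vi algebra_simps)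
      next
        case 2
        then show ?thesis using up by (simp add: B2_row[OF i] bidiag_row_def vi algebra_simps)
      next
        case 3
        have "B 3 v i = zz i * v i - (if i = 0 then 0 else (-1) ^ (i - 1) * v (i - 1)) - (-1) ^ i * (phi (Suc i) * v (Suc i))"
          using B3_row[OF i v] by (simp add: mult.assoc)
        then show ?thesis using lo unfolding up vi 3
          by (cases "i = 0"; cases "i = d") (simp_all add: bidiag_row_def algebra_simps)
      qed
    qed
    then show ?thesis using i by (simp add: v_def)
  qed
qed

section \<open>Identification of the modules\<close>

lemma minus_one_square: "(-1::complex) ^ i * (-1) ^ i = 1"
  by (simp flip: power_mult_distrib)

lemma zcoef_O: "zcoef (thetaL a d) (thetaL b d) (phiO a b c d) (zO a b c d) i
    = - 1 / 2 + (-1) ^ i * (c + (of_nat d + 1) / 2)"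
  by (cases "even i") (simp_all add: zcoef_def thetaL_def phiO_def zO_def field_simps power2_eq_square)

lemma zcoef_E: "zcoef (thetaL a d) (thetaL b d) (phiE a b c d) (zE a b c d) i
    = - 1 / 2 - (-1) ^ i * (a + b)"
  by (cases "even i") (simp_all add: zcoef_def thetaL_def phiE_def zE_def field_simps power2_eq_square)

lemma of_nat_tval:
  assumes "2 * k = - real t"
  shows "of_nat t = - 2 * complex_of_real k"
proof -
  have "complex_of_real (real t) = complex_of_real (- 2 * k)" using assms by simp
  then show ?thesis by simp
qed

text \<open>The index is the exponent of x2. The three parameters are read off the diagonals of Z
  (giving k1), Y (giving -K-n-1) and X (giving k3), after substituting 2 k2 = -(d + 1).\<close>

lemma quot_iso_W2:
  assumes n: "odd n" and k1: "enat n < tval k1" and t2: "tval k2 = enat t2" and t3: "tval k3 = enat t3"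
    and le: "t2 + t3 \<le> n" and Z: "\<And>b. b \<in> Z \<Longrightarrow> t2 \<le> b"
  shows "quot_iso (MnZ k1 k2 k3 n Z, BIgen k1 k2 k3) (MnZ k1 k2 k3 n (Z \<union> {b. b < t2}))
    (dsum2 (twist (sgnaut 1 1) perm13
      (Omod (of_real k1) (of_real (- (k1 + k2 + k3) - real n - 1)) (of_real k3) (t2 - 1))))"
proof -
  define d where "d = t2 - 1"
  have odd: "odd t2" "odd t3" and tk: "2 * k2 = - real t2" "2 * k3 = - real t3"
    using tval_enat[OF t2] tval_enat[OF t3] by auto
  have d: "even d" "Suc d = t2" using odd by (auto simp: d_def elim: oddE)
  have t3pos: "0 < t3" using odd by (auto elim: oddE)
  define K1 K2 K3 where "K1 = complex_of_real k1" and "K2 = complex_of_real k2" and "K3 = complex_of_real k3"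
  have "complex_of_nat (Suc d) = - 2 * K2"
    unfolding d K2_def by (rule of_nat_tval[OF tk(1)])
  then have D: "complex_of_nat d = - 2 * K2 - 1" by (simp add: algebra_simps)
  define b where "b = complex_of_real (- (k1 + k2 + k3) - real n - 1)"
  have b: "b = - K1 - K2 - K3 - of_nat n - 1" by (simp add: b_def K1_def K2_def K3_def)
  interpret bi_seq d "thetaL K1 d" "thetaL b d" "phiO K1 b K3 d" "zO b K3 K1 d" "zO K3 K1 b d" "zO K1 b K3 d"
    by (rule bi_seq_O[OF d(1)])
  define L where "L = (\<lambda>i. \<i> * (-1) ^ i * cnum k3 (Suc (n - i)))"
  define U where "U = (\<lambda>i. \<i> * (-1) ^ i * cnum k2 (Suc i))"
  have ph: "phiO K1 b K3 d (Suc i) = U i * L (Suc i)" if "i < d" for i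
  proof -
    have UL: "U i * L (Suc i) = cnum k2 (Suc i) * cnum k3 (n - i)"
      using that d(2) le minus_one_square[of i] by (simp add: L_def U_def Suc_diff_Suc algebra_simps)
    have par: "even (n - i) \<longleftrightarrow> odd i" and c: "complex_of_nat (n - i) = of_nat n - of_nat i"
      using n that d(2) le by (auto simp: of_nat_diff)
    show ?thesis unfolding UL cnum_def K2_def[symmetric] K3_def[symmetric] c
      using par by (cases "even i") (simp_all add: phiO_def D b K2_def[symmetric] K3_def[symmetric] algebra_simps
        add_divide_distrib diff_divide_distrib)
  qed
  \<comment> \<open>\<open>L (Suc i)\<close> contains \<open>cnum k3 (n - i)\<close>, whose only
    positive zero is t3; \<open>n - i\<close> stays above t3 because t2 + t3 \<le> n.\<close>
  have "L (Suc i) \<noteq> 0" if "i < d" for i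
  proof -
    have "real (n - i) \<noteq> real t3" using that d(2) le by simp
    then show ?thesis using that d(2) le tk(2) by (simp add: L_def Suc_diff_Suc cnum_zero_iff)
  qed
  then obtain mu where mu: "\<And>i. i \<le> d \<Longrightarrow> mu i \<noteq> 0" "\<And>i. i < d \<Longrightarrow> mu (Suc i) * L (Suc i) = mu i"
    using scaling_exists[of d L] by blast
  define Wop where "Wop = (\<lambda>m v y. sgnaut 1 1 (perm13 m) * B (perm13 m) v y)"
  have W: "twist (sgnaut 1 1) perm13 (Omod (of_real k1) b (of_real k3) d) = (coords d, Wop)"
    by (simp add: twist_def Omod_bidiag fst_bidiag Wop_def K1_def K3_def)
  have "quot_iso (MnZ k1 k2 k3 n Z, BIgen k1 k2 k3) (MnZ k1 k2 k3 n (Z \<union> (\<lambda>i. i) ` {..d})) (dsum2 (coords d, Wop))"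
  proof (rule quot_iso_restriction[OF k1 _ _ _ mu(1)])
    fix f :: pvec and e :: complex and m :: nat
    assume f: "f \<in> MnZ k1 k2 k3 n Z" and e: "e = 1 \<or> e = -1" and m: "m \<in> {1,2,3}"
    define rho where "rho = (\<lambda>i. restr e f i (n - i))"
    have fM: "f \<in> Mn k1 k2 k3 n" by (rule MnZ_Mn[OF f])
    have row: "bidiag_row d (thetaL K1 d) (thetaL b d) zz L U (perm13 m) rho i = restr e (BIgen k1 k2 k3 m f) i (n - i)"
      if i: "i \<le> d" for i
    proof -
      define s where "s = (-1::complex) ^ i"
      have ss: "s * s = 1" by (simp add: s_def minus_one_square)
      have i': "i \<le> n" "i < n" using i d(2) le t3pos by auto
      have c: "(-1::complex) ^ (n - i) = - s" "(-1::complex) ^ n = -1" "complex_of_nat (n - i) = of_nat n - of_nat i"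
        using n i' by (auto simp: s_def of_nat_diff minus_one_power_iff)
      have th: "thetaL K1 d i = s * (K1 + K2 + 1 / 2 + of_nat i)"
        "thetaL b d i = - s * (of_nat n - of_nat i + K1 + K3 + 1 / 2)"
        by (simp_all add: thetaL_def s_def D b field_simps)
      have zi: "zz i = - 1 / 2 + s * (K3 - K2)" unfolding zcoef_O D s_def by simp
      have Lr: "(if i = 0 then 0 else L i * rho (i - 1))
         = \<i> * s * (if i = 0 then 0 else cnum k3 (Suc (n - i)) * restr e f (i - 1) (Suc (n - i)))"
        using i' by (cases i) (simp_all add: L_def rho_def s_def Suc_diff_Suc)
      \<comment> \<open>In the last row the entry leading out of the block is a multiple of
        \<open>cnum k2 t2 = 0\<close>.\<close>
      have Ur: "(if i = d then 0 else U i * rho (Suc i))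
         = \<i> * s * (cnum k2 (Suc i) * restr e f (Suc i) (n - i - 1))"
      proof (cases "i = d")
        case True
        then have "cnum k2 (Suc i) = 0" using odd tk d by (simp add: cnum_zero_iff)
        then show ?thesis using True by simp
      qed (simp add: U_def rho_def s_def)
      consider "m = 1" | "m = 2" | "m = 3" using m by auto
      then show ?thesis
      proof cases
        case 1
        have "(if i = 0 then 0 else (-1) ^ (i - 1) * L i * rho (i - 1)) = - s * (if i = 0 then 0 else L i * rho (i - 1))"
          by (cases i) (simp_all add: s_def)
        moreover have "(if i = d then 0 else (-1) ^ i * U i * rho (Suc i)) = s * (if i = d then 0 else U i * rho (Suc i))"
          by (simp add: s_def)
        ultimately have br: "bidiag_row d (thetaL K1 d) (thetaL b d) zz L U 3 rho i =
          zz i * rho i + s * (if i = 0 then 0 else L i * rho (i - 1)) - s * (if i = d then 0 else U i * rho (Suc i))"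
          by (simp add: bidiag_row_def)
        define x where "x = (if i = 0 then 0 else cnum k3 (Suc (n - i)) * restr e f (i - 1) (Suc (n - i)))"
        have p: "perm13 1 = 3" by (simp add: perm13_def)
        have g: "restr e (BIgen k1 k2 k3 1 f) i (n - i) = (- 1 / 2 - K2 * s + K3 * s) * rho i
          - \<i> * (cnum k2 (Suc i) * restr e f (Suc i) (n - i - 1) - x)"
          using i' by (simp add: restr_BIgen1[OF e] c rho_def x_def K2_def[symmetric] K3_def[symmetric] s_def[symmetric])
        show ?thesis
          unfolding 1 p br g Lr Ur zi x_def[symmetric] using ss by algebra
      next
        case 2
        have "bidiag_row d (thetaL K1 d) (thetaL b d) zz L U 2 rho i =
          thetaL b d i * rho i + (if i = d then 0 else U i * rho (Suc i))"
          by (simp add: bidiag_row_def)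
        then show ?thesis
          using i' ss unfolding Ur th 2
          by (simp add: perm13_def restr_BIgen2[OF e fM] c rho_def cnum_def[of k3] K1_def[symmetric] K3_def[symmetric])
            algebra
      next
        case 3
        have "bidiag_row d (thetaL K1 d) (thetaL b d) zz L U 1 rho i =
          thetaL K1 d i * rho i + (if i = 0 then 0 else L i * rho (i - 1))"
          by (simp add: bidiag_row_def)
        moreover have "(if i = 0 then 0 else \<i> * s * cnum k3 (Suc (n - i)) * restr e f (i - 1) (Suc (n - i)))
          = \<i> * s * (if i = 0 then 0 else cnum k3 (Suc (n - i)) * restr e f (i - 1) (Suc (n - i)))" by simp
        ultimately show ?thesis
          using ss unfolding Lr th 3
          by (simp only: perm13_def restr_BIgen3[OF e fM] s_def[symmetric]) 
            (simp add: rho_def cnum_def[of k2] K1_def[symmetric] K2_def[symmetric] s_def[symmetric], algebra)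
      qed
    qed
    have p: "perm13 m \<in> {1,2,3}" "sgnaut 1 1 (perm13 m) = 1" using m by (auto simp: perm13_def sgnaut_def)
    have "Wop m (\<lambda>i. if i \<le> d then mu i * rho i else 0)
        = (\<lambda>i. if i \<le> d then mu i * bidiag_row d (thetaL K1 d) (thetaL b d) zz L U (perm13 m) rho i else 0)"
      unfolding Wop_def p(2) mult_1 by (rule B_scaled[OF mu(2) ph p(1)])
    then show "Wop m (\<lambda>i. if i \<le> d then mu i * restr e f i (n - i) else 0) =
       (\<lambda>i. if i \<le> d then mu i * restr e (BIgen k1 k2 k3 m f) i (n - i) else 0)"
      using row unfolding rho_def by (auto simp: fun_eq_iff)
  qed (use le d(2) Z in \<open>fastforce+\<close>)
  moreover have "(\<lambda>i. i) ` {..d} = {b. b < t2}" using d(2) by auto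
  ultimately show ?thesis using W by (simp add: d_def b_def)
qed

text \<open>The index is now the exponent of x3, so Y becomes lower and Z upper bidiagonal; hence
  the cycle (1 3 2) in place of (1 3).\<close>

lemma quot_iso_W3:
  assumes n: "odd n" and k1: "enat n < tval k1" and t2: "tval k2 = enat t2" and t3: "tval k3 = enat t3"
    and le: "t2 + t3 \<le> n" and Z: "\<And>b. b \<in> Z \<Longrightarrow> b + t3 \<le> n"
  shows "quot_iso (MnZ k1 k2 k3 n Z, BIgen k1 k2 k3) (MnZ k1 k2 k3 n (Z \<union> {b. n < b + t3}))
    (dsum2 (twist (sgnaut 1 1) perm132
      (Omod (of_real k1) (of_real (- (k1 + k2 + k3) - real n - 1)) (of_real k2) (t3 - 1))))"
proof -
  define d where "d = t3 - 1"
  have odd: "odd t2" "odd t3" and tk: "2 * k2 = - real t2" "2 * k3 = - real t3"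
    using tval_enat[OF t2] tval_enat[OF t3] by auto
  have d: "even d" "Suc d = t3" using odd by (auto simp: d_def elim: oddE)
  have t2pos: "0 < t2" using odd by (auto elim: oddE)
  define K1 K2 K3 where "K1 = complex_of_real k1" and "K2 = complex_of_real k2" and "K3 = complex_of_real k3"
  have "complex_of_nat (Suc d) = - 2 * K3"
    unfolding d K3_def by (rule of_nat_tval[OF tk(2)])
  then have D: "complex_of_nat d = - 2 * K3 - 1" by (simp add: algebra_simps)
  define b where "b = complex_of_real (- (k1 + k2 + k3) - real n - 1)"
  have b: "b = - K1 - K2 - K3 - of_nat n - 1" by (simp add: b_def K1_def K2_def K3_def)
  interpret bi_seq d "thetaL K1 d" "thetaL b d" "phiO K1 b K2 d" "zO b K2 K1 d" "zO K2 K1 b d" "zO K1 b K2 d"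
    by (rule bi_seq_O[OF d(1)])
  define L where "L = (\<lambda>i. - \<i> * (-1) ^ i * cnum k2 (Suc (n - i)))"
  define U where "U = (\<lambda>i. - \<i> * (-1) ^ i * cnum k3 (Suc i))"
  have ph: "phiO K1 b K2 d (Suc i) = U i * L (Suc i)" if "i < d" for i
  proof -
    have UL: "U i * L (Suc i) = cnum k3 (Suc i) * cnum k2 (n - i)"
      using that d(2) le minus_one_square[of i] by (simp add: L_def U_def Suc_diff_Suc algebra_simps)
    have par: "even (n - i) \<longleftrightarrow> odd i" and c: "complex_of_nat (n - i) = of_nat n - of_nat i"
      using n that d(2) le by (auto simp: of_nat_diff)
    show ?thesis unfolding UL cnum_def K2_def[symmetric] K3_def[symmetric] c
      using par by (cases "even i") (simp_all add: phiO_def D b K2_def[symmetric] K3_def[symmetric] algebra_simps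
        add_divide_distrib diff_divide_distrib)
  qed
  have "L (Suc i) \<noteq> 0" if "i < d" for i
  proof -
    have "real (n - i) \<noteq> real t2" using that d(2) le by simp
    then show ?thesis using that d(2) le tk(1) by (simp add: L_def Suc_diff_Suc cnum_zero_iff)
  qed
  then obtain mu where mu: "\<And>i. i \<le> d \<Longrightarrow> mu i \<noteq> 0" "\<And>i. i < d \<Longrightarrow> mu (Suc i) * L (Suc i) = mu i"
    using scaling_exists[of d L] by blast
  define Wop where "Wop = (\<lambda>m v y. sgnaut 1 1 (perm132 m) * B (perm132 m) v y)"
  have W: "twist (sgnaut 1 1) perm132 (Omod (of_real k1) b (of_real k2) d) = (coords d, Wop)"
    by (simp add: twist_def Omod_bidiag fst_bidiag Wop_def K1_def K2_def)
  have "quot_iso (MnZ k1 k2 k3 n Z, BIgen k1 k2 k3) (MnZ k1 k2 k3 n (Z \<union> (\<lambda>i. n - i) ` {..d})) (dsum2 (coords d, Wop))"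
  proof (rule quot_iso_restriction[OF k1 _ _ _ mu(1)])
    fix f :: pvec and e :: complex and m :: nat
    assume f: "f \<in> MnZ k1 k2 k3 n Z" and e: "e = 1 \<or> e = -1" and m: "m \<in> {1,2,3}"
    define rho where "rho = (\<lambda>i. restr e f (n - i) (n - (n - i)))"
    have fM: "f \<in> Mn k1 k2 k3 n" by (rule MnZ_Mn[OF f])
    have row: "bidiag_row d (thetaL K1 d) (thetaL b d) zz L U (perm132 m) rho i = restr e (BIgen k1 k2 k3 m f) (n - i) (n - (n - i))"
      if i: "i \<le> d" for i
    proof -
      define s where "s = (-1::complex) ^ i"
      have ss: "s * s = 1" by (simp add: s_def minus_one_square)
      have i': "i \<le> n" "i < n" using i d(2) le t2pos by auto
      have c: "(-1::complex) ^ (n - i) = - s" "(-1::complex) ^ n = -1" "complex_of_nat (n - i) = of_nat n - of_nat i"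
        using n i' by (auto simp: s_def of_nat_diff minus_one_power_iff)
      have ni: "n - (n - i) = i" using i' by simp
      have th: "thetaL K1 d i = s * (K1 + K3 + 1 / 2 + of_nat i)"
        "thetaL b d i = - s * (of_nat n - of_nat i + K1 + K2 + 1 / 2)"
        by (simp_all add: thetaL_def s_def D b field_simps)
      have zi: "zz i = - 1 / 2 + s * (K2 - K3)" unfolding zcoef_O D s_def by simp
      have Lr: "(if i = 0 then 0 else L i * rho (i - 1))
         = - \<i> * s * (if i = 0 then 0 else cnum k2 (Suc (n - i)) * restr e f (Suc (n - i)) (i - 1))"
        using i' by (cases i) (simp_all add: L_def rho_def s_def Suc_diff_Suc)
      have Ur: "(if i = d then 0 else U i * rho (Suc i))
         = - \<i> * s * (cnum k3 (Suc i) * restr e f (n - i - 1) (Suc i))"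
      proof (cases "i = d")
        case True
        then have "cnum k3 (Suc i) = 0" using odd tk d by (simp add: cnum_zero_iff)
        then show ?thesis using True by simp
      next
        case False
        then have "n - (n - Suc i) = Suc i" using i d(2) le by simp
        then show ?thesis using False by (simp add: U_def rho_def s_def)
      qed
      have nz: "n - i \<noteq> 0" using i' by simp
      consider "m = 1" | "m = 2" | "m = 3" using m by auto
      then show ?thesis
      proof cases
        case 1
        have "(if i = 0 then 0 else (-1) ^ (i - 1) * L i * rho (i - 1)) = - s * (if i = 0 then 0 else L i * rho (i - 1))"
          by (cases i) (simp_all add: s_def)
        moreover have "(if i = d then 0 else (-1) ^ i * U i * rho (Suc i)) = s * (if i = d then 0 else U i * rho (Suc i))"
          by (simp add: s_def)
        ultimately have br: "bidiag_row d (thetaL K1 d) (thetaL b d) zz L U 3 rho i =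
          zz i * rho i + s * (if i = 0 then 0 else L i * rho (i - 1)) - s * (if i = d then 0 else U i * rho (Suc i))"
          by (simp add: bidiag_row_def)
        define x where "x = (if i = 0 then 0 else cnum k2 (Suc (n - i)) * restr e f (Suc (n - i)) (i - 1))"
        have p: "perm132 1 = 3" by (simp add: perm132_def)
        have g: "restr e (BIgen k1 k2 k3 1 f) (n - i) i = (- 1 / 2 + K2 * s - K3 * s) * rho i
          - \<i> * (x - cnum k3 (Suc i) * restr e f (n - i - 1) (Suc i))"
          using i' nz by (simp add: restr_BIgen1[OF e] c ni rho_def x_def K2_def[symmetric] K3_def[symmetric] s_def[symmetric])
        show ?thesis
          unfolding 1 p br ni g Lr Ur zi x_def[symmetric] using ss by algebra
      next
        case 2
        have "bidiag_row d (thetaL K1 d) (thetaL b d) zz L U 1 rho i =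
          thetaL K1 d i * rho i + (if i = 0 then 0 else L i * rho (i - 1))"
          by (simp add: bidiag_row_def)
        moreover have "(if i = 0 then 0 else \<i> * s * cnum k2 (Suc (n - i)) * restr e f (Suc (n - i)) (i - 1))
          = \<i> * s * (if i = 0 then 0 else cnum k2 (Suc (n - i)) * restr e f (Suc (n - i)) (i - 1))" by simp
        ultimately show ?thesis
          using ss unfolding Lr th 2 ni
          by (simp only: perm132_def restr_BIgen2[OF e fM] s_def[symmetric])
            (simp add: rho_def ni cnum_def[of k3] K1_def[symmetric] K3_def[symmetric] s_def[symmetric], algebra)
      next
        case 3
        have "bidiag_row d (thetaL K1 d) (thetaL b d) zz L U 2 rho i =
          thetaL b d i * rho i + (if i = d then 0 else U i * rho (Suc i))"
          by (simp add: bidiag_row_def)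
        then show ?thesis
          using i' nz ss unfolding Ur th 3 ni
          by (simp add: perm132_def restr_BIgen3[OF e fM] c rho_def ni cnum_def[of k2] K1_def[symmetric] K2_def[symmetric])
            algebra
      qed
    qed
    have p: "perm132 m \<in> {1,2,3}" "sgnaut 1 1 (perm132 m) = 1" using m by (auto simp: perm132_def sgnaut_def)
    have "Wop m (\<lambda>i. if i \<le> d then mu i * rho i else 0)
        = (\<lambda>i. if i \<le> d then mu i * bidiag_row d (thetaL K1 d) (thetaL b d) zz L U (perm132 m) rho i else 0)"
      unfolding Wop_def p(2) mult_1 by (rule B_scaled[OF mu(2) ph p(1)])
    then show "Wop m (\<lambda>i. if i \<le> d then mu i * restr e f (n - i) (n - (n - i)) else 0) =
       (\<lambda>i. if i \<le> d then mu i * restr e (BIgen k1 k2 k3 m f) (n - i) (n - (n - i)) else 0)"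
      using row unfolding rho_def by (auto simp: fun_eq_iff)
  next
    show "inj_on (\<lambda>i. n - i) {..d}" using d(2) le by (auto intro!: inj_onI)
    show "n - i \<notin> Z" if "i \<le> d" for i using Z[of "n - i"] that d(2) le by auto
  qed auto
  \<comment> \<open>The two index sets agree only up to \<open>n\<close>, which is all that
    \<open>MnZ\<close> looks at.\<close>
  moreover have "MnZ k1 k2 k3 n (Z \<union> (\<lambda>i. n - i) ` {..d}) = MnZ k1 k2 k3 n (Z \<union> {b. n < b + t3})"
  proof -
    have "b \<in> (\<lambda>i. n - i) ` {..d} \<longleftrightarrow> n < b + t3" if "b \<le> n" for b
      using that d(2) le by (auto simp: image_iff intro!: bexI[of _ "n - b"])
    then show ?thesis by (auto simp: MnZ_def)
  qed
  ultimately show ?thesis using W by (simp add: d_def b_def)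
qed

text \<open>The exponent of x2 is t2 + i with t2 odd, so (-1)^b = -(-1)^i and Y, Z appear with
  reversed sign; the twist (-1,-1) compensates. The kernel is zero because \<open>Z\<close> and the
  middle block together exhaust all exponents.\<close>

lemma bimod_iso_W1:
  assumes n: "odd n" and k1: "enat n < tval k1" and t2: "tval k2 = enat t2" and t3: "tval k3 = enat t3"
    and le: "t2 + t3 \<le> n"
  shows "bimod_iso (MnZ k1 k2 k3 n ({b. b < t2} \<union> {b. n < b + t3}), BIgen k1 k2 k3)
    (dsum2 (twist (sgnaut (-1) (-1)) perm13
      (Emod (of_real (k1 + k3 + (real n + 1) / 2)) (of_real (- k1 - k2 - (real n + 1) / 2))
        (of_real ((real n + 1) / 2)) (n - t2 - t3))))"
proof -
  define d where "d = n - t2 - t3"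
  have odd: "odd t2" "odd t3" and tk: "2 * k2 = - real t2" "2 * k3 = - real t3"
    using tval_enat[OF t2] tval_enat[OF t3] by auto
  have d: "odd d" "n = t2 + d + t3" using odd n le by (auto simp: d_def)
  define K1 K2 K3 where "K1 = complex_of_real k1" and "K2 = complex_of_real k2" and "K3 = complex_of_real k3"
  have T: "complex_of_nat t2 = - 2 * K2" "complex_of_nat t3 = - 2 * K3"
    unfolding K2_def K3_def by (rule of_nat_tval[OF tk(1)], rule of_nat_tval[OF tk(2)])
  have D: "complex_of_nat n = complex_of_nat d - 2 * K2 - 2 * K3" unfolding d(2) by (simp add: T)
  define a b N where "a = complex_of_real (k1 + k3 + (real n + 1) / 2)"
    and "b = complex_of_real (- k1 - k2 - (real n + 1) / 2)" and "N = complex_of_real ((real n + 1) / 2)"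
  have N: "N = (complex_of_nat d + 1) / 2 - K2 - K3" by (simp add: N_def D field_simps)
  have a: "a = K1 + K3 + N" and b: "b = - K1 - K2 - N"
    by (simp_all add: a_def b_def N_def K1_def K2_def K3_def)
  interpret bi_seq d "thetaL a d" "thetaL b d" "phiE a b N d" "zE b N a d" "zE N a b d" "zE a b N d"
    by (rule bi_seq_E[OF d(1)])
  define L where "L = (\<lambda>i. \<i> * (-1) ^ i * cnum k3 (Suc (n - (t2 + i))))"
  define U where "U = (\<lambda>i. \<i> * (-1) ^ i * cnum k2 (Suc (t2 + i)))"
  have ph: "phiE a b N d (Suc i) = U i * L (Suc i)" if "i < d" for i
  proof -
    have "Suc (n - (t2 + Suc i)) = n - (t2 + i)" using that d(2) by simp
    then have UL: "U i * L (Suc i) = cnum k2 (Suc (t2 + i)) * cnum k3 (n - (t2 + i))"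
      using minus_one_square[of i] by (simp add: L_def U_def algebra_simps)
    have par: "even (n - (t2 + i)) \<longleftrightarrow> even i" and c: "complex_of_nat (n - (t2 + i)) = of_nat d - 2 * K3 - of_nat i"
      using n that d odd(1) odd(2) by (auto simp: of_nat_diff T)
    have "complex_of_nat (Suc (t2 + i)) = 1 - 2 * K2 + of_nat i" by (simp add: T)
    then show ?thesis unfolding UL cnum_def K2_def[symmetric] K3_def[symmetric] c
      using par odd(1) by (cases "even i") (simp_all add: phiE_def a b N T power2_eq_square field_simps)
  qed
  have "L (Suc i) \<noteq> 0" if "i < d" for i
  proof -
    have s: "Suc (n - (t2 + Suc i)) = n - (t2 + i)" using that d(2) by simp
    have "real (n - (t2 + i)) \<noteq> real t3" "n - (t2 + i) \<noteq> 0" using that d(2) by simp_all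
    then show ?thesis using tk(2) unfolding L_def s by (simp add: cnum_zero_iff)
  qed
  then obtain mu where mu: "\<And>i. i \<le> d \<Longrightarrow> mu i \<noteq> 0" "\<And>i. i < d \<Longrightarrow> mu (Suc i) * L (Suc i) = mu i"
    using scaling_exists[of d L] by blast
  define Wop where "Wop = (\<lambda>m v y. sgnaut (-1) (-1) (perm13 m) * B (perm13 m) v y)"
  have W: "twist (sgnaut (-1) (-1)) perm13 (Emod a b N d) = (coords d, Wop)"
    by (simp add: twist_def Emod_bidiag fst_bidiag Wop_def)
  define Z where "Z = {b. b < t2} \<union> {b. n < b + t3}"
  have "quot_iso (MnZ k1 k2 k3 n Z, BIgen k1 k2 k3) (MnZ k1 k2 k3 n (Z \<union> (\<lambda>i. t2 + i) ` {..d})) (dsum2 (coords d, Wop))"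
  proof (rule quot_iso_restriction[OF k1 _ _ _ mu(1)])
    fix f :: pvec and e :: complex and m :: nat
    assume f: "f \<in> MnZ k1 k2 k3 n Z" and e: "e = 1 \<or> e = -1" and m: "m \<in> {1,2,3}"
    define rho where "rho = (\<lambda>i. restr e f (t2 + i) (n - (t2 + i)))"
    have fM: "f \<in> Mn k1 k2 k3 n" by (rule MnZ_Mn[OF f])
    have fZ: "restr e f x (n - x) = 0" if "x \<in> Z" "x \<le> n" for x
      using f that e unfolding MnZ_restr by auto
    have row: "sgnaut (-1) (-1) (perm13 m) * bidiag_row d (thetaL a d) (thetaL b d) zz L U (perm13 m) rho i
        = restr e (BIgen k1 k2 k3 m f) (t2 + i) (n - (t2 + i))"
      if i: "i \<le> d" for i
    proof -
      define s where "s = (-1::complex) ^ i"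
      have ss: "s * s = 1" by (simp add: s_def minus_one_square)
      define c where "c = n - (t2 + i)"
      have cn: "t2 + i + c = n" "c \<noteq> 0" using i d(2) odd(2) by (auto simp: c_def elim: oddE)
      have t2pos: "0 < t2" using odd(1) by (auto elim: oddE)
      have c: "(-1::complex) ^ c = s" "(-1::complex) ^ (t2 + i) = - s" "(-1::complex) ^ (t2 + i + c) = -1"
        "complex_of_nat c = of_nat d - 2 * K3 - of_nat i"
        "complex_of_nat (t2 + i) = of_nat i - 2 * K2"
        using n odd i d(2) unfolding cn(1) by (auto simp: s_def of_nat_diff minus_one_power_iff T c_def)
      have th: "thetaL a d i = s * (K1 - K2 + 1 / 2 + of_nat i)"
        "thetaL b d i = - s * (K1 + of_nat d - K3 + 1 / 2 - of_nat i)"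
        by (simp_all add: thetaL_def s_def N a b field_simps)
      have zi: "zz i = - 1 / 2 - s * (K3 - K2)" unfolding zcoef_E s_def a b by simp
      \<comment> \<open>Entries leading out of the block meet b = t2 - 1 on one side and n - b = t3
        - 1 on the other. At both exponents the restriction is zero since they belong to
        \<open>Z\<close>.\<close>
      have Lr: "(if i = 0 then 0 else L i * rho (i - 1))
         = \<i> * s * (cnum k3 (Suc c) * restr e f (t2 + i - 1) (Suc c))"
      proof (cases i)
        case 0
        have "restr e f (t2 - 1) (n - (t2 - 1)) = 0" by (rule fZ) (use t2pos d(2) in \<open>auto simp: Z_def\<close>)
        moreover have "n - (t2 - 1) = Suc c" using t2pos 0 d(2) by (simp add: c_def)
        ultimately show ?thesis using 0 by simp
      next
        case (Suc i')
        then have "n - (t2 + i') = Suc c" using i d(2) by (simp add: c_def)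
        then show ?thesis using Suc by (simp add: L_def rho_def s_def c_def)
      qed
      have Ur: "(if i = d then 0 else U i * rho (Suc i))
         = \<i> * s * (cnum k2 (Suc (t2 + i)) * restr e f (Suc (t2 + i)) (c - 1))"
      proof (cases "i = d")
        case True
        have "restr e f (Suc (t2 + i)) (n - (Suc (t2 + i))) = 0"
          by (rule fZ) (use True cn d(2) in \<open>auto simp: Z_def\<close>)
        then show ?thesis using True by (simp add: c_def)
      qed (simp add: U_def rho_def s_def c_def)
      have rc: "rho i = restr e f (t2 + i) c" by (simp add: rho_def c_def)
      consider "m = 1" | "m = 2" | "m = 3" using m by auto
      then show ?thesis
      proof cases
        case 1
        have "(if i = 0 then 0 else (-1) ^ (i - 1) * L i * rho (i - 1)) = - s * (if i = 0 then 0 else L i * rho (i - 1))"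
          by (cases i) (simp_all add: s_def)
        moreover have "(if i = d then 0 else (-1) ^ i * U i * rho (Suc i)) = s * (if i = d then 0 else U i * rho (Suc i))"
          by (simp add: s_def)
        ultimately have br: "bidiag_row d (thetaL a d) (thetaL b d) zz L U 3 rho i =
          zz i * rho i + s * (if i = 0 then 0 else L i * rho (i - 1)) - s * (if i = d then 0 else U i * rho (Suc i))"
          by (simp add: bidiag_row_def)
        have p: "perm13 1 = 3" "sgnaut (-1) (-1) 3 = 1" by (simp_all add: perm13_def sgnaut_def)
        have "restr e (BIgen k1 k2 k3 1 f) (t2 + i) c = (- 1 / 2 + K2 * s - K3 * s) * restr e f (t2 + i) c
          - \<i> * (cnum k2 (Suc (t2 + i)) * restr e f (Suc (t2 + i)) (c - 1) - cnum k3 (Suc c) * restr e f (t2 + i - 1) (Suc c))"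
          using restr_BIgen1[OF e, of k1 k2 k3 f "t2 + i" c] cn(2) t2pos
          unfolding c K2_def[symmetric] K3_def[symmetric] by simp
        then show ?thesis unfolding 1 p br c_def[symmetric] Lr Ur zi rc using ss by algebra
      next
        case 2
        have br: "bidiag_row d (thetaL a d) (thetaL b d) zz L U 2 rho i =
          thetaL b d i * rho i + (if i = d then 0 else U i * rho (Suc i))"
          by (simp add: bidiag_row_def)
        have p: "perm13 2 = 2" "sgnaut (-1) (-1) 2 = -1" by (simp_all add: perm13_def sgnaut_def)
        have "restr e (BIgen k1 k2 k3 2 f) (t2 + i) c = (s * (of_nat d - 2 * K3 - of_nat i + K3 * (1 - s) + 1 / 2 + K1) + K3) * restr e f (t2 + i) c
          - \<i> * s * (cnum k2 (Suc (t2 + i)) * restr e f (Suc (t2 + i)) (c - 1))"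
          using restr_BIgen2[OF e fM, of "t2 + i" c] cn(2)
          unfolding cnum_def[of k3] c K1_def[symmetric] K3_def[symmetric] by simp
        then show ?thesis unfolding 2 p br c_def[symmetric] Ur th rc using ss by algebra
      next
        case 3
        have br: "bidiag_row d (thetaL a d) (thetaL b d) zz L U 1 rho i =
          thetaL a d i * rho i + (if i = 0 then 0 else L i * rho (i - 1))"
          by (simp add: bidiag_row_def)
        have p: "perm13 3 = 1" "sgnaut (-1) (-1) 1 = -1" by (simp_all add: perm13_def sgnaut_def)
        have "restr e (BIgen k1 k2 k3 3 f) (t2 + i) c = (- s * (of_nat i - 2 * K2 + K2 * (1 + s) + 1 / 2 + K1) + K2) * restr e f (t2 + i) c
          - \<i> * s * (cnum k3 (Suc c) * restr e f (t2 + i - 1) (Suc c))"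
          using restr_BIgen3[OF e fM, of "t2 + i" c] t2pos
          unfolding cnum_def[of k2] c K1_def[symmetric] K2_def[symmetric] by simp
        then show ?thesis unfolding 3 p br c_def[symmetric] Lr th rc using ss by algebra
      qed
    qed
    have p: "perm13 m \<in> {1,2,3}" using m by (auto simp: perm13_def)
    have "Wop m (\<lambda>i. if i \<le> d then mu i * rho i else 0)
        = (\<lambda>i. if i \<le> d then mu i * (sgnaut (-1) (-1) (perm13 m) * bidiag_row d (thetaL a d) (thetaL b d) zz L U (perm13 m) rho i) else 0)"
      unfolding Wop_def using B_scaled[OF mu(2) ph p, of rho] by (auto simp: fun_eq_iff)
    then show "Wop m (\<lambda>i. if i \<le> d then mu i * restr e f (t2 + i) (n - (t2 + i)) else 0) =
       (\<lambda>i. if i \<le> d then mu i * restr e (BIgen k1 k2 k3 m f) (t2 + i) (n - (t2 + i)) else 0)"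
      using row unfolding rho_def by (auto simp: fun_eq_iff)
  qed (use d(2) in \<open>auto simp: Z_def\<close>)
  moreover have "MnZ k1 k2 k3 n (Z \<union> (\<lambda>i. t2 + i) ` {..d}) = {\<lambda>_. 0}"
  proof (rule MnZ_all[OF k1], rule subsetI)
    fix x assume "x \<in> {..n}"
    then have "x \<in> Z \<or> x = t2 + (x - t2) \<and> x - t2 \<le> d" using d(2) by (auto simp: Z_def)
    then show "x \<in> Z \<union> (\<lambda>i. t2 + i) ` {..d}" by blast
  qed
  ultimately have "bimod_iso (MnZ k1 k2 k3 n Z, BIgen k1 k2 k3) (dsum2 (coords d, Wop))"
    using bimod_iso_of_quot_iso subspace_MnZ by metis
  then show ?thesis unfolding W[symmetric] unfolding Z_def a_def b_def N_def d_def .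
qed

section \<open>Irreducibility and isomorphisms for k1 >= 0\<close>

lemma bidiag_op_closed: "i \<in> {1,2,3} \<Longrightarrow> v \<in> coords d \<Longrightarrow> bidiag_op d th ths phi z i v \<in> coords d"
  by (auto simp: coords_def bidiag_op1 bidiag_op2 bidiag_op3)

lemma bihom_perm:
  assumes "bihom d f A A'" "\<sigma> 1 \<in> {1,2,3}" "\<sigma> 2 \<in> {1,2,3}" "\<sigma> 3 \<in> {1,2,3}"
  shows "bihom d f (\<lambda>i. A (\<sigma> i)) (\<lambda>i. A' (\<sigma> i))"
proof -
  have "f (A i v) = A' i (f v)" if "i \<in> {1,2,3}" "v \<in> coords d" for i v
    using assms(1) that by (auto simp: bihom_def)
  then show ?thesis using assms unfolding bihom_def by blast
qed

text \<open>The scalar \<open>c\<close> carries the sign of a twist; it must be the same for both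
  modules, and linearity then takes it through \<open>f\<close>.\<close>

lemma bimod_iso_of_bihom:
  assumes hom: "bihom d f A A'" and bij: "bij_betw f (coords d) (coords d)"
    and cl: "\<And>i v. i \<in> {1,2,3} \<Longrightarrow> v \<in> coords d \<Longrightarrow> A i v \<in> coords d"
    and M: "fst M = coords d" "fst M' = coords d"
    and act: "\<And>i. i \<in> {1,2,3} \<Longrightarrow> \<exists>c. \<exists>j\<in>{1,2,3}. \<forall>v. snd M i v = (\<lambda>y. c * A j v y) \<and> snd M' i v = (\<lambda>y. c * A' j v y)"
  shows "bimod_iso M M'"
proof -
  have lin: "lin_on (coords d) f" using hom by (simp add: bihom_def)
  have "f (snd M i v) = snd M' i (f v)" if i: "i \<in> {1,2,3}" and v: "v \<in> coords d" for i v
  proof -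
    obtain c j where j: "j \<in> {1,2,3}"
      and a: "\<And>v. snd M i v = (\<lambda>y. c * A j v y)" "\<And>v. snd M' i v = (\<lambda>y. c * A' j v y)"
      using act[OF i] by blast
    have "f (A j v) = A' j (f v)" using hom j v by (auto simp: bihom_def)
    then show ?thesis unfolding a lin_on_scale[OF lin cl[OF j v]] by simp
  qed
  then show ?thesis unfolding bimod_iso_def M using lin bij by blast
qed

lemma bimod_irreducible_twist:
  assumes irr: "bimod_irreducible (coords d, A)"
    and \<sigma>: "\<And>j. j \<in> {1,2,3} \<Longrightarrow> \<exists>i\<in>{1,2,3}. \<sigma> i = j" and sg: "\<And>j. j \<in> {1,2,3} \<Longrightarrow> sg j \<noteq> 0"
  shows "bimod_irreducible (twist sg \<sigma> (coords d, A))"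
proof -
  have "A j v \<in> U"
    if U: "subspace_of U" "\<forall>i\<in>{1,2,3}. \<forall>v\<in>U. (\<lambda>y. sg (\<sigma> i) * A (\<sigma> i) v y) \<in> U" and j: "j \<in> {1,2,3}" and v: "v \<in> U" for U j v
  proof -
    obtain i where i: "i \<in> {1,2,3}" "\<sigma> i = j" using \<sigma>[OF j] by blast
    then have "(\<lambda>y. sg j * A j v y) \<in> U" using U(2) v by blast
    then have "(\<lambda>y. inverse (sg j) * (sg j * A j v y)) \<in> U" using U(1) by (simp add: subspace_of_def)
    moreover have "(\<lambda>y. inverse (sg j) * (sg j * A j v y)) = A j v" using sg[OF j] by (simp add: fun_eq_iff)
    ultimately show ?thesis by simp
  qed
  then show ?thesis using irr unfolding bimod_irreducible_def twist_def by simp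
qed

lemma irreducible_E_real:
  assumes d: "odd d"
    and o: "\<And>m. 1 \<le> m \<Longrightarrow> m \<le> d \<Longrightarrow> c\<^sup>2 \<noteq> (2 * a + 2 * b - real d + 2 * real m - 1)\<^sup>2 / 4
       \<and> c\<^sup>2 \<noteq> (2 * a - 2 * b + real d - 2 * real m + 1)\<^sup>2 / 4"
    and e: "2 * b + real d < 0"
  shows "bimod_irreducible (Emod (of_real a) (of_real b) (of_real c) d)"
proof (rule irreducible_E[OF d])
  fix m :: nat assume m: "1 \<le> m" "m \<le> d"
  have "(of_real (c\<^sup>2) :: complex) \<noteq> of_real ((2 * a + 2 * b - real d + 2 * real m - 1)\<^sup>2 / 4)
     \<and> (of_real (c\<^sup>2) :: complex) \<noteq> of_real ((2 * a - 2 * b + real d - 2 * real m + 1)\<^sup>2 / 4)"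
    using o[OF m] unfolding of_real_eq_iff .
  then show "(of_real c)\<^sup>2 \<noteq> (2 * of_real a + 2 * of_real b - of_nat d + 2 * of_nat m - 1)\<^sup>2 / (4 :: complex)
     \<and> (of_real c)\<^sup>2 \<noteq> (2 * of_real a - 2 * of_real b + of_nat d - 2 * of_nat m + 1)\<^sup>2 / (4 :: complex)"
    by simp
next
  fix i :: nat assume "i \<le> 2 * d"
  then have "real i \<le> 2 * real d" by (metis of_nat_le_iff of_nat_mult of_nat_numeral)
  then have "2 * b + real i \<noteq> real d" using e by linarith
  then have "(of_real (2 * b + real i) :: complex) \<noteq> of_real (real d)" unfolding of_real_eq_iff .
  then show "2 * of_real b + of_nat i \<noteq> (of_nat d :: complex)" by simp
qed

lemma irreducible_O_real:
  assumes d: "even d"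
    and o: "\<And>m. m \<le> d \<Longrightarrow> real d + 1 - 2 * real m - 2 * a - 2 * b - 2 * c \<noteq> 0
       \<and> 2 * b - real d - 1 + 2 * real m - 2 * a - 2 * c \<noteq> 0
       \<and> real d + 1 - 2 * real m - 2 * a - 2 * b + 2 * c \<noteq> 0
       \<and> 2 * b - 2 * a + 2 * c - real d - 1 + 2 * real m \<noteq> 0"
    and e: "2 * b + real d < 0"
  shows "bimod_irreducible (Omod (of_real a) (of_real b) (of_real c) d)"
proof (rule irreducible_O[OF d])
  have ne: "(of_real x :: complex) \<noteq> 0" if "x \<noteq> 0" for x using that by simp
  fix m :: nat assume m: "m \<le> d"
  show "of_nat d + 1 - 2 * of_nat m - 2 * of_real a - 2 * of_real b - 2 * of_real c \<noteq> (0 :: complex)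
      \<and> 2 * of_real b - of_nat d - 1 + 2 * of_nat m - 2 * of_real a - 2 * of_real c \<noteq> (0 :: complex)"
    using ne[of "real d + 1 - 2 * real m - 2 * a - 2 * b - 2 * c"]
      ne[of "2 * b - real d - 1 + 2 * real m - 2 * a - 2 * c"] o[OF m] by simp
  show "of_nat d + 1 - 2 * of_nat m - 2 * of_real a - 2 * of_real b + 2 * of_real c \<noteq> (0 :: complex)
      \<and> 2 * of_real b - 2 * of_real a + 2 * of_real c - of_nat d - 1 + 2 * of_nat m \<noteq> (0 :: complex)"
    using ne[of "real d + 1 - 2 * real m - 2 * a - 2 * b + 2 * c"]
      ne[of "2 * b - 2 * a + 2 * c - real d - 1 + 2 * real m"] o[OF m] by simp
next
  fix i :: nat assume "i \<le> 2 * d"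
  then have "real i \<le> 2 * real d" by (metis of_nat_le_iff of_nat_mult of_nat_numeral)
  then have "2 * b + real i \<noteq> real d" using e by linarith
  then have "(of_real (2 * b + real i) :: complex) \<noteq> of_real (real d)" unfolding of_real_eq_iff .
  then show "2 * of_real b + of_nat i \<noteq> (of_nat d :: complex)" by simp
qed

text \<open>Once k2 and k3 are expressed by t2 and t3, the quantities x and y whose squares must
  differ from (n+1)^2 satisfy \<bar>x\<bar> < n + 1 < \<bar>y\<bar>. The bound on y uses k1 >=
  0.\<close>

lemma irreducible_Emod:
  fixes k1 k2 k3 :: real and n t2 t3 :: nat
  assumes n: "odd n" and k1: "k1 \<ge> 0" and odd: "odd t2" "odd t3" and tk: "2 * k2 = - real t2" "2 * k3 = - real t3"
    and le: "t2 + t3 \<le> n"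
  shows "bimod_irreducible (Emod (of_real (k1 + k3 + (real n + 1) / 2)) (of_real (- k1 - k2 - (real n + 1) / 2))
        (of_real ((real n + 1) / 2)) (n - t2 - t3))"
proof (rule irreducible_E_real)
  show "odd (n - t2 - t3)" using n odd le by auto
  have D: "real (n - t2 - t3) = real n - real t2 - real t3" using le by simp
  show "2 * (- k1 - k2 - (real n + 1) / 2) + real (n - t2 - t3) < 0"
    unfolding D using k1 tk by (simp add: field_simps)
  fix m :: nat assume m: "1 \<le> m" "m \<le> n - t2 - t3"
  define c x y where "c = (real n + 1) / 2"
    and "x = 2 * (k1 + k3 + c) + 2 * (- k1 - k2 - c) - real (n - t2 - t3) + 2 * real m - 1"
    and "y = 2 * (k1 + k3 + c) - 2 * (- k1 - k2 - c) + real (n - t2 - t3) - 2 * real m + 1"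
  have mr: "1 \<le> real m" "real m \<le> real n - real t2 - real t3" using m le by linarith+
  have c: "2 * c = real n + 1" by (simp add: c_def)
  have "x = 2 * real t2 - real n + 2 * real m - 1" unfolding x_def D using tk by simp
  then have "\<bar>x\<bar> < \<bar>2 * c\<bar>" unfolding c using mr by linarith
  then have "x\<^sup>2 < (2 * c)\<^sup>2" by (simp only: not_le[symmetric] abs_le_square_iff not_False_eq_True)
  then have 1: "c\<^sup>2 \<noteq> x\<^sup>2 / 4" by (simp add: power_mult_distrib)
  have "y = 4 * k1 + 3 * real n + 3 - 2 * real t2 - 2 * real t3 - 2 * real m"
    unfolding y_def D using tk c by simp
  then have "\<bar>2 * c\<bar> < \<bar>y\<bar>" unfolding c using mr k1 by linarith
  then have "(2 * c)\<^sup>2 < y\<^sup>2" by (simp only: not_le[symmetric] abs_le_square_iff not_False_eq_True)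
  then have 2: "c\<^sup>2 \<noteq> y\<^sup>2 / 4" by (simp add: power_mult_distrib)
  show "((real n + 1) / 2)\<^sup>2 \<noteq> (2 * (k1 + k3 + (real n + 1) / 2) + 2 * (- k1 - k2 - (real n + 1) / 2) - real (n - t2 - t3) + 2 * real m - 1)\<^sup>2 / 4 \<and>
     ((real n + 1) / 2)\<^sup>2 \<noteq> (2 * (k1 + k3 + (real n + 1) / 2) - 2 * (- k1 - k2 - (real n + 1) / 2) + real (n - t2 - t3) - 2 * real m + 1)\<^sup>2 / 4"
    using 1 2 unfolding x_def y_def c_def by blast
qed

lemma irreducible_Omod:
  fixes k1 k2 k3 :: real and n t2 t3 :: nat
  assumes k1: "k1 \<ge> 0" and odd: "odd t2" and tk: "2 * k2 = - real t2" "2 * k3 = - real t3" and le: "t2 + t3 \<le> n"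
  shows "bimod_irreducible (Omod (of_real k1) (of_real (- (k1 + k2 + k3) - real n - 1)) (of_real k3) (t2 - 1))"
proof (rule irreducible_O_real)
  show "even (t2 - 1)" using odd by simp
  have D: "real (t2 - 1) = real t2 - 1" using odd by (auto elim: oddE)
  have le': "real t2 + real t3 \<le> real n" "0 \<le> real t3" using le by linarith+
  have "2 * (- (k1 + k2 + k3) - real n - 1) + real (t2 - 1) = - 2 * k1 + 2 * real t2 + real t3 - 2 * real n - 3"
    unfolding D using tk by (simp add: algebra_simps)
  then show "2 * (- (k1 + k2 + k3) - real n - 1) + real (t2 - 1) < 0" using k1 le' by linarith
  fix m :: nat assume "m \<le> t2 - 1"
  then have m: "real m \<le> real t2 - 1" using D by linarith
  have k: "k2 = - real t2 / 2" "k3 = - real t3 / 2" using tk by simp_all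
  \<comment> \<open>With p = n + 1 - m and q = n + 1 - t3 - m, both positive, the four expressions
    are 2p, -4 k1 - 2q, 2q and -4 k1 - 2p.\<close>
  have "real (t2 - 1) + 1 - 2 * real m - 2 * k1 - 2 * (- (k1 + k2 + k3) - real n - 1) - 2 * k3 = 2 * (real n + 1 - real m)"
    "2 * (- (k1 + k2 + k3) - real n - 1) - real (t2 - 1) - 1 + 2 * real m - 2 * k1 - 2 * k3 = - 4 * k1 - 2 * (real n + 1 - real t3 - real m)"
    "real (t2 - 1) + 1 - 2 * real m - 2 * k1 - 2 * (- (k1 + k2 + k3) - real n - 1) + 2 * k3 = 2 * (real n + 1 - real t3 - real m)"
    "2 * (- (k1 + k2 + k3) - real n - 1) - 2 * k1 + 2 * k3 - real (t2 - 1) - 1 + 2 * real m = - 4 * k1 - 2 * (real n + 1 - real m)"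
    unfolding D k by (simp_all add: algebra_simps)
  moreover have "0 < real n + 1 - real m" "0 < real n + 1 - real t3 - real m" using m le' by linarith+
  ultimately show "real (t2 - 1) + 1 - 2 * real m - 2 * k1 - 2 * (- (k1 + k2 + k3) - real n - 1) - 2 * k3 \<noteq> 0 \<and>
     2 * (- (k1 + k2 + k3) - real n - 1) - real (t2 - 1) - 1 + 2 * real m - 2 * k1 - 2 * k3 \<noteq> 0 \<and>
     real (t2 - 1) + 1 - 2 * real m - 2 * k1 - 2 * (- (k1 + k2 + k3) - real n - 1) + 2 * k3 \<noteq> 0 \<and>
     2 * (- (k1 + k2 + k3) - real n - 1) - 2 * k1 + 2 * k3 - real (t2 - 1) - 1 + 2 * real m \<noteq> 0"
    using k1 by auto
qed

text \<open>Exchanging X and Z exchanges \<open>a\<close> and \<open>c\<close>; afterwards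
  \<open>b\<close> is replaced by \<open>- b\<close>, which \<open>bihom_E_neg\<close> permits
  because \<open>b\<close> is sufficiently negative.\<close>

lemma bimod_iso_E:
  fixes a b c :: real
  assumes d: "odd d" and irr: "bimod_irreducible (Emod (of_real a) (of_real b) (of_real c) d)"
    and b: "2 * b + real d + 1 < 0"
  shows "bimod_iso (twist (sgnaut (-1) (-1)) perm13 (Emod (of_real a) (of_real b) (of_real c) d))
    (twist (sgnaut 1 (-1)) id (Emod (of_real c) (of_real (- b)) (of_real a) d))"
proof -
  have nz: "2 * of_real b + of_nat j + 1 \<noteq> (0 :: complex)" if "j \<le> d" for j
  proof -
    have "2 * b + real j + 1 \<noteq> 0" using b that by linarith
    then have "complex_of_real (2 * b + real j + 1) \<noteq> 0" by (simp only: of_real_eq_0_iff not_False_eq_True)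
    then show ?thesis by simp
  qed
  define A where "A = Eop (of_real a) (of_real b) (of_real c) d"
  define A' where "A' = Eop (of_real c) (of_real b) (of_real a) d"
  define A'' where "A'' = Eop (of_real c) (of_real (- b)) (of_real a) d"
  obtain f where f: "bihom d f A (\<lambda>i. A' (perm13 i))" "f (unit_at 0) = unit_at 0"
    using bihom_E_swap13[OF d nz] unfolding A_def A'_def by blast
  obtain g where g: "bihom d g A' A''" "g (unit_at 0) \<noteq> (\<lambda>_. 0)"
    using bihom_E_neg[OF d refl, of "- b" "of_real c" "of_real a"] b unfolding A'_def A''_def by auto
  have h: "bihom d (g \<circ> f) A (\<lambda>i. A'' (perm13 i))"
    by (rule bihom_comp[OF f(1) bihom_perm[OF g(1)]]) (simp_all add: perm13_def)
  have E: "Emod (of_real a) (of_real b) (of_real c) d = (coords d, A)" 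
     "Emod (of_real c) (of_real (- b)) (of_real a) d = (coords d, A'')"
    unfolding A_def A''_def by (rule prod_eqI; simp add: Emod_bidiag fst_bidiag)+
  have cl: "A i v \<in> coords d" "lin_on (coords d) (A'' i)" if "i \<in> {1,2,3}" "v \<in> coords d" for i v
    using that unfolding A_def A''_def Emod_bidiag by (auto intro: bidiag_op_closed lin_on_bidiag_op)
  have "bij_betw (g \<circ> f) (coords d) (coords d)"
  proof (rule bihom_bij[OF h])
    show "bimod_irreducible (coords d, A)" using irr unfolding E .
    show "unit_at 0 \<in> coords d" by (simp add: unit_at_coords)
    show "(g \<circ> f) (unit_at 0) \<noteq> (\<lambda>_. 0)" using f(2) g(2) by simp
    show "lin_on (coords d) (A'' (perm13 i))" if "i \<in> {1,2,3}" for i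
      using cl(2)[of "perm13 i" "unit_at 0"] that by (auto simp: perm13_def unit_at_coords)
  qed (rule cl)
  then show ?thesis
  proof (rule bimod_iso_of_bihom[OF h _ cl(1)])
    fix i :: nat assume i: "i \<in> {1,2,3}"
    show "\<exists>c'. \<exists>j\<in>{1,2,3}. \<forall>v. snd (twist (sgnaut (-1) (-1)) perm13 (Emod (of_real a) (of_real b) (of_real c) d)) i v
       = (\<lambda>y. c' * A j v y) \<and> snd (twist (sgnaut 1 (-1)) id (Emod (of_real c) (of_real (- b)) (of_real a) d)) i v
       = (\<lambda>y. c' * A'' (perm13 j) v y)"
      using i unfolding E
      \<comment> \<open>Conjugation by (1 3) moves the minus signs of (-1,-1) from X, Y to Z, Y;
        this is the sign pattern (1,-1).\<close>
      by (intro exI[of _ "sgnaut 1 (-1) i"] bexI[of _ "perm13 i"]) (auto simp: twist_def perm13_def sgnaut_def)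
  qed (simp_all add: twist_def Emod_bidiag Omod_bidiag fst_bidiag)
qed

lemma bimod_iso_O_swap13:
  fixes a b c :: real
  assumes d: "even d" and irr: "bimod_irreducible (Omod (of_real a) (of_real b) (of_real c) d)"
    and b: "2 * b + real d + 1 < 0"
  shows "bimod_iso (twist (sgnaut 1 1) perm13 (Omod (of_real a) (of_real b) (of_real c) d))
    (Omod (of_real c) (of_real b) (of_real a) d)"
proof -
  have nz: "2 * of_real b + of_nat j + 1 \<noteq> (0 :: complex)" if "j \<le> d" for j
  proof -
    have "2 * b + real j + 1 \<noteq> 0" using b that by linarith
    then have "complex_of_real (2 * b + real j + 1) \<noteq> 0" by (simp only: of_real_eq_0_iff not_False_eq_True)
    then show ?thesis by simp
  qed
  define A where "A = Oop (of_real a) (of_real b) (of_real c) d"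
  define A' where "A' = Oop (of_real c) (of_real b) (of_real a) d"
  obtain f where f: "bihom d f A (\<lambda>i. A' (perm13 i))" "f (unit_at 0) = unit_at 0"
    using bihom_O_swap13[OF d nz] unfolding A_def A'_def by blast
  have E: "Omod (of_real a) (of_real b) (of_real c) d = (coords d, A)" 
     "Omod (of_real c) (of_real b) (of_real a) d = (coords d, A')"
    unfolding A_def A'_def by (rule prod_eqI; simp add: Omod_bidiag fst_bidiag)+
  have cl: "A i v \<in> coords d" "lin_on (coords d) (A' i)" if "i \<in> {1,2,3}" "v \<in> coords d" for i v
    using that unfolding A_def A'_def Omod_bidiag by (auto intro: bidiag_op_closed lin_on_bidiag_op)
  have "bij_betw f (coords d) (coords d)"
  proof (rule bihom_bij[OF f(1)])
    show "bimod_irreducible (coords d, A)" using irr unfolding E .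
    show "unit_at 0 \<in> coords d" by (simp add: unit_at_coords)
    show "f (unit_at 0) \<noteq> (\<lambda>_. 0)" using f(2) by (auto simp: unit_at_def fun_eq_iff)
    show "lin_on (coords d) (A' (perm13 i))" if "i \<in> {1,2,3}" for i
      using cl(2)[of "perm13 i" "unit_at 0"] that by (auto simp: perm13_def unit_at_coords)
  qed (rule cl)
  then show ?thesis
  proof (rule bimod_iso_of_bihom[OF f(1) _ cl(1)])
    fix i :: nat assume i: "i \<in> {1,2,3}"
    show "\<exists>c'. \<exists>j\<in>{1,2,3}. \<forall>v. snd (twist (sgnaut 1 1) perm13 (Omod (of_real a) (of_real b) (of_real c) d)) i v
       = (\<lambda>y. c' * A j v y) \<and> snd (Omod (of_real c) (of_real b) (of_real a) d) i v
       = (\<lambda>y. c' * A' (perm13 j) v y)"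
      using i unfolding E
      by (intro exI[of _ 1] bexI[of _ "perm13 i"]) (auto simp: twist_def perm13_def sgnaut_def)
  qed (simp_all add: twist_def Emod_bidiag Omod_bidiag fst_bidiag)
qed

text \<open>The 3-cycle is realised by two transpositions: (1 2) exchanges the first two parameters,
  then (1 3) the first and the last.\<close>

lemma bimod_iso_O_perm132:
  fixes a b c :: real
  assumes d: "even d" and irr: "bimod_irreducible (Omod (of_real a) (of_real b) (of_real c) d)"
    and b: "2 * b + real d + 1 < 0" and a: "a \<ge> 0"
  shows "bimod_iso (twist (sgnaut 1 1) perm132 (Omod (of_real a) (of_real b) (of_real c) d))
    (Omod (of_real c) (of_real a) (of_real b) d)"
proof -
  have nz: "2 * of_real a + of_nat j + 1 \<noteq> (0 :: complex)" if "j \<le> d" for j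
  proof -
    have "2 * a + real j + 1 \<noteq> 0" using a by linarith
    then have "complex_of_real (2 * a + real j + 1) \<noteq> 0" by (simp only: of_real_eq_0_iff not_False_eq_True)
    then show ?thesis by simp
  qed
  define A where "A = Oop (of_real a) (of_real b) (of_real c) d"
  define A' where "A' = Oop (of_real b) (of_real a) (of_real c) d"
  define A'' where "A'' = Oop (of_real c) (of_real a) (of_real b) d"
  obtain f where f: "bihom d f A (\<lambda>i. A' (perm12 i))" "f (unit_at 0) \<noteq> (\<lambda>_. 0)"
    using bihom_O_swap12[OF d refl b] unfolding A_def A'_def by blast
  obtain g where g: "bihom d g A' (\<lambda>i. A'' (perm13 i))" "g (unit_at 0) = unit_at 0"
    using bihom_O_swap13[OF d nz] unfolding A'_def A''_def by blast
  have h: "bihom d (g \<circ> f) A (\<lambda>i. A'' (perm13 (perm12 i)))"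
    by (rule bihom_comp[OF f(1) bihom_perm[OF g(1)]]) (simp_all add: perm12_def)
  have E: "Omod (of_real a) (of_real b) (of_real c) d = (coords d, A)" 
     "Omod (of_real c) (of_real a) (of_real b) d = (coords d, A'')"
    unfolding A_def A''_def by (rule prod_eqI; simp add: Omod_bidiag fst_bidiag)+
  have irr': "bimod_irreducible (coords d, A)" using irr unfolding E .
  have cl: "A i v \<in> coords d" "lin_on (coords d) (A' i)" "lin_on (coords d) (A'' i)" if "i \<in> {1,2,3}" "v \<in> coords d" for i v
    using that unfolding A_def A'_def A''_def Omod_bidiag by (auto intro: bidiag_op_closed lin_on_bidiag_op)
  have u: "unit_at 0 \<in> coords d" by (simp add: unit_at_coords)
  \<comment> \<open>\<open>f\<close> is known only to be nonzero on the generator, whereas the value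
    of \<open>g\<close> is known at \<open>unit_at 0\<close>. Bijectivity of \<open>f\<close>
    supplies a preimage of \<open>unit_at 0\<close>, at which the composite is nonzero.\<close>
  have "bij_betw f (coords d) (coords d)"
  proof (rule bihom_bij[OF f(1) irr' cl(1) _ u f(2)])
    show "lin_on (coords d) (A' (perm12 i))" if "i \<in> {1,2,3}" for i
      using cl(2)[of "perm12 i" "unit_at 0"] that u by (auto simp: perm12_def)
  qed
  then obtain e where e: "e \<in> coords d" "f e = unit_at 0" using u by (metis bij_betw_imp_surj_on imageE)
  have "bij_betw (g \<circ> f) (coords d) (coords d)"
  proof (rule bihom_bij[OF h irr' cl(1) _ e(1)])
    have "unit_at 0 \<noteq> (\<lambda>_. 0)" by (auto simp: unit_at_def fun_eq_iff)
    then show "(g \<circ> f) e \<noteq> (\<lambda>_. 0)" using e(2) g(2) by simp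
    show "lin_on (coords d) (A'' (perm13 (perm12 i)))" if "i \<in> {1,2,3}" for i
      using cl(3)[of "perm13 (perm12 i)" "unit_at 0"] that u by (auto simp: perm12_def perm13_def)
  qed
  then show ?thesis
  proof (rule bimod_iso_of_bihom[OF h _ cl(1)])
    fix i :: nat assume i: "i \<in> {1,2,3}"
    show "\<exists>c'. \<exists>j\<in>{1,2,3}. \<forall>v. snd (twist (sgnaut 1 1) perm132 (Omod (of_real a) (of_real b) (of_real c) d)) i v
       = (\<lambda>y. c' * A j v y) \<and> snd (Omod (of_real c) (of_real a) (of_real b) d) i v
       = (\<lambda>y. c' * A'' (perm13 (perm12 j)) v y)"
      using i unfolding E
      by (intro exI[of _ 1] bexI[of _ "perm132 i"]) (auto simp: twist_def perm132_def perm12_def perm13_def sgnaut_def)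
  qed (simp_all add: twist_def Emod_bidiag Omod_bidiag fst_bidiag)
qed

theorem theorem8p7:
  fixes k1 k2 k3 :: real and n t2 t3 :: nat
  assumes "odd n"
    and "tval k2 = enat t2" and "tval k3 = enat t3"
    and "t2 + t3 \<le> n" and "enat n < tval k1"
  defines "K \<equiv> k1 + k2 + k3" and "N \<equiv> (real n + 1) / 2"
  defines "G \<equiv> BIgen k1 k2 k3"
    and "M \<equiv> Mn k1 k2 k3 n" and "M2 \<equiv> Mnx k1 k2 k3 n 2" and "M3 \<equiv> Mnx k1 k2 k3 n 3"
  defines "W1 \<equiv> twist (sgnaut (-1) (-1)) perm13
              (Emod (of_real (k1 + k3 + N)) (of_real (- k1 - k2 - N)) (of_real N) (n - t2 - t3))"
    and "W2 \<equiv> twist (sgnaut 1 1) perm13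
              (Omod (of_real k1) (of_real (- K - real n - 1)) (of_real k3) (t2 - 1))"
    and "W3 \<equiv> twist (sgnaut 1 1) perm132
              (Omod (of_real k1) (of_real (- K - real n - 1)) (of_real k2) (t3 - 1))"
  shows "bimod_iso (M2 \<inter> M3, G) (dsum2 W1)
    \<and> quot_iso (M3, G) (M2 \<inter> M3) (dsum2 W2) \<and> quot_iso (M, G) M2 (dsum2 W2)
    \<and> quot_iso (M2, G) (M2 \<inter> M3) (dsum2 W3) \<and> quot_iso (M, G) M3 (dsum2 W3)
    \<and> (k1 \<ge> 0 \<longrightarrow>
         bimod_irreducible W1 \<and> bimod_irreducible W2 \<and> bimod_irreducible W3
       \<and> bimod_iso W1 (twist (sgnaut 1 (-1)) id
            (Emod (of_real N) (of_real (k1 + k2 + N)) (of_real (k1 + k3 + N)) (n - t2 - t3)))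
       \<and> bimod_iso W2 (Omod (of_real k3) (of_real (- K - real n - 1)) (of_real k1) (t2 - 1))
       \<and> bimod_iso W3 (Omod (of_real k2) (of_real k1) (of_real (- K - real n - 1)) (t3 - 1)))"
proof -
  note t2 = assms(2) and t3 = assms(3) and le = assms(4) and k1 = assms(5)
  have odd: "odd t2" "odd t3" and tk: "2 * k2 = - real t2" "2 * k3 = - real t3"
    using tval_enat[OF t2] tval_enat[OF t3] by auto
  have M2: "M2 = MnZ k1 k2 k3 n {b. b < t2}" unfolding M2_def by (rule Mnx2_eq_MnZ[OF k1 t2])
  have M3: "M3 = MnZ k1 k2 k3 n {b. n < b + t3}" unfolding M3_def by (rule Mnx3_eq_MnZ[OF k1 t3])
  have M: "M = MnZ k1 k2 k3 n {}" unfolding M_def MnZ_empty ..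
  have M23: "M2 \<inter> M3 = MnZ k1 k2 k3 n ({b. b < t2} \<union> {b. n < b + t3})" unfolding M2 M3 MnZ_Un ..
  have 1: "bimod_iso (M2 \<inter> M3, G) (dsum2 W1)"
    unfolding M23 G_def W1_def N_def by (rule bimod_iso_W1[OF assms(1) k1 t2 t3 le])
  \<comment> \<open>Taking \<open>Z\<close> empty, or equal to the exponents cut out by M_n(x3),
    yields the two quotients isomorphic to W2 + W2 from one statement.\<close>
  have q2: "quot_iso (MnZ k1 k2 k3 n Z, G) (MnZ k1 k2 k3 n (Z \<union> {b. b < t2})) (dsum2 W2)"
    if "\<And>b. b \<in> Z \<Longrightarrow> t2 \<le> b" for Z
    unfolding G_def W2_def K_def by (rule quot_iso_W2[OF assms(1) k1 t2 t3 le that])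
  have q3: "quot_iso (MnZ k1 k2 k3 n Z, G) (MnZ k1 k2 k3 n (Z \<union> {b. n < b + t3})) (dsum2 W3)"
    if "\<And>b. b \<in> Z \<Longrightarrow> b + t3 \<le> n" for Z
    unfolding G_def W3_def K_def by (rule quot_iso_W3[OF assms(1) k1 t2 t3 le that])
  have 2: "quot_iso (M3, G) (M2 \<inter> M3) (dsum2 W2)" "quot_iso (M, G) M2 (dsum2 W2)"
    using q2[of "{b. n < b + t3}"] q2[of "{}"] le unfolding M23 unfolding M M2 M3 by (auto simp: Un_commute)
  have 3: "quot_iso (M2, G) (M2 \<inter> M3) (dsum2 W3)" "quot_iso (M, G) M3 (dsum2 W3)"
    using q3[of "{b. b < t2}"] q3[of "{}"] le unfolding M23 unfolding M M2 M3 by auto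
  have 4: "bimod_irreducible W1 \<and> bimod_irreducible W2 \<and> bimod_irreducible W3
       \<and> bimod_iso W1 (twist (sgnaut 1 (-1)) id
            (Emod (of_real N) (of_real (k1 + k2 + N)) (of_real (k1 + k3 + N)) (n - t2 - t3)))
       \<and> bimod_iso W2 (Omod (of_real k3) (of_real (- K - real n - 1)) (of_real k1) (t2 - 1))
       \<and> bimod_iso W3 (Omod (of_real k2) (of_real k1) (of_real (- K - real n - 1)) (t3 - 1))"
    if pos: "k1 \<ge> 0"
  proof -
    have i1: "bimod_irreducible (Emod (of_real (k1 + k3 + N)) (of_real (- k1 - k2 - N)) (of_real N) (n - t2 - t3))"
      unfolding N_def by (rule irreducible_Emod[OF assms(1) pos odd tk le])
    have i2: "bimod_irreducible (Omod (of_real k1) (of_real (- K - real n - 1)) (of_real k3) (t2 - 1))"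
      unfolding K_def by (rule irreducible_Omod[OF pos odd(1) tk le])
    \<comment> \<open>\<open>irreducible_Omod\<close> is reused with x2 and x3 exchanged; K is
      symmetric in k2 and k3.\<close>
    have "t3 + t2 \<le> n" "k1 + k2 + k3 = k1 + k3 + k2" using le by simp_all
    then have i3: "bimod_irreducible (Omod (of_real k1) (of_real (- K - real n - 1)) (of_real k2) (t3 - 1))"
      unfolding K_def using irreducible_Omod[OF pos odd(2) tk(2) tk(1)] by metis
    have tw: "bimod_irreducible (twist sg \<sigma> (bidiag d th ths phi z))"
      if "bimod_irreducible (bidiag d th ths phi z)" "\<sigma> = perm13 \<or> \<sigma> = perm132" "sg 1 \<noteq> 0" "sg 2 \<noteq> 0" "sg 3 \<noteq> 0"
      for sg \<sigma> d th ths phi z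
    proof (subst bidiag_pair, rule bimod_irreducible_twist)
      show "bimod_irreducible (coords d, bidiag_op d th ths phi z)" using that(1) by (subst (asm) bidiag_pair)
      show "\<exists>i\<in>{1,2,3}. \<sigma> i = j" if "j \<in> {1,2,3}" for j
        using that \<open>\<sigma> = perm13 \<or> \<sigma> = perm132\<close> by (auto simp: perm13_def perm132_def)
    qed (use that in auto)
    have sg: "sgnaut (-1) (-1) i \<noteq> 0" "sgnaut 1 1 i \<noteq> 0" for i by (simp_all add: sgnaut_def)
    have I: "bimod_irreducible W1" "bimod_irreducible W2" "bimod_irreducible W3"
      using i1 i2 i3 unfolding W1_def W2_def W3_def Emod_bidiag Omod_bidiag by (auto intro!: tw simp: sg)
    have le': "real t2 + real t3 \<le> real n" "1 \<le> real t2" "1 \<le> real t3"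
      using le odd by (auto elim: oddE)
    have D: "real (n - t2 - t3) = real n - real t2 - real t3" "real (t2 - 1) = real t2 - 1" "real (t3 - 1) = real t3 - 1"
      using le odd by (auto elim: oddE)
    have J1: "bimod_iso W1 (twist (sgnaut 1 (-1)) id
            (Emod (of_real N) (of_real (- (- k1 - k2 - N))) (of_real (k1 + k3 + N)) (n - t2 - t3)))"
      unfolding W1_def
    proof (rule bimod_iso_E[OF _ i1])
      show "odd (n - t2 - t3)" using assms(1) odd le by auto
      have "2 * N = real n + 1" by (simp add: N_def)
      then have "2 * (- k1 - k2 - N) + real (n - t2 - t3) + 1 = - 2 * k1 - real t3"
        unfolding D right_diff_distrib using tk by linarith
      then show "2 * (- k1 - k2 - N) + real (n - t2 - t3) + 1 < 0" using pos le'(3) by linarith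
    qed
    have neg: "- (- k1 - k2 - N) = k1 + k2 + N" by simp
    have J2: "bimod_iso W2 (Omod (of_real k3) (of_real (- K - real n - 1)) (of_real k1) (t2 - 1))"
      unfolding W2_def
    proof (rule bimod_iso_O_swap13[OF _ i2])
      show "even (t2 - 1)" using odd by simp
      have "2 * (- K - real n - 1) + real (t2 - 1) + 1 = - 2 * k1 + 2 * real t2 + real t3 - 2 * real n - 2"
        unfolding D K_def using tk by (simp add: algebra_simps)
      then show "2 * (- K - real n - 1) + real (t2 - 1) + 1 < 0" using pos le' by linarith
    qed
    have J3: "bimod_iso W3 (Omod (of_real k2) (of_real k1) (of_real (- K - real n - 1)) (t3 - 1))"
      unfolding W3_def
    proof (rule bimod_iso_O_perm132[OF _ i3 _ pos])
      show "even (t3 - 1)" using odd by simp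
      have "2 * (- K - real n - 1) + real (t3 - 1) + 1 = - 2 * k1 + real t2 + 2 * real t3 - 2 * real n - 2"
        unfolding D K_def using tk by (simp add: algebra_simps)
      then show "2 * (- K - real n - 1) + real (t3 - 1) + 1 < 0" using pos le' by linarith
    qed
    show ?thesis using I J1[unfolded neg] J2 J3 by (intro conjI)
  qed
  show ?thesis using 1 2 3 4 by blast
qed

end
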